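(* Let $1\leq p<\infty$, and let $E$ be an $\ell_\infty$-$V_p$-barrelled space. Then for a weak$^\ast$ bounded subset $B$ of $E'$ the following assertions are equivalent: (i) $B$ is a $p$-$(V)$ set; (ii) for every normed space $Y$ and each weakly sequentially $p$-precompact operator $T:Y\to E$, the set $T^\ast(B)$ is relatively compact in the Banach space $Y'_\beta$; (iii) $T^\ast(B)$ is relatively compact in $\ell_p$ for every operator $T:\ell_{p^\ast}^0\to E$ (or $T:c_0^0\to E$ if $p=1$). If additionally $E$ is sequentially complete, then (i)--(iii) are equivalent to (iv) $T^\ast(B)$ is relatively compact in $\ell_p$ for every operator $T:\ell_{p^\ast}\to E$ (or $T:c_0\to E$ if $p=1$).
   Context: All locally convex spaces are Hausdorff, over $\mathbb{F}\in\{\mathbb{R},\mathbb{C}\}$. An operator is a continuous linear map; $T^\ast$ is its adjoint. For a normed space $Y$, $Y'_\beta$ is its Banach dual. $p^\ast$ is the conjugate exponent of $p$; $\ell_{r}^0$ and $c_0^0$ are the linear spans of the canonical unit vectors in $\ell_r$ and $c_0$ with the induced norms, so that the duals of $\ell_{p^\ast}^0$ ($p>1$) and of $c_0^0$ ($p=1$) are canonically identified with $\ell_p$. Weak$^\ast$ bounded means bounded in $\sigma(E',E)$. The set $B$ is non-empty. A sequence $\{x_n\}_{n\in\omega}$ in $E$ is weakly $p$-summable if $(\langle\chi,x_n\rangle)_n\in\ell_p$ for every $\chi\in E'$; it is weakly $p$-Cauchy if for each pair of strictly increasing sequences $(k_n),(j_n)\subseteq\omega$ the sequence $\{x_{k_n}-x_{j_n}\}_n$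 is weakly $p$-summable. A non-empty $B\subseteq E'$ is a $p$-$(V)$ set if $\lim_n\sup_{\chi\in B}|\langle\chi,x_n\rangle|=0$ for every weakly $p$-summable sequence $\{x_n\}$ in $E$. $E$ is $\ell_\infty$-$V_p$-barrelled if every sequence in $E'$ which is (as a set) a $p$-$(V)$ set is equicontinuous. A subset of $E$ is weakly sequentially $p$-precompact if every sequence from it has a weakly $p$-Cauchy subsequence; an operator $T:Y\to E$ is weakly sequentially $p$-precompact if $T(U)$ is weakly sequentially $p$-precompact for some neighborhood $U$ of zero in $Y$. $E$ is sequentially complete if every Cauchy sequence in $E$ converges. *)

theory Defs
  imports "HOL-Analysis.Analysis"
begin

section \<open>The scalar field\<close>

text \<open>
  The scalars are the real or the complex numbers: up to isometric isomorphism of normed fields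
  (given by \<open>\<phi>\<close>) a member of this class is one of these two, and both are instances.
\<close>

class real_or_complex = real_normed_field +
  assumes ex_real_or_complex_iso:
    "\<exists>\<phi> :: 'a \<Rightarrow> complex. (range \<phi> = \<real> \<or> range \<phi> = UNIV) \<and>
       (\<forall>x y. \<phi> (x + y) = \<phi> x + \<phi> y) \<and> (\<forall>x y. \<phi> (x * y) = \<phi> x * \<phi> y) \<and>
       (\<forall>x. norm (\<phi> x) = norm x)"

instance real :: real_or_complex
proof
  show "\<exists>\<phi> :: real \<Rightarrow> complex. (range \<phi> = \<real> \<or> range \<phi> = UNIV) \<and>
       (\<forall>x y. \<phi> (x + y) = \<phi> x + \<phi> y) \<and> (\<forall>x y. \<phi> (x * y) = \<phi> x * \<phi> y) \<and>
       (\<forall>x. norm (\<phi> x) = norm x)"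
    by (rule exI[of _ complex_of_real]) (auto simp: Reals_def)
qed

instance complex :: real_or_complex
proof
  show "\<exists>\<phi> :: complex \<Rightarrow> complex. (range \<phi> = \<real> \<or> range \<phi> = UNIV) \<and>
       (\<forall>x y. \<phi> (x + y) = \<phi> x + \<phi> y) \<and> (\<forall>x y. \<phi> (x * y) = \<phi> x * \<phi> y) \<and>
       (\<forall>x. norm (\<phi> x) = norm x)"
    by (rule exI[of _ "\<lambda>x. x"]) auto
qed


section \<open>Hausdorff locally convex spaces\<close>

text \<open>
  Addition is continuous by the type class; the scalar multiplication is an explicit parameter
  because the scalars may be real or complex.
\<close>

locale locally_convex_space = vector_space smul
  for smul :: "'k::real_or_complex \<Rightarrow> 'e::{topological_ab_group_add, t2_space} \<Rightarrow> 'e" +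
  assumes continuous_scale: "continuous_on UNIV (\<lambda>(c, x). smul c x)"
    and convex_nhds: "\<And>U. \<lbrakk>open U; 0 \<in> U\<rbrakk> \<Longrightarrow>
      \<exists>V. open V \<and> 0 \<in> V \<and> V \<subseteq> U \<and>
        (\<forall>x\<in>V. \<forall>y\<in>V. \<forall>t\<in>{0..1}. smul (of_real (1 - t)) x + smul (of_real t) y \<in> V)"

definition top_dual ::
  "('k::real_or_complex \<Rightarrow> 'e::{topological_ab_group_add, t2_space} \<Rightarrow> 'e) \<Rightarrow> ('e \<Rightarrow> 'k) set" where
  "top_dual smul = {f. Vector_Spaces.linear smul (*) f \<and> continuous_on UNIV f}"

definition weak_star_topology ::
  "('k::real_or_complex \<Rightarrow> 'e::{topological_ab_group_add, t2_space} \<Rightarrow> 'e) \<Rightarrow> ('e \<Rightarrow> 'k) topology" where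
  "weak_star_topology smul =
     subtopology (product_topology (\<lambda>_. euclidean) UNIV) (top_dual smul)"

definition weak_star_bounded ::
  "('k::real_or_complex \<Rightarrow> 'e::{topological_ab_group_add, t2_space} \<Rightarrow> 'e) \<Rightarrow> ('e \<Rightarrow> 'k) set \<Rightarrow> bool" where
  "weak_star_bounded smul B \<longleftrightarrow> B \<subseteq> top_dual smul \<and>
     (\<forall>U. openin (weak_star_topology smul) U \<and> (\<lambda>_. 0) \<in> U \<longrightarrow>
        (\<exists>r>0. B \<subseteq> (\<lambda>f x. of_real r * f x) ` U))"

definition equicontinuous_functionals ::
  "('e::{topological_ab_group_add, t2_space} \<Rightarrow> 'k::real_or_complex) set \<Rightarrow> bool" where
  "equicontinuous_functionals A \<longleftrightarrow>
     (\<forall>x. \<forall>\<epsilon>>0. \<exists>U. open U \<and> x \<in> U \<and> (\<forall>f\<in>A. \<forall>y\<in>U. norm (f y - f x) < \<epsilon>))"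

definition tvs_sequentially_complete :: "'e::{topological_ab_group_add, t2_space} itself \<Rightarrow> bool" where
  "tvs_sequentially_complete _ \<longleftrightarrow>
     (\<forall>x :: nat \<Rightarrow> 'e.
        (\<forall>U. open U \<and> 0 \<in> U \<longrightarrow> (\<exists>N. \<forall>m\<ge>N. \<forall>n\<ge>N. x m - x n \<in> U)) \<longrightarrow> convergent x)"


section \<open>Normed spaces\<close>

text \<open>
  Normed spaces are given by an explicit carrier and operations, so that one can quantify over
  them inside a formula. The values of the operations outside the carrier are irrelevant.
  A quantifier over all \<open>('k, 'y + (nat \<Rightarrow> 'k)) nspace\<close> with \<open>'y\<close> a free type variable renders
  ``for every normed space'': \<open>'y\<close> is arbitrary, and the second summand ensures that spaces of
  scalar sequences are included whatever \<open>'y\<close> is.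
\<close>

record ('k, 'y) nspace =
  ns_carrier :: "'y set"
  ns_zero :: 'y
  ns_add :: "'y \<Rightarrow> 'y \<Rightarrow> 'y"
  ns_scale :: "'k \<Rightarrow> 'y \<Rightarrow> 'y"
  ns_norm :: "'y \<Rightarrow> real"

locale normed_space =
  fixes Y :: "('k::real_or_complex, 'y) nspace"
  assumes zero_closed: "ns_zero Y \<in> ns_carrier Y"
    and add_closed: "\<lbrakk>x \<in> ns_carrier Y; y \<in> ns_carrier Y\<rbrakk> \<Longrightarrow> ns_add Y x y \<in> ns_carrier Y"
    and scale_closed: "x \<in> ns_carrier Y \<Longrightarrow> ns_scale Y c x \<in> ns_carrier Y"
    and add_assoc: "\<lbrakk>x \<in> ns_carrier Y; y \<in> ns_carrier Y; z \<in> ns_carrier Y\<rbrakk> \<Longrightarrow>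
      ns_add Y (ns_add Y x y) z = ns_add Y x (ns_add Y y z)"
    and add_commute: "\<lbrakk>x \<in> ns_carrier Y; y \<in> ns_carrier Y\<rbrakk> \<Longrightarrow> ns_add Y x y = ns_add Y y x"
    and add_zero: "x \<in> ns_carrier Y \<Longrightarrow> ns_add Y x (ns_zero Y) = x"
    and add_inverse: "x \<in> ns_carrier Y \<Longrightarrow> \<exists>y\<in>ns_carrier Y. ns_add Y x y = ns_zero Y"
    and scale_one: "x \<in> ns_carrier Y \<Longrightarrow> ns_scale Y 1 x = x"
    and scale_scale: "x \<in> ns_carrier Y \<Longrightarrow> ns_scale Y a (ns_scale Y b x) = ns_scale Y (a * b) x"
    and scale_add_left: "x \<in> ns_carrier Y \<Longrightarrow>
      ns_scale Y (a + b) x = ns_add Y (ns_scale Y a x) (ns_scale Y b x)"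
    and scale_add_right: "\<lbrakk>x \<in> ns_carrier Y; y \<in> ns_carrier Y\<rbrakk> \<Longrightarrow>
      ns_scale Y a (ns_add Y x y) = ns_add Y (ns_scale Y a x) (ns_scale Y a y)"
    and norm_eq_zero: "x \<in> ns_carrier Y \<Longrightarrow> ns_norm Y x = 0 \<longleftrightarrow> x = ns_zero Y"
    and norm_nonneg: "x \<in> ns_carrier Y \<Longrightarrow> 0 \<le> ns_norm Y x"
    and norm_triangle: "\<lbrakk>x \<in> ns_carrier Y; y \<in> ns_carrier Y\<rbrakk> \<Longrightarrow>
      ns_norm Y (ns_add Y x y) \<le> ns_norm Y x + ns_norm Y y"
    and norm_scale: "x \<in> ns_carrier Y \<Longrightarrow> ns_norm Y (ns_scale Y c x) = norm c * ns_norm Y x"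

text \<open>
  The distance is set to 0 outside the carrier because the locale \<open>Metric_space\<close> requires
  nonnegativity and symmetry on the whole type.
\<close>

definition ns_dist :: "('k::real_or_complex, 'y) nspace \<Rightarrow> 'y \<Rightarrow> 'y \<Rightarrow> real" where
  "ns_dist Y x y =
     (if x \<in> ns_carrier Y \<and> y \<in> ns_carrier Y then ns_norm Y (ns_add Y x (ns_scale Y (-1) y)) else 0)"

definition ns_topology :: "('k::real_or_complex, 'y) nspace \<Rightarrow> 'y topology" where
  "ns_topology Y = Metric_space.mtopology (ns_carrier Y) (ns_dist Y)"

definition ns_relatively_compact :: "('k::real_or_complex, 'y) nspace \<Rightarrow> 'y set \<Rightarrow> bool" where
  "ns_relatively_compact Y A \<longleftrightarrow>
     A \<subseteq> ns_carrier Y \<and> compactin (ns_topology Y) (ns_topology Y closure_of A)"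

definition ns_operator ::
  "('k::real_or_complex, 'y) nspace \<Rightarrow>
   ('k \<Rightarrow> 'e::{topological_ab_group_add, t2_space} \<Rightarrow> 'e) \<Rightarrow> ('y \<Rightarrow> 'e) \<Rightarrow> bool" where
  "ns_operator Y smul T \<longleftrightarrow>
     (\<forall>x\<in>ns_carrier Y. \<forall>y\<in>ns_carrier Y. T (ns_add Y x y) = T x + T y) \<and>
     (\<forall>c. \<forall>x\<in>ns_carrier Y. T (ns_scale Y c x) = smul c (T x)) \<and>
     continuous_map (ns_topology Y) euclidean T"

text \<open>
  The Banach dual. Functionals are \<open>undefined\<close> outside the carrier, so that a functional is
  determined by its values on the carrier.
\<close>

definition ns_dual :: "('k::real_or_complex, 'y) nspace \<Rightarrow> ('k, 'y \<Rightarrow> 'k) nspace" where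
  "ns_dual Y =
     \<lparr> ns_carrier = {f \<in> extensional (ns_carrier Y). ns_operator Y (*) f},
       ns_zero = restrict (\<lambda>_. 0) (ns_carrier Y),
       ns_add = (\<lambda>f g. restrict (\<lambda>y. f y + g y) (ns_carrier Y)),
       ns_scale = (\<lambda>c f. restrict (\<lambda>y. c * f y) (ns_carrier Y)),
       ns_norm = (\<lambda>f. SUP y\<in>{y \<in> ns_carrier Y. ns_norm Y y \<le> 1}. norm (f y)) \<rparr>"

definition ns_adjoint ::
  "('k::real_or_complex, 'y) nspace \<Rightarrow> ('y \<Rightarrow> 'e) \<Rightarrow> ('e \<Rightarrow> 'k) \<Rightarrow> ('y \<Rightarrow> 'k)" where
  "ns_adjoint Y T f = restrict (f \<circ> T) (ns_carrier Y)"


section \<open>Sequence spaces\<close>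

definition seq_space :: "(nat \<Rightarrow> 'k::real_or_complex) set \<Rightarrow> ((nat \<Rightarrow> 'k) \<Rightarrow> real) \<Rightarrow> ('k, nat \<Rightarrow> 'k) nspace" where
  "seq_space C N =
     \<lparr> ns_carrier = C,
       ns_zero = (\<lambda>_. 0),
       ns_add = (\<lambda>x y n. x n + y n),
       ns_scale = (\<lambda>c x n. c * x n),
       ns_norm = N \<rparr>"

definition lp_set :: "real \<Rightarrow> (nat \<Rightarrow> 'k::real_or_complex) set" where
  "lp_set r = {x. summable (\<lambda>n. norm (x n) powr r)}"

definition lp_norm :: "real \<Rightarrow> (nat \<Rightarrow> 'k::real_or_complex) \<Rightarrow> real" where
  "lp_norm r x = (\<Sum>n. norm (x n) powr r) powr (1 / r)"

definition sup_norm :: "(nat \<Rightarrow> 'k::real_or_complex) \<Rightarrow> real" where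
  "sup_norm x = (SUP n. norm (x n))"

definition unit_seq :: "nat \<Rightarrow> nat \<Rightarrow> 'k::real_or_complex" where
  "unit_seq n = (\<lambda>m. if m = n then 1 else 0)"

definition span_unit_seq :: "(nat \<Rightarrow> 'k::real_or_complex) set" where
  "span_unit_seq = {x. \<exists>F a. finite F \<and> x = (\<lambda>m. \<Sum>n\<in>F. a n * unit_seq n m)}"

definition lp_space :: "real \<Rightarrow> ('k::real_or_complex, nat \<Rightarrow> 'k) nspace" where
  "lp_space r = seq_space (lp_set r) (lp_norm r)"

definition lp_space0 :: "real \<Rightarrow> ('k::real_or_complex, nat \<Rightarrow> 'k) nspace" where
  "lp_space0 r = seq_space span_unit_seq (lp_norm r)"

definition c0_space :: "('k::real_or_complex, nat \<Rightarrow> 'k) nspace" where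
  "c0_space = seq_space {x. x \<longlonglongrightarrow> 0} sup_norm"

definition c0_space0 :: "('k::real_or_complex, nat \<Rightarrow> 'k) nspace" where
  "c0_space0 = seq_space span_unit_seq sup_norm"

definition conjugate_exponent :: "real \<Rightarrow> real" where
  "conjugate_exponent p = p / (p - 1)"

definition predual :: "real \<Rightarrow> ('k::real_or_complex, nat \<Rightarrow> 'k) nspace" where
  "predual p = (if p = 1 then c0_space else lp_space (conjugate_exponent p))"

definition predual0 :: "real \<Rightarrow> ('k::real_or_complex, nat \<Rightarrow> 'k) nspace" where
  "predual0 p = (if p = 1 then c0_space0 else lp_space0 (conjugate_exponent p))"

text \<open>The canonical identification of the duals of \<open>predual p\<close> and \<open>predual0 p\<close> with \<open>lp_space p\<close>.\<close>

definition seq_of_functional :: "((nat \<Rightarrow> 'k::real_or_complex) \<Rightarrow> 'k) \<Rightarrow> (nat \<Rightarrow> 'k)" where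
  "seq_of_functional f = (\<lambda>n. f (unit_seq n))"


section \<open>Weakly \<open>p\<close>-summable sequences and the derived notions\<close>

definition weakly_p_summable ::
  "('k::real_or_complex \<Rightarrow> 'e::{topological_ab_group_add, t2_space} \<Rightarrow> 'e) \<Rightarrow> real \<Rightarrow> (nat \<Rightarrow> 'e) \<Rightarrow> bool" where
  "weakly_p_summable smul p x \<longleftrightarrow> (\<forall>f\<in>top_dual smul. (\<lambda>n. f (x n)) \<in> lp_set p)"

definition weakly_p_Cauchy ::
  "('k::real_or_complex \<Rightarrow> 'e::{topological_ab_group_add, t2_space} \<Rightarrow> 'e) \<Rightarrow> real \<Rightarrow> (nat \<Rightarrow> 'e) \<Rightarrow> bool" where
  "weakly_p_Cauchy smul p x \<longleftrightarrow>
     (\<forall>k j :: nat \<Rightarrow> nat. strict_mono k \<and> strict_mono j \<longrightarrow>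
        weakly_p_summable smul p (\<lambda>n. x (k n) - x (j n)))"

text \<open>The supremum is taken in \<open>ennreal\<close>: it may be infinite for some \<open>n\<close>.\<close>

definition p_V_set ::
  "('k::real_or_complex \<Rightarrow> 'e::{topological_ab_group_add, t2_space} \<Rightarrow> 'e) \<Rightarrow> real \<Rightarrow> ('e \<Rightarrow> 'k) set \<Rightarrow> bool" where
  "p_V_set smul p B \<longleftrightarrow> B \<noteq> {} \<and> B \<subseteq> top_dual smul \<and>
     (\<forall>x. weakly_p_summable smul p x \<longrightarrow>
        (\<lambda>n. SUP f\<in>B. ennreal (norm (f (x n)))) \<longlonglongrightarrow> 0)"

definition linf_Vp_barrelled ::
  "('k::real_or_complex \<Rightarrow> 'e::{topological_ab_group_add, t2_space} \<Rightarrow> 'e) \<Rightarrow> real \<Rightarrow> bool" where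
  "linf_Vp_barrelled smul p \<longleftrightarrow>
     (\<forall>f :: nat \<Rightarrow> 'e \<Rightarrow> 'k. p_V_set smul p (range f) \<longrightarrow> equicontinuous_functionals (range f))"

definition weakly_seq_p_precompact ::
  "('k::real_or_complex \<Rightarrow> 'e::{topological_ab_group_add, t2_space} \<Rightarrow> 'e) \<Rightarrow> real \<Rightarrow> 'e set \<Rightarrow> bool" where
  "weakly_seq_p_precompact smul p A \<longleftrightarrow>
     (\<forall>x :: nat \<Rightarrow> 'e. range x \<subseteq> A \<longrightarrow>
        (\<exists>r :: nat \<Rightarrow> nat. strict_mono r \<and> weakly_p_Cauchy smul p (x \<circ> r)))"

definition weakly_seq_p_precompact_operator ::
  "('k::real_or_complex, 'y) nspace \<Rightarrow>
   ('k \<Rightarrow> 'e::{topological_ab_group_add, t2_space} \<Rightarrow> 'e) \<Rightarrow> real \<Rightarrow> ('y \<Rightarrow> 'e) \<Rightarrow> bool" where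
  "weakly_seq_p_precompact_operator Y smul p T \<longleftrightarrow> ns_operator Y smul T \<and>
     (\<exists>U. openin (ns_topology Y) U \<and> ns_zero Y \<in> U \<and> weakly_seq_p_precompact smul p (T ` U))"

end

theory Submission
  imports Defs "HOL-Complex_Analysis.Great_Picard"
begin

text \<open>
  Everything is reduced to sets of scalar sequences. If \<open>x\<close> is a sequence in \<open>E\<close> and \<open>B\<close> a set of
  functionals, consider the set of the sequences \<open>(\<chi>(x\<^sub>n))\<^sub>n\<close> with \<open>\<chi> \<in> B\<close>. When \<open>x\<close> is weakly
  \<open>p\<close>-summable this is a subset of \<open>\<ell>\<^sub>p\<close>, and the \<open>p\<close>-(V) property says that it is uniformly null.

  Operators \<open>T\<close> on the span of the unit vectors in the predual of \<open>\<ell>\<^sub>p\<close> correspond to weakly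
  \<open>p\<close>-summable sequences through \<open>x\<^sub>n = T e\<^sub>n\<close>, and \<open>T\<^sup>*\<chi>\<close> is the sequence \<open>(\<chi>(x\<^sub>n))\<^sub>n\<close>. That \<open>T e\<^sub>n\<close> is
  weakly \<open>p\<close>-summable is the duality of the predual with \<open>\<ell>\<^sub>p\<close>. Conversely, for weakly \<open>p\<close>-summable
  \<open>x\<close>, Hoelder's inequality makes the sums \<open>\<Sum> a\<^sub>i x\<^sub>i\<close> over \<open>a\<close> in the unit ball weakly bounded; a weakly
  bounded set is bounded in a locally convex space (\<open>weakly_bounded_imp_seminorm_bounded\<close>, which
  rests on the Hahn-Banach theorem), so \<open>a \<mapsto> \<Sum> a\<^sub>i x\<^sub>i\<close> is continuous. If \<open>E\<close> is sequentially complete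
  the series converge for all \<open>a\<close> in the predual itself, and restricting an operator from the
  predual to the span loses nothing, since only the vectors \<open>T e\<^sub>n\<close> matter. Hence (iii) and (iv) are
  about the same sets of sequences.

  (i) implies (iii): a pointwise bounded subset of \<open>\<ell>\<^sub>p\<close> is relatively compact if its tails are
  uniformly small. If the tails of the sequences \<open>(\<chi>(x\<^sub>n))\<^sub>n\<close> are not, there are consecutive blocks of
  indices on which some \<open>\<chi>\<^sub>k \<in> B\<close> has large \<open>\<ell>\<^sub>p\<close> norm. Vectors \<open>b\<^sub>k\<close> in the unit ball of the predual,
  supported in these blocks, attain these norms. As the blocks are disjoint, \<open>(T b\<^sub>k)\<^sub>k\<close> is again weakly
  \<open>p\<close>-summable, while \<open>\<chi>\<^sub>k(T b\<^sub>k)\<close> stays away from zero. (iii) implies (i) because a relatively compact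
  subset of \<open>\<ell>\<^sub>p\<close> is uniformly null.

  (i) implies (ii): for a weakly sequentially \<open>p\<close>-precompact \<open>T\<close>, a ball of \<open>Y\<close> is totally bounded for
  the pseudometric \<open>sup\<^bsub>\<chi> \<in> B\<^esub> |\<chi>(T y - T z)|\<close>: in a separated sequence, the successive differences of a
  subsequence with weakly \<open>p\<close>-Cauchy image would contradict the \<open>p\<close>-(V) property. On such a ball the
  functionals \<open>T\<^sup>*\<chi>\<close> are equicontinuous and pointwise bounded, and the argument of Arzela and Ascoli
  applies.

  (ii) implies (i): take for \<open>Y\<close> the span of the unit vectors in \<open>\<ell>\<^sub>1\<close>, whatever \<open>p\<close> is, and
  \<open>T e\<^sub>n = x\<^sub>n\<close>. A sequence in the unit ball of \<open>\<ell>\<^sub>1\<close> has a subsequence which consists of a fixed vector,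
  disjoint blocks of norm at most 2, and errors of geometrically decreasing norm; \<open>T\<close> maps it to a
  weakly \<open>p\<close>-Cauchy sequence. The span of the unit vectors in \<open>c\<^sub>0\<close> would not do for \<open>p = 1\<close>: no
  subsequence of \<open>(e\<^sub>1 + \<dots> + e\<^sub>n)\<^sub>n\<close> is weakly 1-Cauchy there. Relative compactness of \<open>T\<^sup>*(B)\<close> in \<open>\<ell>\<^sub>\<infinity>\<close>
  makes the null sequences \<open>(\<chi>(x\<^sub>n))\<^sub>n\<close> uniformly null.
\<close>

section \<open>Scalars\<close>

text \<open>
  The isometry onto a closed subset of the complex plane transports the Bolzano-Weierstrass property
  to the scalars, and with it completeness.
\<close>

instance real_or_complex \<subseteq> heine_borel
proof
  fix f :: "nat \<Rightarrow> 'a"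
  assume bnd: "bounded (range f)"
  obtain \<phi> :: "'a \<Rightarrow> complex" where r: "range \<phi> = \<real> \<or> range \<phi> = UNIV"
    and add: "\<And>x y. \<phi> (x + y) = \<phi> x + \<phi> y" and nrm: "\<And>x. norm (\<phi> x) = norm x"
    using ex_real_or_complex_iso by blast
  have diff: "\<phi> (x - y) = \<phi> x - \<phi> y" for x y
    using add[of "x - y" y] by simp
  have dst: "dist (\<phi> x) (\<phi> y) = dist x y" for x y
    by (simp add: dist_norm nrm flip: diff)
  have "bounded (range (\<phi> \<circ> f))"
    using bnd by (auto simp: bounded_iff nrm)
  then obtain l s where s: "strict_mono s" and lim: "(\<phi> \<circ> f \<circ> s) \<longlonglongrightarrow> l"
    by (metis bounded_imp_convergent_subsequence)
  have "closed (range \<phi>)" using r closed_complex_Reals by auto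
  then have "l \<in> range \<phi>"
    by (rule closed_sequentially[where f = "\<phi> \<circ> f \<circ> s"]) (use lim in auto)
  then obtain z where "l = \<phi> z" by auto
  then have "(f \<circ> s) \<longlonglongrightarrow> z"
    using lim by (simp add: tendsto_iff dst)
  with s show "\<exists>l r. strict_mono r \<and> (f \<circ> r) \<longlonglongrightarrow> l" by blast
qed

instance real_or_complex \<subseteq> banach ..

text \<open>
  Rescaling each coordinate by its own bound reduces the claim to uniformly bounded sequences, where it
  is the diagonal argument.
\<close>

lemma pointwise_convergent_subsequence:
  fixes f :: "nat \<Rightarrow> 'a \<Rightarrow> 'k::{real_normed_vector, heine_borel}"
  assumes "countable S" and bnd: "\<And>x. x \<in> S \<Longrightarrow> \<exists>M. \<forall>n. norm (f n x) \<le> M"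
  obtains r :: "nat \<Rightarrow> nat" where "strict_mono r" "\<And>x. x \<in> S \<Longrightarrow> convergent (\<lambda>n. f (r n) x)"
proof -
  obtain M where M: "\<And>x n. x \<in> S \<Longrightarrow> norm (f n x) \<le> M x"
    using bnd by metis
  define c where "c x = 1 + \<bar>M x\<bar>" for x
  have c: "c x > 0" for x by (simp add: c_def add_pos_nonneg)
  have "norm (f n x /\<^sub>R c x) \<le> 1" if "x \<in> S" for n x
    using M[OF that, of n] c[of x] by (simp add: c_def field_simps)
  then obtain r :: "nat \<Rightarrow> nat" where r: "strict_mono r"
    and l: "\<And>x. x \<in> S \<Longrightarrow> \<exists>l. (\<lambda>n. f (r n) x /\<^sub>R c x) \<longlonglongrightarrow> l"
    by (rule function_convergent_subsequence[OF assms(1), of "\<lambda>n x. f n x /\<^sub>R c x" 1]) auto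
  have "convergent (\<lambda>n. f (r n) x)" if x: "x \<in> S" for x
  proof -
    obtain l' where "(\<lambda>n. f (r n) x /\<^sub>R c x) \<longlonglongrightarrow> l'" using l x by blast
    then have "(\<lambda>n. c x *\<^sub>R (f (r n) x /\<^sub>R c x)) \<longlonglongrightarrow> c x *\<^sub>R l'"
      by (intro tendsto_intros)
    then show ?thesis using c[of x] by (auto simp: convergent_def)
  qed
  with r that show ?thesis by blast
qed

text \<open>
  Stands in for the sign or the complex conjugate phase of \<open>z\<close>, uniformly in both fields.
\<close>

lemma unit_rotation:
  fixes z :: "'k::real_normed_field"
  obtains u where "norm u = 1" "u * z = of_real (norm z)"
proof (cases "z = 0")
  case False
  then show ?thesis
    by (intro that[of "of_real (norm z) / z"]) (auto simp: norm_divide)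
qed (use that[of 1] in auto)

section \<open>The Hahn-Banach theorem for seminorms\<close>

text \<open>
  The route to a dominated linear functional: a sublinear functional that is minimal in the pointwise
  order is linear, and minimal ones exist by Zorn's lemma. All functionals are total, so no extension
  of partially defined functionals is needed.
\<close>

definition sublinear_functional :: "(real \<Rightarrow> 'e::ab_group_add \<Rightarrow> 'e) \<Rightarrow> ('e \<Rightarrow> real) \<Rightarrow> bool" where
  "sublinear_functional sc q \<longleftrightarrow>
     (\<forall>x y. q (x + y) \<le> q x + q y) \<and> (\<forall>t\<ge>0. \<forall>x. q (sc t x) = t * q x)"

lemma sublinear_functional_lower_bound:
  assumes "vector_space sc" "sublinear_functional sc q"
  shows "q 0 = 0" "- q (- x) \<le> q x"
proof -
  interpret vector_space sc by fact
  have "q (sc 0 x) = 0 * q x" using assms(2) unfolding sublinear_functional_def by blast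
  then show "q 0 = 0" by simp
  have "q (x + - x) \<le> q x + q (- x)" using assms(2) unfolding sublinear_functional_def by blast
  with \<open>q 0 = 0\<close> show "- q (- x) \<le> q x" by simp
qed

text \<open>
  The witness \<open>q'(y) = inf\<^bsub>t \<ge> 0\<^esub> q(y + t x) - t q(x)\<close> is the largest sublinear functional below \<open>q\<close>
  whose value at \<open>-x\<close> is at most \<open>-q(x)\<close>. It is used twice: it shows that a minimal functional is odd,
  and it makes a functional below it attain \<open>q\<close> at a prescribed point.
\<close>

lemma sublinear_functional_tilt:
  assumes vs: "vector_space sc" and q: "sublinear_functional sc q"
  obtains q' where "sublinear_functional sc q'" "q' \<le> q" "q' (- x) \<le> - q x"
proof -
  interpret vector_space sc by fact
  have sub: "q (a + b) \<le> q a + q b" and hom: "t \<ge> 0 \<Longrightarrow> q (sc t a) = t * q a" for a b t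
    using q unfolding sublinear_functional_def by auto
  define q' where "q' y = (INF t\<in>{0..}. q (y + sc t x) - t * q x)" for y
  have lower: "- q (- y) \<le> q (y + sc t x) - t * q x" if "t \<ge> 0" for y t
    using sub[of "y + sc t x" "- y"] hom[OF that, of x] by simp
  have bdd: "bdd_below ((\<lambda>t. q (y + sc t x) - t * q x) ` {0..})" for y
    by (rule bdd_belowI2[of _ "- q (- y)"]) (simp add: lower)
  have le: "q' y \<le> q (y + sc t x) - t * q x" if "t \<ge> 0" for y t
    unfolding q'_def by (rule cINF_lower[OF bdd]) (use that in simp)
  have ge: "c \<le> q' y" if "\<And>t. t \<ge> 0 \<Longrightarrow> c \<le> q (y + sc t x) - t * q x" for c y
    unfolding q'_def by (rule cINF_greatest) (use that in auto)
  have sub': "q' (a + b) \<le> q' a + q' b" for a b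
  proof -
    have "q' (a + b) - (q (a + sc t x) - t * q x) \<le> q (b + sc s x) - s * q x"
      if "t \<ge> 0" "s \<ge> 0" for t s
    proof -
      have "q' (a + b) \<le> q ((a + b) + sc (t + s) x) - (t + s) * q x"
        using le that by simp
      also have "(a + b) + sc (t + s) x = (a + sc t x) + (b + sc s x)"
        by (simp add: scale_left_distrib algebra_simps)
      also have "q \<dots> \<le> q (a + sc t x) + q (b + sc s x)" by (rule sub)
      finally show ?thesis by (simp add: algebra_simps)
    qed
    then have "q' (a + b) - (q (a + sc t x) - t * q x) \<le> q' b" if "t \<ge> 0" for t
      by (intro ge) (use that in auto)
    then have "q' (a + b) - q' b \<le> q (a + sc t x) - t * q x" if "t \<ge> 0" for t
      using that by (simp add: algebra_simps)
    then have "q' (a + b) - q' b \<le> q' a" by (rule ge)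
    then show ?thesis by simp
  qed
  have hom_le: "q' (sc s a) \<le> s * q' a" if "s > 0" for s a
  proof -
    have "q' (sc s a) / s \<le> q (a + sc t x) - t * q x" if "t \<ge> 0" for t
    proof -
      have "q' (sc s a) \<le> q (sc s a + sc (s * t) x) - (s * t) * q x"
        using le that \<open>s > 0\<close> by simp
      also have "sc s a + sc (s * t) x = sc s (a + sc t x)"
        by (simp add: scale_right_distrib)
      also have "q \<dots> = s * q (a + sc t x)" using hom \<open>s > 0\<close> by simp
      finally show ?thesis using \<open>s > 0\<close> by (simp add: field_simps)
    qed
    then have "q' (sc s a) / s \<le> q' a" by (rule ge)
    then show ?thesis using that by (simp add: field_simps)
  qed
  have "q' (sc s a) = s * q' a" if "s \<ge> 0" for s a
  proof (cases "s = 0")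
    case True
    have "q' 0 \<le> 0" using le[of 0 0] sublinear_functional_lower_bound(1)[OF vs q] by simp
    moreover have "0 \<le> q' 0"
      by (rule ge) (use hom in simp)
    ultimately show ?thesis using True by simp
  next
    case False
    then have "s > 0" using that by simp
    have "s * q' a = s * q' (sc (1 / s) (sc s a))" using \<open>s > 0\<close> by simp
    also have "\<dots> \<le> s * ((1 / s) * q' (sc s a))"
      by (intro mult_left_mono hom_le) (use \<open>s > 0\<close> in auto)
    also have "\<dots> = q' (sc s a)" using \<open>s > 0\<close> by simp
    finally show ?thesis using hom_le[OF \<open>s > 0\<close>, of a] by simp
  qed
  with sub' have "sublinear_functional sc q'" by (simp add: sublinear_functional_def)
  moreover have "q' \<le> q" using le[of 0] by (auto simp: le_fun_def)
  moreover have "q' (- x) \<le> - q x"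
    using le[of 1 "- x"] sublinear_functional_lower_bound(1)[OF vs q] by simp
  ultimately show ?thesis by (rule that)
qed

text \<open>
  The pointwise infimum of a chain is sublinear, as two members of a chain may be replaced by the
  smaller one; it is finite because \<open>f(x) \<ge> -f(-x) \<ge> -q(-x)\<close>.
\<close>

lemma minimal_sublinear_functional:
  assumes vs: "vector_space sc" and q: "sublinear_functional sc q"
  obtains m where "sublinear_functional sc m" "m \<le> q"
    "\<And>f. sublinear_functional sc f \<Longrightarrow> f \<le> m \<Longrightarrow> f = m"
proof -
  interpret vector_space sc by fact
  define A where "A = {f. sublinear_functional sc f \<and> f \<le> q}"
  let ?P = "\<lambda>f g :: 'a \<Rightarrow> real. g \<le> f"
  have "\<exists>m\<in>A. \<forall>f\<in>A. ?P m f \<longrightarrow> f = m"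
  proof (rule predicate_Zorn)
    show "partial_order_on A (relation_of ?P A)"
      by (auto simp: partial_order_on_def preorder_on_def refl_on_def trans_def antisym_def
          relation_of_def)
  next
    fix C assume "C \<in> Chains (relation_of ?P A)"
    then have CA: "C \<subseteq> A" and chain: "\<And>f g. f \<in> C \<Longrightarrow> g \<in> C \<Longrightarrow> f \<le> g \<or> g \<le> f"
      by (auto simp: Chains_def relation_of_def)
    show "\<exists>u\<in>A. \<forall>a\<in>C. u \<le> a"
    proof (cases "C = {}")
      case True
      then show ?thesis using q by (auto simp: A_def)
    next
      case False
      define u where "u x = (INF f\<in>C. f x)" for x
      have sl: "sublinear_functional sc f" "f \<le> q" if "f \<in> C" for f
        using that CA by (auto simp: A_def)
      have lower: "- q (- x) \<le> f x" if "f \<in> C" for f x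
        using sublinear_functional_lower_bound(2)[OF vs sl(1)[OF that], of x] sl(2)[OF that]
        by (smt (verit) le_funD)
      have bdd: "bdd_below ((\<lambda>f. f x) ` C)" for x
        by (rule bdd_belowI2[of _ "- q (- x)"]) (simp add: lower)
      have le: "u x \<le> f x" if "f \<in> C" for f x
        unfolding u_def by (rule cINF_lower[OF bdd that])
      have ge: "c \<le> u x" if "\<And>f. f \<in> C \<Longrightarrow> c \<le> f x" for c x
        unfolding u_def by (rule cINF_greatest) (use that False in auto)
      have "u (x + y) \<le> u x + u y" for x y
      proof -
        have "u (x + y) \<le> f x + g y" if fg: "f \<in> C" "g \<in> C" for f g
        proof -
          obtain h where h: "h \<in> C" "h \<le> f" "h \<le> g" using chain fg by blast
          have "u (x + y) \<le> h (x + y)" using le h by simp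
          also have "\<dots> \<le> h x + h y" using sl(1)[OF h(1)] by (simp add: sublinear_functional_def)
          also have "\<dots> \<le> f x + g y" using h by (intro add_mono) (auto simp: le_fun_def)
          finally show ?thesis .
        qed
        then have "u (x + y) - f x \<le> g y" if "f \<in> C" "g \<in> C" for f g
          using that by (metis diff_le_eq add.commute)
        then have "u (x + y) - f x \<le> u y" if "f \<in> C" for f
          using that by (intro ge) blast
        then have "u (x + y) - u y \<le> f x" if "f \<in> C" for f
          using that by (metis diff_le_eq add.commute)
        then have "u (x + y) - u y \<le> u x" by (intro ge) blast
        then show ?thesis by simp
      qed
      moreover have "u (sc t x) = t * u x" if "t \<ge> 0" for t x
      proof (cases "t = 0")
        case True
        have "f 0 = 0" if "f \<in> C" for f using sublinear_functional_lower_bound(1)[OF vs sl(1)[OF that]] .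
        with False have "(\<lambda>f. f 0) ` C = {0}" by force
        then have "u 0 = 0" by (simp add: u_def)
        then show ?thesis using True by simp
      next
        case False
        then have "t > 0" using that by simp
        have hom: "f (sc t x) = t * f x" if "f \<in> C" for f
          using sl(1)[OF that] \<open>t > 0\<close> by (simp add: sublinear_functional_def)
        have "t * u x \<le> u (sc t x)"
          by (rule ge) (use \<open>t > 0\<close> in \<open>simp add: hom le\<close>)
        moreover have "u (sc t x) / t \<le> u x"
          by (rule ge) (use le[of _ "sc t x"] \<open>t > 0\<close> in \<open>auto simp: hom field_simps\<close>)
        ultimately show ?thesis using \<open>t > 0\<close> by (simp add: field_simps)
      qed
      ultimately have "sublinear_functional sc u" by (simp add: sublinear_functional_def)
      moreover obtain f where "f \<in> C" using False by blast
      then have "u \<le> q" using le sl(2) by (meson le_fun_def order_trans)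
      ultimately show ?thesis using le by (auto simp: A_def le_fun_def)
    qed
  qed
  then obtain m where m: "m \<in> A" "\<And>f. f \<in> A \<Longrightarrow> f \<le> m \<Longrightarrow> f = m" by blast
  show ?thesis
  proof (rule that)
    show "f = m" if "sublinear_functional sc f" "f \<le> m" for f
      using m that by (auto simp: A_def intro: order_trans)
  qed (use m(1) in \<open>auto simp: A_def\<close>)
qed

text \<open>
  By minimality, tilting in direction \<open>x\<close> changes nothing, so \<open>m(-x) = -m(x)\<close>; subadditivity applied to
  \<open>x = (x + y) + (-y)\<close> then gives the reverse inequality.
\<close>

lemma minimal_sublinear_functional_linear:
  assumes vs: "vector_space sc" and m: "sublinear_functional sc m"
    and min: "\<And>f. sublinear_functional sc f \<Longrightarrow> f \<le> m \<Longrightarrow> f = m"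
  shows "m (x + y) = m x + m y" "m (sc t x) = t * m x"
proof -
  interpret vector_space sc by fact
  have sub: "m (a + b) \<le> m a + m b" and hom: "t \<ge> 0 \<Longrightarrow> m (sc t a) = t * m a" for a b t
    using m unfolding sublinear_functional_def by auto
  have minus: "m (- a) = - m a" for a
  proof -
    obtain q' where "sublinear_functional sc q'" "q' \<le> m" "q' (- a) \<le> - m a"
      by (rule sublinear_functional_tilt[OF vs m])
    then have "m (- a) \<le> - m a" using min by blast
    then show ?thesis using sublinear_functional_lower_bound(2)[OF vs m, of a] by simp
  qed
  show "m (x + y) = m x + m y"
    using sub[of x y] sub[of "x + y" "- y"] minus[of y] by simp
  show "m (sc t x) = t * m x"
  proof (cases "t \<ge> 0")
    case False
    then have "m (- sc t x) = - (t * m x)" using hom[of "- t" x] by simp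
    then show ?thesis using minus[of "sc t x"] by simp
  qed (use hom in simp)
qed

lemma real_Hahn_Banach:
  assumes vs: "vector_space sc" and q: "sublinear_functional sc q"
  obtains u where "\<And>x y. u (x + y) = u x + u y" "\<And>t x. u (sc t x) = t * u x"
    "\<And>x. u x \<le> q x" "u x0 = q x0"
proof -
  obtain q' where q': "sublinear_functional sc q'" "q' \<le> q" "q' (- x0) \<le> - q x0"
    by (rule sublinear_functional_tilt[OF vs q])
  obtain m where m: "sublinear_functional sc m" "m \<le> q'"
    "\<And>f. sublinear_functional sc f \<Longrightarrow> f \<le> m \<Longrightarrow> f = m"
    using minimal_sublinear_functional[OF vs q'(1)] by blast
  note lin = minimal_sublinear_functional_linear[OF vs m(1,3)]
  have le: "m x \<le> q x" for x using m(2) q'(2) by (meson le_funD order_trans)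
  have "m (- x0) = - m x0" using lin(1)[of x0 "- x0"] sublinear_functional_lower_bound(1)[OF vs m(1)] by simp
  moreover have "m (- x0) \<le> - q x0" using m(2) q'(3) by (meson le_funD order_trans)
  ultimately have "m x0 = q x0" using le[of x0] by simp
  with lin le that show ?thesis by blast
qed

definition seminorm :: "('k::real_normed_field \<Rightarrow> 'e::ab_group_add \<Rightarrow> 'e) \<Rightarrow> ('e \<Rightarrow> real) \<Rightarrow> bool" where
  "seminorm smul q \<longleftrightarrow>
     (\<forall>x y. q (x + y) \<le> q x + q y) \<and> (\<forall>c x. q (smul c x) = norm c * q x)"

lemma linear_functionalI:
  fixes f :: "'e::ab_group_add \<Rightarrow> 'k::field"
  assumes "vector_space smul" "\<And>x y. f (x + y) = f x + f y" "\<And>c x. f (smul c x) = c * f x"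
  shows "Vector_Spaces.linear smul (*) f"
  using assms by (auto simp: Vector_Spaces.linear_def module_hom_def module_hom_axioms_def
      module_def vector_space_def algebra_simps)

lemma linear_functionalD:
  assumes "Vector_Spaces.linear smul (*) f"
  shows "f (x + y) = f x + f y" "f (smul c x) = c * f x" "f (x - y) = f x - f y" "f 0 = 0"
    "f (\<Sum>i\<in>I. g i) = (\<Sum>i\<in>I. f (g i))"
proof -
  interpret Vector_Spaces.linear smul "(*)" f by fact
  show "f (x + y) = f x + f y" "f (smul c x) = c * f x" "f (x - y) = f x - f y" "f 0 = 0"
    "f (\<Sum>i\<in>I. g i) = (\<Sum>i\<in>I. f (g i))"
    by (auto simp: add scale diff sum)
qed

text \<open>
  Apply the real theorem to the underlying real space. Over the complex numbers, \<open>u\<close> is the real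
  part of \<open>f(x) = u(x) - i u(i x)\<close>, and rotating \<open>f(x)\<close> to the positive real axis turns \<open>u \<le> q\<close> into
  \<open>|f| \<le> q\<close>. The two fields are told apart by the range of their embedding \<open>\<phi>\<close>.
\<close>

lemma seminorm_Hahn_Banach:
  fixes smul :: "'k::real_or_complex \<Rightarrow> 'e::ab_group_add \<Rightarrow> 'e"
  assumes vs: "vector_space smul" and q: "seminorm smul q"
  obtains f where "Vector_Spaces.linear smul (*) f" "\<And>x. norm (f x) \<le> q x" "norm (f x0) = q x0"
proof -
  interpret vector_space smul by fact
  define sc where "sc t = smul (of_real t)" for t :: real
  have vsr: "vector_space sc"
    by unfold_locales (auto simp: sc_def scale_right_distrib scale_left_distrib)
  have qs: "q (smul c x) = norm c * q x" for c x using q by (simp add: seminorm_def)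
  have "sublinear_functional sc q"
    using q by (auto simp: sublinear_functional_def seminorm_def sc_def)
  then obtain u where uadd: "\<And>x y. u (x + y) = u x + u y" and usc: "\<And>t x. u (sc t x) = t * u x"
    and ule: "\<And>x. u x \<le> q x" and ux0: "u x0 = q x0"
    using real_Hahn_Banach[OF vsr] by metis
  have uneg: "u (- x) = - u x" for x using usc[of "-1" x] by (simp add: sc_def)
  obtain \<phi> :: "'k \<Rightarrow> complex" where r: "range \<phi> = \<real> \<or> range \<phi> = UNIV"
    and padd: "\<And>x y. \<phi> (x + y) = \<phi> x + \<phi> y" and pmul: "\<And>x y. \<phi> (x * y) = \<phi> x * \<phi> y"
    and nrm: "\<And>x. norm (\<phi> x) = norm x"
    using ex_real_or_complex_iso by blast
  have pdiff: "\<phi> (x - y) = \<phi> x - \<phi> y" for x y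
    using padd[of "x - y" y] by simp
  have inj: "x = y" if "\<phi> x = \<phi> y" for x y
    using nrm[of "x - y"] that by (simp add: pdiff)
  have p1: "\<phi> 1 = 1"
    using pmul[of 1 1] nrm[of 1] by force
  \<comment> \<open>A complex number is determined by its distances to 0 and 1 once these are those of a real number.\<close>
  have preal: "\<phi> (of_real t) = of_real t" for t
  proof -
    let ?z = "\<phi> (of_real t)"
    have "norm ?z = \<bar>t\<bar>" by (simp add: nrm)
    then have 1: "(Re ?z)\<^sup>2 + (Im ?z)\<^sup>2 = t\<^sup>2" by (metis cmod_power2 power2_abs)
    have "norm (?z - 1) = \<bar>t - 1\<bar>"
      using nrm[of "of_real (t - 1)"] by (metis norm_of_real of_real_1 of_real_diff p1 pdiff)
    then have "(Re ?z - 1)\<^sup>2 + (Im ?z)\<^sup>2 = (t - 1)\<^sup>2"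
      by (metis cmod_power2 power2_abs minus_complex.sel one_complex.sel diff_zero)
    with 1 have "Re ?z = t" by (simp add: power2_eq_square algebra_simps)
    with 1 show ?thesis by (simp add: complex_eq_iff)
  qed
  show ?thesis
  proof (cases "range \<phi> = \<real>")
    case True
    have rl: "\<exists>t. c = of_real t" for c :: 'k
    proof -
      have "\<phi> c \<in> \<real>" using True by auto
      then obtain t where "\<phi> c = of_real t" by (auto elim: Reals_cases)
      then show ?thesis using inj preal by metis
    qed
    have "\<bar>u x\<bar> \<le> q x" for x
      using ule[of x] ule[of "- x"] qs[of "-1" x] by (simp add: uneg abs_le_iff)
    moreover have "of_real (u (smul c x)) = c * of_real (u x)" for c x
    proof -
      obtain t where "c = of_real t" using rl by blast
      then show ?thesis using usc[of t x] by (simp add: sc_def)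
    qed
    moreover have "q x0 \<ge> 0" using ule[of "- x0"] qs[of "-1" x0] ux0 by (simp add: uneg)
    ultimately show ?thesis
      by (intro that[of "\<lambda>x. of_real (u x)"] linear_functionalI[OF vs]) (auto simp: uadd ux0)
  next
    case False
    then obtain i where i: "\<phi> i = \<i>" using r by (metis UNIV_I image_iff)
    have ii: "i * i = -1"
      by (rule inj) (use i pmul pdiff[of 0 1] pdiff[of 0 0] p1 in simp)
    have dec: "\<exists>a b. c = of_real a + of_real b * i" for c :: 'k
      by (intro exI[of _ "Re (\<phi> c)"] exI[of _ "Im (\<phi> c)"] inj)
        (simp add: padd pmul preal i complex_eq_iff)
    define f where "f x = of_real (u x) - i * of_real (u (smul i x))" for x
    have fadd: "f (x + y) = f x + f y" for x y
      by (simp add: f_def uadd scale_right_distrib algebra_simps)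
    have fr: "f (smul (of_real t) x) = of_real t * f x" for t x
      using usc[of t x] usc[of t "smul i x"]
      by (simp add: f_def sc_def algebra_simps)
    have fi: "f (smul i x) = i * f x" for x
    proof -
      have "smul i (smul i x) = - x" by (simp add: ii)
      then have "f (smul i x) = of_real (u (smul i x)) + i * of_real (u x)"
        by (simp add: f_def uneg)
      also have "\<dots> = i * f x" by (simp add: f_def right_diff_distrib ii flip: mult.assoc)
      finally show ?thesis .
    qed
    have fc: "f (smul c x) = c * f x" for c x
    proof -
      obtain a b where c: "c = of_real a + of_real b * i" using dec by blast
      have "smul c x = smul (of_real a) x + smul (of_real b) (smul i x)"
        by (simp add: c scale_left_distrib)
      then show ?thesis using fr[of a x] fr[of b "smul i x"] fi[of x]
        by (simp add: fadd c algebra_simps)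
    qed
    have Re: "Re (\<phi> (f x)) = u x" for x
      by (simp add: f_def pdiff pmul preal i)
    have fle: "norm (f x) \<le> q x" for x
    proof -
      obtain w where w: "norm w = 1" "w * f x = of_real (norm (f x))" by (rule unit_rotation)
      have "norm (f x) = Re (\<phi> (f (smul w x)))" by (simp add: fc w preal)
      also have "\<dots> \<le> q (smul w x)" using ule by (simp add: Re)
      finally show ?thesis by (simp add: qs w)
    qed
    have "q x0 \<le> norm (f x0)"
      using Re[of x0] ux0 nrm[of "f x0"] complex_Re_le_cmod[of "\<phi> (f x0)"] by simp
    with fle have "norm (f x0) = q x0" by (simp add: order_antisym)
    then show ?thesis using that linear_functionalI[OF vs] fadd fc fle by blast
  qed
qed

section \<open>Continuous seminorms of a locally convex space\<close>

lemma seminormD: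
  assumes "vector_space smul" "seminorm smul q"
  shows "q (x + y) \<le> q x + q y" "q (smul c x) = norm c * q x" "q 0 = 0" "q (- x) = q x"
    "0 \<le> q x" "\<bar>q x - q y\<bar> \<le> q (x - y)"
proof -
  interpret vector_space smul by fact
  show add: "q (a + b) \<le> q a + q b" and sc: "q (smul c a) = norm c * q a" for a b c
    using assms(2) by (auto simp: seminorm_def)
  show 0: "q 0 = 0" using sc[of 0 0] by simp
  show minus: "q (- a) = q a" for a using sc[of "-1" a] by simp
  show "0 \<le> q x" using add[of x "- x"] minus[of x] 0 by simp
  show "\<bar>q x - q y\<bar> \<le> q (x - y)"
    using add[of "x - y" y] add[of "y - x" x] minus[of "x - y"] by (simp only: minus_diff_eq diff_add_cancel)
qed

definition continuous_seminorm ::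
  "('k::real_normed_field \<Rightarrow> 'e::topological_ab_group_add \<Rightarrow> 'e) \<Rightarrow> ('e \<Rightarrow> real) \<Rightarrow> bool" where
  "continuous_seminorm smul q \<longleftrightarrow> seminorm smul q \<and> continuous_on UNIV q"

lemma continuous_seminormI:
  fixes smul :: "'k::real_normed_field \<Rightarrow> 'e::topological_ab_group_add \<Rightarrow> 'e"
  assumes vs: "vector_space smul" and q: "seminorm smul q"
    and small: "\<And>\<epsilon>. \<epsilon> > 0 \<Longrightarrow> \<exists>U. open U \<and> 0 \<in> U \<and> (\<forall>x\<in>U. q x < \<epsilon>)"
  shows "continuous_seminorm smul q"
proof -
  have "(q \<longlongrightarrow> q x) (at x)" for x
  proof (rule tendstoI)
    fix \<epsilon> :: real assume "\<epsilon> > 0"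
    from small[OF this] obtain U where U: "open U" "0 \<in> U" "\<forall>x\<in>U. q x < \<epsilon>" by blast
    let ?S = "(\<lambda>y. y - x) -` U"
    have "open ?S"
      by (intro open_vimage[OF U(1)] continuous_on_diff continuous_on_id continuous_on_const)
    moreover have "x \<in> ?S" using U(2) by simp
    moreover have "dist (q y) (q x) < \<epsilon>" if "y \<in> ?S" for y
    proof -
      have "q (y - x) < \<epsilon>" using U(3) that by (simp only: vimage_eq)
      then show ?thesis
        using seminormD(6)[OF vs q, of y x] unfolding dist_real_def by linarith
    qed
    ultimately have "open ?S \<and> x \<in> ?S \<and> (\<forall>y\<in>?S. y \<noteq> x \<longrightarrow> y \<in> UNIV \<longrightarrow> dist (q y) (q x) < \<epsilon>)"
      by (intro conjI ballI impI)
    then show "\<forall>\<^sub>F y in at x. dist (q y) (q x) < \<epsilon>"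
      unfolding eventually_at_topological by (rule exI)
  qed
  then have "continuous_on UNIV q"
    by (simp add: continuous_on_def)
  with q show ?thesis by (simp add: continuous_seminorm_def)
qed

lemma top_dualI:
  fixes smul :: "'k::real_or_complex \<Rightarrow> 'e::{topological_ab_group_add, t2_space} \<Rightarrow> 'e"
  assumes vs: "vector_space smul" and q: "continuous_seminorm smul q"
    and f: "Vector_Spaces.linear smul (*) f" and le: "\<And>x. norm (f x) \<le> C * q x"
  shows "f \<in> top_dual smul"
proof -
  have sq: "seminorm smul q" and cq: "continuous_on UNIV q"
    using q by (auto simp: continuous_seminorm_def)
  have "(f \<longlongrightarrow> f x) (at x)" for x
  proof -
    have "isCont q 0" using cq by (simp add: continuous_on_eq_continuous_at)
    moreover have "((\<lambda>y. y - x) \<longlongrightarrow> 0) (at x)"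
      using tendsto_diff[OF tendsto_ident_at[of x UNIV] tendsto_const[of x]] by simp
    ultimately have "((\<lambda>y. q (y - x)) \<longlongrightarrow> q 0) (at x)"
      by (rule isCont_tendsto_compose)
    then have "((\<lambda>y. C * q (y - x)) \<longlongrightarrow> C * q 0) (at x)"
      by (rule tendsto_mult_left)
    then have "((\<lambda>y. C * q (y - x)) \<longlongrightarrow> 0) (at x)"
      by (simp add: seminormD(3)[OF vs sq])
    moreover have "norm (f y - f x) \<le> C * q (y - x)" for y
      using le[of "y - x"] by (simp only: linear_functionalD(3)[OF f])
    then have "\<forall>\<^sub>F y in at x. norm (f y - f x) \<le> C * q (y - x)" by simp
    ultimately have "((\<lambda>y. f y - f x) \<longlongrightarrow> 0) (at x)"
      by (rule Lim_null_comparison[rotated])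
    then show ?thesis by (rule LIM_zero_cancel)
  qed
  then show ?thesis using f by (simp add: top_dual_def continuous_on_def)
qed

text \<open>
  The seminorm is the gauge \<open>q\<close> of the balanced core \<open>N\<close> of a convex neighborhood; joint continuity of
  the scalar multiplication at \<open>(0, 0)\<close> makes \<open>N\<close> a neighborhood of zero.
\<close>

lemma continuous_seminorm_basis:
  fixes smul :: "'k::real_or_complex \<Rightarrow> 'e::{topological_ab_group_add, t2_space} \<Rightarrow> 'e"
  assumes "locally_convex_space smul" and U: "open U" "0 \<in> U"
  obtains q where "continuous_seminorm smul q" "{x. q x < 1} \<subseteq> U"
proof -
  interpret locally_convex_space smul by fact
  have vs: "vector_space smul" by (rule vector_space_axioms)
  obtain V where V: "open V" "0 \<in> V" "V \<subseteq> U" and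
    convV: "\<And>x y t. x \<in> V \<Longrightarrow> y \<in> V \<Longrightarrow> t \<in> {0..1} \<Longrightarrow>
      smul (of_real (1 - t)) x + smul (of_real t) y \<in> V"
    using convex_nhds[OF U] by blast
  define N where "N = {x. \<forall>c. norm c \<le> 1 \<longrightarrow> smul c x \<in> V}"
  have cont: "continuous_on UNIV (smul c)" for c
    using continuous_on_compose2[OF continuous_scale, of UNIV "\<lambda>x. (c, x)"]
    by (simp add: continuous_on_Pair)
  have contl: "continuous_on UNIV (\<lambda>c. smul c x)" for x
    using continuous_on_compose2[OF continuous_scale, of UNIV "\<lambda>c. (c, x)"]
    by (simp add: continuous_on_Pair)
  obtain W where W: "open W" "0 \<in> W" "W \<subseteq> N"
  proof -
    have "open ((\<lambda>(c, x). smul c x) -` V)"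
      by (rule open_vimage[OF V(1) continuous_scale])
    moreover have "(0, 0) \<in> (\<lambda>(c, x). smul c x) -` V" using V(2) by simp
    ultimately obtain A S where AS: "open A" "open S" "(0, 0) \<in> A \<times> S"
      and sub: "A \<times> S \<subseteq> (\<lambda>(c, x). smul c x) -` V"
      by (rule open_prod_elim)
    then have AS0: "0 \<in> A" "0 \<in> S" by auto
    with AS(1) obtain \<delta> where \<delta>: "\<delta> > 0" "ball 0 \<delta> \<subseteq> A"
      by (meson open_contains_ball)
    show ?thesis
    proof
      show "open (smul (of_real (2 / \<delta>)) -` S)"
        by (rule open_vimage[OF AS(2) cont])
      show "0 \<in> smul (of_real (2 / \<delta>)) -` S" using AS0 by simp
      show "smul (of_real (2 / \<delta>)) -` S \<subseteq> N"
      proof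
        fix x assume x: "x \<in> smul (of_real (2 / \<delta>)) -` S"
        have "smul c x \<in> V" if "norm c \<le> 1" for c
        proof -
          have "norm (c * of_real (\<delta> / 2)) < \<delta>"
            using that \<delta>(1) mult_right_mono[of "norm c" 1 \<delta>]
            by (simp add: norm_mult norm_divide)
          then have "c * of_real (\<delta> / 2) \<in> A" using \<delta>(2) by (auto simp: dist_norm)
          then have "smul (c * of_real (\<delta> / 2)) (smul (of_real (2 / \<delta>)) x) \<in> V"
            using subsetD[OF sub, of "(c * of_real (\<delta> / 2), smul (of_real (2 / \<delta>)) x)"] x
            by simp
          then show ?thesis using \<delta>(1) by (simp add: mult.assoc)
        qed
        then show "x \<in> N" by (simp add: N_def)
      qed
    qed
  qed
  have balanced: "smul c x \<in> N" if "x \<in> N" "norm c \<le> 1" for c x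
    using that by (auto simp: N_def norm_mult mult_le_one)
  have convex: "smul (of_real (1 - t)) x + smul (of_real t) y \<in> N"
    if "x \<in> N" "y \<in> N" "t \<in> {0..1}" for x y t
  proof -
    have "smul c (smul (of_real (1 - t)) x + smul (of_real t) y)
        = smul (of_real (1 - t)) (smul c x) + smul (of_real t) (smul c y)" for c
      by (simp add: scale_right_distrib mult.commute)
    moreover have "smul (of_real (1 - t)) (smul c x) + smul (of_real t) (smul c y) \<in> V"
      if "norm c \<le> 1" for c
      using \<open>x \<in> N\<close> \<open>y \<in> N\<close> \<open>t \<in> {0..1}\<close> that by (intro convV) (simp_all add: N_def)
    ultimately show ?thesis by (simp only: N_def mem_Collect_eq) blast
  qed
  define S where "S x = {t. t > 0 \<and> smul (of_real (1 / t)) x \<in> N}" for x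
  define q where "q x = Inf (S x)" for x
  have S_mono: "s \<in> S x" if "t \<in> S x" "t \<le> s" for s t x
  proof -
    have t: "t > 0" "smul (of_real (1 / t)) x \<in> N" using that by (auto simp: S_def)
    have "smul (of_real (t / s)) (smul (of_real (1 / t)) x) \<in> N"
      by (rule balanced[OF t(2)]) (use t \<open>t \<le> s\<close> in \<open>simp add: norm_divide\<close>)
    then show ?thesis using t \<open>t \<le> s\<close> by (simp add: S_def)
  qed
  have S_ne: "S x \<noteq> {}" for x
  proof -
    have "open ((\<lambda>c. smul c x) -` W)" by (rule open_vimage[OF W(1) contl])
    moreover have "0 \<in> (\<lambda>c. smul c x) -` W" using W(2) by simp
    ultimately obtain \<delta> where \<delta>: "\<delta> > 0" "ball 0 \<delta> \<subseteq> (\<lambda>c. smul c x) -` W"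
      by (metis open_contains_ball)
    have "of_real (\<delta> / 2) \<in> ball (0 :: 'k) \<delta>" using \<delta>(1) by (simp add: norm_divide)
    then have "smul (of_real (\<delta> / 2)) x \<in> N" using \<delta>(2) W(3) by blast
    then have "2 / \<delta> \<in> S x" using \<delta>(1) by (simp add: S_def)
    then show ?thesis by blast
  qed
  have bdd: "bdd_below (S x)" for x by (rule bdd_belowI[of _ 0]) (auto simp: S_def)
  have q_le: "q x \<le> t" if "t \<in> S x" for t x
    unfolding q_def by (rule cInf_lower[OF that bdd])
  have q_ge: "c \<le> q x" if "\<And>t. t \<in> S x \<Longrightarrow> c \<le> t" for c x
    unfolding q_def by (rule cInf_greatest[OF S_ne]) (rule that)
  have sub: "q (x + y) \<le> q x + q y" for x y
  proof -
    have "q (x + y) \<le> t + s" if "t \<in> S x" "s \<in> S y" for t s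
    proof (rule q_le)
      have pos: "t > 0" "s > 0" using that by (auto simp: S_def)
      have "smul (of_real (1 - s / (t + s))) (smul (of_real (1 / t)) x)
          + smul (of_real (s / (t + s))) (smul (of_real (1 / s)) y) \<in> N"
        using that pos by (intro convex) (auto simp: S_def)
      moreover have "1 - s / (t + s) = t / (t + s)" using pos by (simp add: field_simps)
      ultimately have "smul (of_real (1 / (t + s))) (x + y) \<in> N"
        using pos by (simp add: scale_right_distrib)
      then show "t + s \<in> S (x + y)" using pos by (simp add: S_def)
    qed
    then have "q (x + y) - t \<le> s" if "t \<in> S x" "s \<in> S y" for t s
      using that by (metis diff_le_eq add.commute)
    then have "q (x + y) - t \<le> q y" if "t \<in> S x" for t
      using that by (intro q_ge) blast
    then have "q (x + y) - q y \<le> t" if "t \<in> S x" for t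
      using that by (metis diff_le_eq add.commute)
    then have "q (x + y) - q y \<le> q x" by (rule q_ge)
    then show ?thesis by simp
  qed
  have q_nonneg: "0 \<le> q x" for x by (rule q_ge) (simp add: S_def)
  have "0 \<in> N" using V(2) by (simp add: N_def)
  then have "q 0 \<le> t" if "t > 0" for t using that by (intro q_le) (simp add: S_def)
  then have "q 0 \<le> 0" by (rule dense_ge)
  then have q0: "q 0 = 0" using q_nonneg[of 0] by (rule order_antisym)
  have hom_le: "q (smul c x) \<le> norm c * q x" if "c \<noteq> 0" for c x
  proof -
    have "q (smul c x) \<le> norm c * t" if "t \<in> S x" for t
    proof (rule q_le)
      have t: "t > 0" using that by (simp add: S_def)
      have "smul (c / of_real (norm c)) (smul (of_real (1 / t)) x) \<in> N"
        by (rule balanced) (use that \<open>c \<noteq> 0\<close> in \<open>auto simp: S_def norm_divide\<close>)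
      also have "smul (c / of_real (norm c)) (smul (of_real (1 / t)) x)
          = smul (of_real (1 / (norm c * t))) (smul c x)"
      proof -
        have "c / of_real (norm c) * of_real (1 / t) = of_real (1 / (norm c * t)) * c" by simp
        then show ?thesis by (simp only: scale_scale)
      qed
      finally show "norm c * t \<in> S (smul c x)" using t \<open>c \<noteq> 0\<close> by (simp add: S_def)
    qed
    then have "q (smul c x) / norm c \<le> t" if "t \<in> S x" for t
      using that \<open>c \<noteq> 0\<close> by (simp add: pos_divide_le_eq mult.commute)
    then have "q (smul c x) / norm c \<le> q x" by (rule q_ge)
    then show ?thesis using \<open>c \<noteq> 0\<close> by (simp add: pos_divide_le_eq mult.commute)
  qed
  have hom: "q (smul c x) = norm c * q x" for c x
  proof (cases "c = 0")
    case False
    have "norm c * q x = norm c * q (smul (inverse c) (smul c x))" using False by simp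
    also have "\<dots> \<le> norm c * (norm (inverse c) * q (smul c x))"
      by (intro mult_left_mono hom_le) (use False in auto)
    also have "\<dots> = q (smul c x)" using False by (simp add: norm_inverse)
    finally show ?thesis using hom_le[OF False, of x] by simp
  qed (simp add: q0)
  have sq: "seminorm smul q" using sub hom by (simp add: seminorm_def)
  show ?thesis
  proof
    show "continuous_seminorm smul q"
    proof (rule continuous_seminormI[OF vs sq])
      fix \<epsilon> :: real assume \<epsilon>: "\<epsilon> > 0"
      have "q x < \<epsilon>" if "smul (of_real (2 / \<epsilon>)) x \<in> W" for x
      proof -
        have "\<epsilon> / 2 \<in> S x" using that W(3) \<epsilon> by (auto simp: S_def)
        then have "q x \<le> \<epsilon> / 2" by (rule q_le)
        then show ?thesis using \<epsilon> by simp
      qed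
      then show "\<exists>U. open U \<and> 0 \<in> U \<and> (\<forall>x\<in>U. q x < \<epsilon>)"
        using W(2) open_vimage[OF W(1) cont, of "of_real (2 / \<epsilon>)"]
        by (intro exI[of _ "smul (of_real (2 / \<epsilon>)) -` W"]) auto
    qed
    show "{x. q x < 1} \<subseteq> U"
    proof safe
      fix x assume "q x < 1"
      then obtain t where "t \<in> S x" "t < 1"
        using q_ge[of x 1] by (meson not_le)
      then have "1 \<in> S x" using S_mono by simp
      then have "\<forall>c. norm c \<le> 1 \<longrightarrow> smul c x \<in> V" by (simp add: S_def N_def)
      from this[rule_format, of 1] show "x \<in> U" using V(3) by auto
    qed
  qed
qed

text \<open>
  A gliding hump. If \<open>q(a\<^sub>k) > 4\<^sup>k\<close> and \<open>g\<^sub>k \<le> q\<close> attains \<open>q\<close> at \<open>a\<^sub>k\<close>, choose signs \<open>s\<^sub>k\<close> one after another so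
  that adding \<open>s\<^sub>k 3\<^bsup>-k\<^esup> g\<^sub>k\<close> does not decrease the value at \<open>a\<^sub>k\<close> below \<open>3\<^bsup>-k\<^esup> q(a\<^sub>k)\<close>. The terms after the \<open>k\<close>-th
  change this value by at most half of that amount, so \<open>h = \<Sum> s\<^sub>k 3\<^bsup>-k\<^esup> g\<^sub>k\<close> is a continuous functional
  with \<open>|h(a\<^sub>k)| \<ge> (4/3)\<^sup>k / 2\<close>.
\<close>

lemma weakly_bounded_imp_seminorm_bounded:
  fixes smul :: "'k::real_or_complex \<Rightarrow> 'e::{topological_ab_group_add, t2_space} \<Rightarrow> 'e"
  assumes vs: "vector_space smul" and q: "continuous_seminorm smul q"
    and wb: "\<And>f. f \<in> top_dual smul \<Longrightarrow> \<exists>M. \<forall>a\<in>A. norm (f a) \<le> M"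
  shows "\<exists>C. \<forall>a\<in>A. q a \<le> C"
proof (rule ccontr)
  assume "\<not> ?thesis"
  then have "\<forall>k::nat. \<exists>a\<in>A. 4 ^ k < q a" by (meson not_le)
  then obtain a where aA: "\<And>k::nat. a k \<in> A" and a: "\<And>k. 4 ^ k < q (a k)" by metis
  have sq: "seminorm smul q" using q by (simp add: continuous_seminorm_def)
  note q_nonneg = seminormD(5)[OF vs sq]
  have "\<exists>f. Vector_Spaces.linear smul (*) f \<and> (\<forall>x. norm (f x) \<le> q x) \<and> norm (f (a k)) = q (a k)" for k
    by (rule seminorm_Hahn_Banach[OF vs sq, of "a k"]) blast
  then obtain g where g: "\<And>k. Vector_Spaces.linear smul (*) (g k)"
    and g_le: "\<And>k x. norm (g k x) \<le> q x" and g_eq: "\<And>k. norm (g k (a k)) = q (a k)"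
    by metis
  define r :: "nat \<Rightarrow> 'k" where "r k = of_real ((1/3) ^ k)" for k
  have nr: "norm (r k) = (1/3) ^ k" for k by (simp add: r_def norm_power norm_divide)
  have "\<exists>s. \<forall>k. norm (s k) = 1 \<and>
      norm (r k * g k (a k)) \<le> norm ((\<Sum>i<k. s i * r i * g i (a k)) + s k * r k * g k (a k))"
    (is "\<exists>s. \<forall>k. ?P s k (s k)")
  proof (rule dependent_wellorder_choice)
    show "?P s k t = ?P s' k t" if "\<And>i. i < k \<Longrightarrow> s i = s' i" for s s' k t
      using that by simp
  next
    fix s k
    let ?u = "\<Sum>i<k. s i * r i * g i (a k)" and ?v = "r k * g k (a k)"
    have "norm ((?u + ?v) - (?u - ?v)) \<le> norm (?u + ?v) + norm (?u - ?v)"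
      by (rule norm_triangle_ineq4)
    moreover have "(?u + ?v) - (?u - ?v) = 2 * ?v" by simp
    ultimately have "2 * norm ?v \<le> norm (?u + ?v) + norm (?u - ?v)"
      by (simp add: norm_mult)
    \<comment> \<open>At least one of the signs 1 and -1 is good.\<close>
    then consider "norm ?v \<le> norm (?u + ?v)" | "norm ?v \<le> norm (?u - ?v)" by linarith
    then show "\<exists>t. ?P s k t"
      by cases (auto intro: exI[of _ 1] exI[of _ "-1"])
  qed
  then obtain s where s1: "\<And>k. norm (s k) = 1" and s2: "\<And>k. norm (r k * g k (a k)) \<le>
      norm ((\<Sum>i<k. s i * r i * g i (a k)) + s k * r k * g k (a k))" by blast
  define t where "t x = (\<lambda>k. s k * r k * g k x)" for x
  have t_le: "norm (t x k) \<le> (1/3) ^ k * q x" for x k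
    using g_le by (simp add: t_def norm_mult s1 nr mult_left_mono)
  have sm: "summable (\<lambda>k. (1/3) ^ (k + j) * q x)" for x j
    by (intro summable_mult2 summable_ignore_initial_segment summable_geometric) simp
  have smt: "summable (\<lambda>k. norm (t x (k + j)))" for x j
    by (rule summable_comparison_test'[OF sm[of j x], of 0]) (use t_le in auto)
  have smt0: "summable (t x)" for x using smt[of x 0] summable_norm_cancel by auto
  define h where "h x = suminf (t x)" for x
  have tail: "norm (\<Sum>k. t x (k + j)) \<le> (3/2) * (1/3) ^ j * q x" for x j
  proof -
    have "norm (\<Sum>k. t x (k + j)) \<le> (\<Sum>k. norm (t x (k + j)))" by (rule summable_norm[OF smt])
    also have "\<dots> \<le> (\<Sum>k. (1/3) ^ (k + j) * q x)" by (rule suminf_le[OF _ smt sm]) (rule t_le)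
    also have "\<dots> = (\<Sum>k. (1/3) ^ k * ((1/3) ^ j * q x))" by (simp add: power_add mult.assoc)
    also have "\<dots> = (3/2) * (1/3) ^ j * q x"
      using suminf_mult2[of "\<lambda>k. (1/3::real) ^ k" "(1/3) ^ j * q x"] suminf_geometric[of "1/3::real"]
      by (simp add: summable_geometric)
    finally show ?thesis .
  qed
  have "Vector_Spaces.linear smul (*) h"
  proof (rule linear_functionalI[OF vs])
    show "h (x + y) = h x + h y" for x y
      using suminf_add[OF smt0[of x] smt0[of y]]
      by (simp add: h_def t_def linear_functionalD(1)[OF g] distrib_left)
    show "h (smul c x) = c * h x" for c x
      using suminf_mult[OF smt0[of x], of c]
      by (simp add: h_def t_def linear_functionalD(2)[OF g] mult.left_commute)
  qed
  moreover have "norm (h x) \<le> (3/2) * q x" for x using tail[of x 0] by (simp add: h_def)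
  ultimately have "h \<in> top_dual smul" by (rule top_dualI[OF vs q])
  then obtain M where M: "\<And>k. norm (h (a k)) \<le> M" using wb aA by blast
  have "(1/2) * (4/3) ^ k < M" for k
  proof -
    have "h (a k) = (\<Sum>i. t (a k) (i + Suc k)) + (\<Sum>i<Suc k. t (a k) i)"
      unfolding h_def by (rule suminf_split_initial_segment[OF smt0])
    then have "norm (\<Sum>i<Suc k. t (a k) i) \<le> norm (h (a k)) + norm (\<Sum>i. t (a k) (i + Suc k))"
      by (metis add_diff_cancel_left' norm_triangle_ineq4)
    moreover have "(1/3) ^ k * q (a k) \<le> norm (\<Sum>i<Suc k. t (a k) i)"
      using s2[of k] by (simp add: t_def norm_mult nr g_eq)
    moreover have "norm (\<Sum>i. t (a k) (i + Suc k)) \<le> (1/2) * ((1/3) ^ k * q (a k))"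
      using tail[of "a k" "Suc k"] by simp
    moreover have "(1/3) ^ k * 4 ^ k < (1/3) ^ k * q (a k)" using a by simp
    moreover have "(1/3) ^ k * 4 ^ k = (4/3 :: real) ^ k" by (simp flip: power_mult_distrib)
    ultimately show ?thesis using M[of k] by linarith
  qed
  moreover obtain k where "2 * M < (4/3) ^ k" using real_arch_pow[of "4/3" "2 * M"] by auto
  ultimately show False using \<open>\<And>k. (1/2) * (4/3) ^ k < M\<close>[of k] by linarith
qed

section \<open>Normed spaces and their duals\<close>

context normed_space
begin

lemma scale_zero: "x \<in> ns_carrier Y \<Longrightarrow> ns_scale Y 0 x = ns_zero Y"
  using norm_scale[of x 0] norm_eq_zero[OF scale_closed, of x 0] by simp

lemma norm_zero: "ns_norm Y (ns_zero Y) = 0"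
  using norm_eq_zero[OF zero_closed] by simp

lemma scale_zero_right: "ns_scale Y c (ns_zero Y) = ns_zero Y"
  using scale_scale[OF zero_closed, of c 0] scale_zero[OF zero_closed] by simp

lemma add_minus: "x \<in> ns_carrier Y \<Longrightarrow> ns_add Y x (ns_scale Y (-1) x) = ns_zero Y"
  using scale_add_left[of x 1 "-1"] by (simp add: scale_one scale_zero)

lemma dist_eq: "\<lbrakk>x \<in> ns_carrier Y; y \<in> ns_carrier Y\<rbrakk> \<Longrightarrow>
    ns_dist Y x y = ns_norm Y (ns_add Y x (ns_scale Y (-1) y))"
  by (simp add: ns_dist_def)

lemma zero_add: "x \<in> ns_carrier Y \<Longrightarrow> ns_add Y (ns_zero Y) x = x"
  using add_zero[of x] add_commute[OF zero_closed, of x] by simp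

lemma diff_add_cancel:
  assumes "x \<in> ns_carrier Y" "y \<in> ns_carrier Y"
  shows "ns_add Y (ns_add Y x (ns_scale Y (-1) y)) y = x"
  using assms add_minus[of y] add_commute[of y "ns_scale Y (-1) y"]
  by (simp add: add_assoc scale_closed add_zero)

lemma dist_self_zero: "x \<in> ns_carrier Y \<Longrightarrow> ns_dist Y x (ns_zero Y) = ns_norm Y x"
  by (simp add: dist_eq zero_closed scale_zero_right add_zero)

lemma dist_commute: "ns_dist Y x y = ns_dist Y y x"
proof (cases "x \<in> ns_carrier Y \<and> y \<in> ns_carrier Y")
  case True
  then have "ns_scale Y (-1) (ns_add Y x (ns_scale Y (-1) y)) = ns_add Y y (ns_scale Y (-1) x)"
    by (simp add: scale_add_right scale_closed scale_scale scale_one add_commute)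
  then show ?thesis
    using norm_scale[of "ns_add Y x (ns_scale Y (-1) y)" "-1"] True
    by (simp add: dist_eq add_closed scale_closed)
qed (auto simp: ns_dist_def)

lemma metric: "Metric_space (ns_carrier Y) (ns_dist Y)"
proof
  show "0 \<le> ns_dist Y x y" for x y
    by (simp add: ns_dist_def norm_nonneg add_closed scale_closed)
  show "ns_dist Y x y = ns_dist Y y x" for x y by (rule dist_commute)
  show "ns_dist Y x y = 0 \<longleftrightarrow> x = y" if "x \<in> ns_carrier Y" "y \<in> ns_carrier Y" for x y
  proof
    assume "ns_dist Y x y = 0"
    then have "ns_add Y x (ns_scale Y (-1) y) = ns_zero Y"
      using that by (simp add: dist_eq norm_eq_zero add_closed scale_closed)
    then show "x = y" using diff_add_cancel[OF that] that by (simp add: zero_add)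
  qed (use that in \<open>simp add: dist_eq add_minus norm_zero\<close>)
  show "ns_dist Y x z \<le> ns_dist Y x y + ns_dist Y y z"
    if "x \<in> ns_carrier Y" "y \<in> ns_carrier Y" "z \<in> ns_carrier Y" for x y z
  proof -
    have "ns_add Y (ns_add Y x (ns_scale Y (-1) y)) (ns_add Y y (ns_scale Y (-1) z))
        = ns_add Y x (ns_scale Y (-1) z)"
      using that diff_add_cancel[of x y]
      by (simp add: scale_closed add_closed flip: add_assoc)
    then show ?thesis
      using norm_triangle[of "ns_add Y x (ns_scale Y (-1) y)" "ns_add Y y (ns_scale Y (-1) z)"] that
      by (simp add: dist_eq add_closed scale_closed)
  qed
qed

sublocale ns: Metric_space "ns_carrier Y" "ns_dist Y"
  by (rule metric)

lemma topology_eq: "ns_topology Y = ns.mtopology"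
  by (simp add: ns_topology_def)

lemma relatively_compact_imp_finite_net:
  assumes "ns_relatively_compact Y A" "\<epsilon> > 0"
  obtains K where "finite K" "K \<subseteq> A" "\<And>a. a \<in> A \<Longrightarrow> \<exists>b\<in>K. ns_dist Y a b < \<epsilon>"
proof -
  have A: "A \<subseteq> ns_carrier Y" and "compactin ns.mtopology (ns.mtopology closure_of A)"
    using assms(1) by (auto simp: ns_relatively_compact_def topology_eq)
  then have "ns.mtotally_bounded (ns.mtopology closure_of A)"
    by (intro ns.compactin_imp_mtotally_bounded)
  then have "ns.mtotally_bounded A"
    using A ns.mtotally_bounded_closure_of_eq by blast
  then obtain K where K: "finite K" "K \<subseteq> A" "A \<subseteq> (\<Union>x\<in>K. ns.mball x \<epsilon>)"
    using assms(2) by (auto simp: ns.mtotally_bounded_def)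
  have "\<exists>b\<in>K. ns_dist Y a b < \<epsilon>" if "a \<in> A" for a
  proof -
    have "a \<in> (\<Union>x\<in>K. ns.mball x \<epsilon>)" using K(3) that by (rule subsetD)
    then obtain b where b: "b \<in> K" "a \<in> ns.mball b \<epsilon>" by (rule UN_E)
    then have "ns_dist Y a b < \<epsilon>" by (simp add: ns.commute[of a])
    with b(1) show ?thesis by blast
  qed
  with K that show ?thesis by blast
qed

text \<open>
  In a complete space relative compactness is total boundedness, which asks for Cauchy subsequences;
  no limit has to be exhibited.
\<close>

lemma relatively_compact_sequentially:
  assumes complete: "ns.mcomplete" and A: "A \<subseteq> ns_carrier Y"
    and seq: "\<And>\<sigma> :: nat \<Rightarrow> 'y. range \<sigma> \<subseteq> A \<Longrightarrow>
      \<exists>r :: nat \<Rightarrow> nat. strict_mono r \<and> (\<forall>\<epsilon>>0. \<exists>N. \<forall>m\<ge>N. \<forall>n\<ge>N. ns_dist Y (\<sigma> (r m)) (\<sigma> (r n)) < \<epsilon>)"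
  shows "ns_relatively_compact Y A"
proof -
  have "ns.mtotally_bounded A"
    unfolding ns.mtotally_bounded_sequentially
  proof (intro conjI allI impI A)
    fix \<sigma> :: "nat \<Rightarrow> 'y" assume \<sigma>: "range \<sigma> \<subseteq> A"
    from seq[OF this] obtain r :: "nat \<Rightarrow> nat" where r: "strict_mono r"
      "\<forall>\<epsilon>>0. \<exists>N. \<forall>m\<ge>N. \<forall>n\<ge>N. ns_dist Y (\<sigma> (r m)) (\<sigma> (r n)) < \<epsilon>" by (elim exE conjE)
    have "range (\<sigma> \<circ> r) \<subseteq> ns_carrier Y" using \<sigma> A by fastforce
    moreover have "\<exists>N. \<forall>m n. N \<le> m \<longrightarrow> N \<le> n \<longrightarrow> ns_dist Y ((\<sigma> \<circ> r) m) ((\<sigma> \<circ> r) n) < \<epsilon>"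
      if "\<epsilon> > 0" for \<epsilon>
      using r(2)[rule_format, OF that] unfolding comp_def by (elim exE) (rule exI, simp)
    ultimately have "strict_mono r \<and> ns.MCauchy (\<sigma> \<circ> r)"
      using r(1) unfolding ns.MCauchy_def by blast
    then show "\<exists>r :: nat \<Rightarrow> nat. strict_mono r \<and> ns.MCauchy (\<sigma> \<circ> r)" by blast
  qed
  then have "compactin ns.mtopology (ns.mtopology closure_of A)"
    using ns.mtotally_bounded_eq_compact_closure_of[OF complete] by blast
  with A show ?thesis by (simp add: ns_relatively_compact_def topology_eq)
qed

text \<open>
  An additive map that is continuous at zero is continuous everywhere, by translation.
\<close>

lemma continuous_mapI:
  fixes T :: "'y \<Rightarrow> 'e::{topological_ab_group_add}"
  assumes add: "\<And>x y. \<lbrakk>x \<in> ns_carrier Y; y \<in> ns_carrier Y\<rbrakk> \<Longrightarrow> T (ns_add Y x y) = T x + T y"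
    and cont: "\<And>U. \<lbrakk>open U; 0 \<in> U\<rbrakk> \<Longrightarrow>
      \<exists>\<delta>>0. \<forall>y\<in>ns_carrier Y. ns_norm Y y < \<delta> \<longrightarrow> T y \<in> U"
  shows "continuous_map (ns_topology Y) euclidean T"
  unfolding continuous_map_def topology_eq
proof (intro conjI allI impI)
  fix U :: "'e set" assume "openin euclidean U"
  then have U: "open U" by simp
  show "openin ns.mtopology {x \<in> topspace ns.mtopology. T x \<in> U}"
    unfolding ns.openin_mtopology
  proof (intro conjI allI impI)
    fix x assume "x \<in> {x \<in> topspace ns.mtopology. T x \<in> U}"
    then have x: "x \<in> ns_carrier Y" "T x \<in> U" by auto
    have "open ((\<lambda>z. z + T x) -` U)"
      by (intro open_vimage[OF U] continuous_on_add continuous_on_id continuous_on_const)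
    moreover have "0 \<in> (\<lambda>z. z + T x) -` U" using x by simp
    ultimately obtain \<delta> where \<delta>: "\<delta> > 0"
      "\<And>y. y \<in> ns_carrier Y \<Longrightarrow> ns_norm Y y < \<delta> \<Longrightarrow> T y \<in> (\<lambda>z. z + T x) -` U"
      using cont by metis
    have "T y \<in> U" if "y \<in> ns.mball x \<delta>" for y
    proof -
      have y: "y \<in> ns_carrier Y" "ns_dist Y y x < \<delta>" using that by (auto simp: ns.commute)
      let ?z = "ns_add Y y (ns_scale Y (-1) x)"
      have z: "?z \<in> ns_carrier Y" using x y by (simp add: add_closed scale_closed)
      then have "T ?z + T x \<in> U" using \<delta>(2)[of ?z] x y by (simp add: dist_eq)
      then show ?thesis using add[OF z x(1)] diff_add_cancel[OF y(1) x(1)] by simp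
    qed
    with \<delta>(1) show "\<exists>r>0. ns.mball x r \<subseteq> {x \<in> topspace ns.mtopology. T x \<in> U}"
      by (intro exI[of _ \<delta>]) auto
  qed auto
qed auto

lemma operator_into_locally_convexI:
  fixes smul :: "'k \<Rightarrow> 'e::{topological_ab_group_add, t2_space} \<Rightarrow> 'e"
  assumes lc: "locally_convex_space smul"
    and add: "\<And>x y. \<lbrakk>x \<in> ns_carrier Y; y \<in> ns_carrier Y\<rbrakk> \<Longrightarrow> T (ns_add Y x y) = T x + T y"
    and scale: "\<And>c x. x \<in> ns_carrier Y \<Longrightarrow> T (ns_scale Y c x) = smul c (T x)"
    and bound: "\<And>q. continuous_seminorm smul q \<Longrightarrow>
      \<exists>C. \<forall>y\<in>ns_carrier Y. q (T y) \<le> C * ns_norm Y y"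
  shows "ns_operator Y smul T"
proof -
  have "continuous_map (ns_topology Y) euclidean T"
  proof (rule continuous_mapI[OF add])
    fix U :: "'e set" assume "open U" "0 \<in> U"
    then obtain q where q: "continuous_seminorm smul q" "{x. q x < 1} \<subseteq> U"
      using continuous_seminorm_basis[OF lc] by metis
    obtain C where C: "\<And>y. y \<in> ns_carrier Y \<Longrightarrow> q (T y) \<le> C * ns_norm Y y"
      using bound[OF q(1)] by blast
    have "T y \<in> U" if "y \<in> ns_carrier Y" "ns_norm Y y < 1 / (\<bar>C\<bar> + 1)" for y
    proof -
      have "q (T y) \<le> (\<bar>C\<bar> + 1) * ns_norm Y y"
        using C[OF that(1)] norm_nonneg[OF that(1)]
        by (meson abs_ge_self add_increasing2 mult_right_mono order_trans zero_le_one)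
      also have "\<dots> < 1" using that(2) by (simp add: field_simps)
      finally show ?thesis using q(2) by blast
    qed
    moreover have "1 / (\<bar>C\<bar> + 1) > 0" by (simp add: add_nonneg_pos)
    ultimately show "\<exists>\<delta>>0. \<forall>y\<in>ns_carrier Y. ns_norm Y y < \<delta> \<longrightarrow> T y \<in> U" by blast
  qed
  with add scale show ?thesis by (simp add: ns_operator_def)
qed

lemma operator_small:
  assumes T: "ns_operator Y smul T" and U: "open U" "0 \<in> U"
  shows "\<exists>\<delta>>0. \<forall>y\<in>ns_carrier Y. ns_norm Y y < \<delta> \<longrightarrow> T y \<in> U"
proof -
  have "T (ns_add Y (ns_zero Y) (ns_zero Y)) = T (ns_zero Y) + T (ns_zero Y)"
    using T zero_closed by (simp add: ns_operator_def)
  then have T0: "T (ns_zero Y) = 0" using add_zero[OF zero_closed] by simp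
  have "openin ns.mtopology {x \<in> topspace ns.mtopology. T x \<in> U}"
    using T U by (intro openin_continuous_map_preimage) (auto simp: ns_operator_def topology_eq)
  moreover have "ns_zero Y \<in> {x \<in> topspace ns.mtopology. T x \<in> U}"
    using T0 U by (simp add: zero_closed)
  ultimately obtain \<delta> where \<delta>: "\<delta> > 0"
    "ns.mball (ns_zero Y) \<delta> \<subseteq> {x \<in> topspace ns.mtopology. T x \<in> U}"
    unfolding ns.openin_mtopology by blast
  have "T y \<in> U" if "y \<in> ns_carrier Y" "ns_norm Y y < \<delta>" for y
  proof -
    have "y \<in> ns.mball (ns_zero Y) \<delta>"
      using that by (simp add: zero_closed ns.commute[of "ns_zero Y"] dist_self_zero)
    then show ?thesis using \<delta>(2) by auto
  qed
  with \<delta>(1) show ?thesis by blast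
qed

lemma functional_iff_bounded:
  "ns_operator Y (*) f \<longleftrightarrow>
     (\<forall>x\<in>ns_carrier Y. \<forall>y\<in>ns_carrier Y. f (ns_add Y x y) = f x + f y) \<and>
     (\<forall>c. \<forall>x\<in>ns_carrier Y. f (ns_scale Y c x) = c * f x) \<and>
     (\<exists>C. \<forall>y\<in>ns_carrier Y. norm (f y) \<le> C * ns_norm Y y)" (is "_ \<longleftrightarrow> ?add \<and> ?scale \<and> ?bdd")
proof safe
  assume op: "ns_operator Y (*) f"
  then show add: "f (ns_add Y x y) = f x + f y" if "x \<in> ns_carrier Y" "y \<in> ns_carrier Y" for x y
    using that by (simp add: ns_operator_def)
  from op show scale: "f (ns_scale Y c x) = c * f x" if "x \<in> ns_carrier Y" for c x
    using that by (simp add: ns_operator_def)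
  have f0: "f (ns_zero Y) = 0"
    using scale[OF zero_closed, of 0] scale_zero[OF zero_closed] by simp
  have "\<exists>\<delta>>0. \<forall>y\<in>ns_carrier Y. ns_norm Y y < \<delta> \<longrightarrow> f y \<in> ball 0 1"
    by (rule operator_small[OF op]) auto
  then obtain \<delta> where \<delta>: "\<delta> > 0"
    and less1: "\<And>y. y \<in> ns_carrier Y \<Longrightarrow> ns_norm Y y < \<delta> \<Longrightarrow> norm (f y) < 1" by auto
  have "norm (f y) \<le> (2 / \<delta>) * ns_norm Y y" if y: "y \<in> ns_carrier Y" for y
  proof (cases "ns_norm Y y = 0")
    case True
    then show ?thesis using f0 norm_eq_zero[OF y] by simp
  next
    case False
    then have pos: "ns_norm Y y > 0" using norm_nonneg[OF y] by simp
    let ?c = "of_real (\<delta> / (2 * ns_norm Y y)) :: 'k"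
    have nc: "norm ?c = \<delta> / (2 * ns_norm Y y)" using pos \<delta> by (simp only: norm_of_real) simp
    have "ns_norm Y (ns_scale Y ?c y) < \<delta>"
      using y pos \<delta> nc by (simp add: norm_scale)
    then have "norm (?c * f y) < 1"
      using less1[of "ns_scale Y ?c y"] y by (simp only: scale scale_closed)
    then have "\<delta> / (2 * ns_norm Y y) * norm (f y) < 1" by (simp only: norm_mult nc)
    then show ?thesis using pos \<delta> by (simp add: field_simps)
  qed
  then show ?bdd by blast
next
  fix C assume add: ?add and scale: ?scale and C: "\<forall>y\<in>ns_carrier Y. norm (f y) \<le> C * ns_norm Y y"
  have "continuous_map (ns_topology Y) euclidean f"
  proof (rule continuous_mapI)
    fix U :: "'k set" assume "open U" "0 \<in> U"
    then obtain e where e: "e > 0" "ball 0 e \<subseteq> U" by (meson open_contains_ball)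
    have "f y \<in> U" if "y \<in> ns_carrier Y" "ns_norm Y y < e / (\<bar>C\<bar> + 1)" for y
    proof -
      have "norm (f y) \<le> (\<bar>C\<bar> + 1) * ns_norm Y y"
        using C that(1) norm_nonneg[OF that(1)]
        by (meson abs_ge_self add_increasing2 mult_right_mono order_trans zero_le_one)
      also have "\<dots> < e" using that(2) by (simp add: field_simps)
      finally show ?thesis using e(2) by auto
    qed
    moreover have "e / (\<bar>C\<bar> + 1) > 0" using e(1) by (simp add: add_nonneg_pos)
    ultimately show "\<exists>\<delta>>0. \<forall>y\<in>ns_carrier Y. ns_norm Y y < \<delta> \<longrightarrow> f y \<in> U" by blast
  qed (use add in blast)
  with add scale show "ns_operator Y (*) f" by (simp add: ns_operator_def)
qed

lemma functional_bound:
  assumes "ns_operator Y (*) f"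
  obtains C where "C \<ge> 0" "\<And>y. y \<in> ns_carrier Y \<Longrightarrow> norm (f y) \<le> C * ns_norm Y y"
proof -
  obtain C where C: "\<And>y. y \<in> ns_carrier Y \<Longrightarrow> norm (f y) \<le> C * ns_norm Y y"
    using assms functional_iff_bounded by blast
  have "norm (f y) \<le> \<bar>C\<bar> * ns_norm Y y" if "y \<in> ns_carrier Y" for y
    using C[OF that] norm_nonneg[OF that] by (meson abs_ge_self mult_right_mono order_trans)
  then show ?thesis by (rule that[of "\<bar>C\<bar>", rotated]) simp_all
qed

text \<open>
  The dual norm is a supremum of reals, which is meaningful because \<open>functional_bound\<close> bounds it; the
  inequality for general \<open>y\<close> follows by normalizing \<open>y\<close>.
\<close>

lemma dual_norm_bound:
  assumes "ns_operator Y (*) f" "y \<in> ns_carrier Y"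
  shows "norm (f y) \<le> ns_norm (ns_dual Y) f * ns_norm Y y"
proof -
  obtain C where C: "C \<ge> 0" "\<And>y. y \<in> ns_carrier Y \<Longrightarrow> norm (f y) \<le> C * ns_norm Y y"
    by (rule functional_bound[OF assms(1)]) blast
  have scale: "f (ns_scale Y c x) = c * f x" if "x \<in> ns_carrier Y" for c x
    using that assms(1) by (simp add: ns_operator_def)
  let ?B = "{y \<in> ns_carrier Y. ns_norm Y y \<le> 1}"
  have "bdd_above ((\<lambda>y. norm (f y)) ` ?B)"
  proof (rule bdd_aboveI2)
    show "norm (f y) \<le> C" if "y \<in> ?B" for y
      using C(2)[of y] that mult_left_le[of "ns_norm Y y" C] C(1) by simp
  qed
  then have le: "norm (f y) \<le> ns_norm (ns_dual Y) f" if "y \<in> ?B" for y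
    using cSUP_upper[OF that] by (simp add: ns_dual_def)
  show ?thesis
  proof (cases "ns_norm Y y = 0")
    case True
    then have "norm (f y) \<le> 0" using C(2)[OF assms(2)] by simp
    with True show ?thesis by simp
  next
    case False
    then have pos: "ns_norm Y y > 0" using norm_nonneg[OF assms(2)] by simp
    let ?c = "of_real (1 / ns_norm Y y) :: 'k"
    have nc: "norm ?c = 1 / ns_norm Y y" using pos by (simp only: norm_of_real) simp
    have "norm (f (ns_scale Y ?c y)) \<le> ns_norm (ns_dual Y) f"
      by (rule le) (use assms(2) nc pos in \<open>simp add: scale_closed norm_scale del: of_real_divide\<close>)
    then have "1 / ns_norm Y y * norm (f y) \<le> ns_norm (ns_dual Y) f"
      by (simp only: scale[OF assms(2)] norm_mult nc)
    then show ?thesis using pos by (simp add: field_simps)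
  qed
qed

lemma dual_norm_le:
  assumes "\<And>y. y \<in> ns_carrier Y \<Longrightarrow> ns_norm Y y \<le> 1 \<Longrightarrow> norm (f y) \<le> C"
  shows "ns_norm (ns_dual Y) f \<le> C"
proof -
  have "(SUP y\<in>{y \<in> ns_carrier Y. ns_norm Y y \<le> 1}. norm (f y)) \<le> C"
    by (rule cSUP_least) (use assms zero_closed norm_zero in auto)
  then show ?thesis by (simp add: ns_dual_def)
qed

lemma dual_carrier: "f \<in> ns_carrier (ns_dual Y) \<longleftrightarrow>
    f \<in> extensional (ns_carrier Y) \<and> ns_operator Y (*) f"
  by (simp add: ns_dual_def)

lemma functional_zero: "ns_operator Y (*) f \<Longrightarrow> f (ns_zero Y) = 0"
  using scale_zero[OF zero_closed] by (metis mult_zero_left ns_operator_def zero_closed)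

lemma functional_cong:
  assumes "ns_operator Y (*) f" "\<And>y. y \<in> ns_carrier Y \<Longrightarrow> f y = g y"
  shows "ns_operator Y (*) g"
  using assms by (simp add: functional_iff_bounded add_closed scale_closed)

lemma functional_add:
  assumes "ns_operator Y (*) f" "ns_operator Y (*) g"
  shows "ns_operator Y (*) (\<lambda>y. f y + g y)"
  unfolding functional_iff_bounded
proof (intro conjI ballI allI)
  obtain C where C: "\<And>y. y \<in> ns_carrier Y \<Longrightarrow> norm (f y) \<le> C * ns_norm Y y"
    by (rule functional_bound[OF assms(1)]) blast
  obtain D where D: "\<And>y. y \<in> ns_carrier Y \<Longrightarrow> norm (g y) \<le> D * ns_norm Y y"
    by (rule functional_bound[OF assms(2)]) blast
  show "\<exists>C. \<forall>y\<in>ns_carrier Y. norm (f y + g y) \<le> C * ns_norm Y y"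
    using C D by (intro exI[of _ "C + D"]) (auto simp: distrib_right intro!: norm_triangle_mono)
qed (use assms in \<open>auto simp: ns_operator_def distrib_left\<close>)

lemma functional_scale:
  assumes "ns_operator Y (*) f"
  shows "ns_operator Y (*) (\<lambda>y. c * f y)"
  unfolding functional_iff_bounded
proof (intro conjI ballI allI)
  obtain C where C: "\<And>y. y \<in> ns_carrier Y \<Longrightarrow> norm (f y) \<le> C * ns_norm Y y"
    by (rule functional_bound[OF assms(1)]) blast
  show "\<exists>C. \<forall>y\<in>ns_carrier Y. norm (c * f y) \<le> C * ns_norm Y y"
    using C by (intro exI[of _ "norm c * C"]) (auto simp: norm_mult mult.assoc intro!: mult_left_mono)
qed (use assms in \<open>auto simp: ns_operator_def distrib_left mult.left_commute\<close>)

lemma dual_normed_space: "normed_space (ns_dual Y)"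
proof
  let ?D = "ns_dual Y"
  have add_eq: "ns_add ?D f g = restrict (\<lambda>y. f y + g y) (ns_carrier Y)" for f g
    by (simp add: ns_dual_def)
  have scale_eq: "ns_scale ?D c f = restrict (\<lambda>y. c * f y) (ns_carrier Y)" for c f
    by (simp add: ns_dual_def)
  have zero_eq: "ns_zero ?D = restrict (\<lambda>y. 0) (ns_carrier Y)"
    by (simp add: ns_dual_def)
  have "ns_operator Y (*) (\<lambda>y. 0)"
    by (auto simp: functional_iff_bounded intro: exI[of _ 0])
  then show "ns_zero ?D \<in> ns_carrier ?D"
    by (auto simp: zero_eq dual_carrier elim: functional_cong)
  show "ns_add ?D f g \<in> ns_carrier ?D" if "f \<in> ns_carrier ?D" "g \<in> ns_carrier ?D" for f g
    using functional_add[of f g] that by (auto simp: add_eq dual_carrier elim: functional_cong)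
  show scale_closed': "ns_scale ?D c f \<in> ns_carrier ?D" if "f \<in> ns_carrier ?D" for c f
    using functional_scale[of f c] that by (auto simp: scale_eq dual_carrier elim: functional_cong)
  show "\<exists>g\<in>ns_carrier ?D. ns_add ?D f g = ns_zero ?D" if "f \<in> ns_carrier ?D" for f
  proof
    show "ns_scale ?D (-1) f \<in> ns_carrier ?D" by (rule scale_closed'[OF that])
    show "ns_add ?D f (ns_scale ?D (-1) f) = ns_zero ?D"
      by (auto simp: scale_eq add_eq zero_eq)
  qed
  show "ns_norm ?D f = 0 \<longleftrightarrow> f = ns_zero ?D" if "f \<in> ns_carrier ?D" for f
  proof
    assume "ns_norm ?D f = 0"
    then have "f y = 0" if "y \<in> ns_carrier Y" for y
      using dual_norm_bound[OF _ that, of f] \<open>f \<in> ns_carrier ?D\<close> by (simp add: dual_carrier)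
    then show "f = ns_zero ?D" using that
      by (auto simp: zero_eq dual_carrier intro!: extensionalityI[of _ "ns_carrier Y"])
  next
    assume "f = ns_zero ?D"
    then have "f y = 0" if "y \<in> ns_carrier Y" for y using that by (simp add: zero_eq)
    then have "ns_norm ?D f \<le> 0" by (intro dual_norm_le) simp
    moreover have "0 \<le> ns_norm ?D f"
      unfolding ns_dual_def nspace.simps using \<open>\<And>y. y \<in> ns_carrier Y \<Longrightarrow> f y = 0\<close>
      by (intro cSUP_upper2[of _ _ "ns_zero Y"]) (auto simp: zero_closed norm_zero)
    ultimately show "ns_norm ?D f = 0" by simp
  qed
  have ge0: "0 \<le> ns_norm ?D f" if f: "f \<in> ns_carrier ?D" for f
  proof -
    obtain C where C: "C \<ge> 0" "\<And>y. y \<in> ns_carrier Y \<Longrightarrow> norm (f y) \<le> C * ns_norm Y y"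
      by (rule functional_bound[of f]) (use f dual_carrier in auto)
    have "norm (f y) \<le> C" if "y \<in> ns_carrier Y" "ns_norm Y y \<le> 1" for y
      using C(2)[of y] that mult_left_le[of "ns_norm Y y" C] C(1) by simp
    then have "bdd_above ((\<lambda>y. norm (f y)) ` {y \<in> ns_carrier Y. ns_norm Y y \<le> 1})"
      by (intro bdd_aboveI2[of _ _ C]) auto
    then show ?thesis unfolding ns_dual_def nspace.simps
      by (intro cSUP_upper2[of _ _ "ns_zero Y"]) (auto simp: zero_closed norm_zero)
  qed
  then show "0 \<le> ns_norm ?D f" if "f \<in> ns_carrier ?D" for f using that .
  have bound1: "norm (f y) \<le> ns_norm ?D f"
    if "f \<in> ns_carrier ?D" "y \<in> ns_carrier Y" "ns_norm Y y \<le> 1" for f y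
    using dual_norm_bound[of f y] that ge0[of f] mult_left_le[of "ns_norm Y y" "ns_norm ?D f"]
    by (simp add: dual_carrier)
  show "ns_norm ?D (ns_add ?D f g) \<le> ns_norm ?D f + ns_norm ?D g"
    if "f \<in> ns_carrier ?D" "g \<in> ns_carrier ?D" for f g
    by (rule dual_norm_le) (use bound1 that in \<open>auto simp: add_eq intro!: norm_triangle_mono\<close>)
  have le: "ns_norm ?D (ns_scale ?D c f) \<le> norm c * ns_norm ?D f" if "f \<in> ns_carrier ?D" for c f
    by (rule dual_norm_le) (use bound1 that in \<open>auto simp: scale_eq norm_mult intro!: mult_left_mono\<close>)
  show "ns_norm ?D (ns_scale ?D c f) = norm c * ns_norm ?D f" if f: "f \<in> ns_carrier ?D" for c f
  proof (cases "c = 0")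
    case True
    then show ?thesis using le[OF f, of c] ge0[OF scale_closed'[OF f], of c] by simp
  next
    case False
    have "ns_scale ?D (inverse c) (ns_scale ?D c f) = f"
      using f False by (auto simp: scale_eq dual_carrier intro!: extensionalityI[of _ "ns_carrier Y"])
    then have "norm c * ns_norm ?D f = norm c * ns_norm ?D (ns_scale ?D (inverse c) (ns_scale ?D c f))"
      by simp
    also have "\<dots> \<le> norm c * (norm (inverse c) * ns_norm ?D (ns_scale ?D c f))"
      by (intro mult_left_mono le scale_closed' f) simp
    also have "\<dots> = ns_norm ?D (ns_scale ?D c f)" using False by (simp add: norm_inverse)
    finally show ?thesis using le[OF f, of c] by simp
  qed
qed (auto simp: ns_dual_def add.assoc add.commute algebra_simps scale_closed
      intro!: extensionalityI[of _ "ns_carrier Y"])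

lemma completeI:
  assumes "\<And>\<sigma> :: nat \<Rightarrow> 'y. \<lbrakk>\<And>n. \<sigma> n \<in> ns_carrier Y;
      \<And>\<epsilon>. \<epsilon> > 0 \<Longrightarrow> \<exists>N. \<forall>m\<ge>N. \<forall>n\<ge>N. ns_dist Y (\<sigma> m) (\<sigma> n) < \<epsilon>\<rbrakk> \<Longrightarrow>
      \<exists>x\<in>ns_carrier Y. \<forall>\<epsilon>>0. \<exists>N. \<forall>n\<ge>N. ns_dist Y (\<sigma> n) x \<le> \<epsilon>"
  shows "ns.mcomplete"
  unfolding ns.mcomplete_def
proof (intro allI impI)
  fix \<sigma> :: "nat \<Rightarrow> 'y" assume \<sigma>: "ns.MCauchy \<sigma>"
  then have cl: "\<sigma> n \<in> ns_carrier Y" for n by (auto simp: ns.MCauchy_def)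
  have cauchy: "\<exists>N. \<forall>m\<ge>N. \<forall>n\<ge>N. ns_dist Y (\<sigma> m) (\<sigma> n) < \<epsilon>" if "\<epsilon> > 0" for \<epsilon>
    using \<sigma> that unfolding ns.MCauchy_def by (elim conjE allE[of _ \<epsilon>] impE) auto
  have "\<exists>x\<in>ns_carrier Y. \<forall>\<epsilon>>0. \<exists>N. \<forall>n\<ge>N. ns_dist Y (\<sigma> n) x \<le> \<epsilon>"
    by (rule assms[OF cl cauchy])
  then obtain x where x: "x \<in> ns_carrier Y"
    "\<forall>\<epsilon>>0. \<exists>N. \<forall>n\<ge>N. ns_dist Y (\<sigma> n) x \<le> \<epsilon>" ..
  have "\<forall>\<^sub>F n in sequentially. \<sigma> n \<in> ns_carrier Y \<and> ns_dist Y (\<sigma> n) x < \<epsilon>" if "\<epsilon> > 0" for \<epsilon>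
  proof -
    have "\<epsilon> / 2 > 0" using that by simp
    from x(2)[rule_format, OF this] obtain N where N: "\<forall>n\<ge>N. ns_dist Y (\<sigma> n) x \<le> \<epsilon> / 2" ..
    have "\<sigma> n \<in> ns_carrier Y \<and> ns_dist Y (\<sigma> n) x < \<epsilon>" if "n \<ge> N" for n
      using N[rule_format, OF that] cl[of n] \<open>\<epsilon> > 0\<close> by simp
    then show ?thesis by (rule eventually_sequentiallyI)
  qed
  then show "\<exists>x. limitin ns.mtopology \<sigma> x sequentially"
    using x(1) by (intro exI[of _ x]) (simp add: ns.limitin_metric)
qed

lemma dual_dist:
  assumes "f \<in> ns_carrier (ns_dual Y)" "g \<in> ns_carrier (ns_dual Y)"
  shows "ns_dist (ns_dual Y) f g =
    ns_norm (ns_dual Y) (restrict (\<lambda>y. f y - g y) (ns_carrier Y))"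
proof -
  have "ns_add (ns_dual Y) f (ns_scale (ns_dual Y) (-1) g) = restrict (\<lambda>y. f y - g y) (ns_carrier Y)"
    by (auto simp: ns_dual_def)
  then show ?thesis using assms by (simp add: ns_dist_def)
qed

lemma dual_dist_bound:
  assumes f: "f \<in> ns_carrier (ns_dual Y)" and g: "g \<in> ns_carrier (ns_dual Y)"
    and y: "y \<in> ns_carrier Y"
  shows "norm (f y - g y) \<le> ns_dist (ns_dual Y) f g * ns_norm Y y"
proof -
  have "ns_operator Y (*) (\<lambda>y. f y + (-1) * g y)"
    using f g by (intro functional_add functional_scale) (auto simp: dual_carrier)
  then have "ns_operator Y (*) (restrict (\<lambda>y. f y - g y) (ns_carrier Y))"
    by (rule functional_cong) simp
  from dual_norm_bound[OF this y] show ?thesis using y by (simp add: dual_dist[OF f g])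
qed

lemma dual_dist_le:
  assumes "f \<in> ns_carrier (ns_dual Y)" "g \<in> ns_carrier (ns_dual Y)"
    and "\<And>y. y \<in> ns_carrier Y \<Longrightarrow> ns_norm Y y \<le> 1 \<Longrightarrow> norm (f y - g y) \<le> C"
  shows "ns_dist (ns_dual Y) f g \<le> C"
  unfolding dual_dist[OF assms(1,2)] by (rule dual_norm_le) (use assms(3) in simp)

text \<open>
  A Cauchy sequence of functionals is pointwise Cauchy, and the Cauchy estimate passes to the pointwise
  limit, uniformly on the unit ball.
\<close>

lemma dual_complete: "Metric_space.mcomplete (ns_carrier (ns_dual Y)) (ns_dist (ns_dual Y))"
proof -
  interpret D: normed_space "ns_dual Y" by (rule dual_normed_space)
  show ?thesis
  proof (rule D.completeI)
    fix \<sigma> :: "nat \<Rightarrow> 'y \<Rightarrow> 'k"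
    assume cl: "\<And>n. \<sigma> n \<in> ns_carrier (ns_dual Y)"
      and cauchy: "\<And>\<epsilon>. \<epsilon> > 0 \<Longrightarrow> \<exists>N. \<forall>m\<ge>N. \<forall>n\<ge>N. ns_dist (ns_dual Y) (\<sigma> m) (\<sigma> n) < \<epsilon>"
    have op: "ns_operator Y (*) (\<sigma> n)" for n using cl[of n] by (simp add: dual_carrier)
    have close: "norm (\<sigma> m y - \<sigma> n y) \<le> \<epsilon> * ns_norm Y y"
      if "ns_dist (ns_dual Y) (\<sigma> m) (\<sigma> n) < \<epsilon>" "y \<in> ns_carrier Y" for m n \<epsilon> y
      using dual_dist_bound[OF cl cl that(2), of m n] that(1)
        mult_right_mono[OF less_imp_le[OF that(1)] norm_nonneg[OF that(2)]] by linarith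
    have "convergent (\<lambda>n. \<sigma> n y)" if y: "y \<in> ns_carrier Y" for y
    proof (rule Cauchy_convergent, rule CauchyI)
      fix e :: real assume e: "e > 0"
      define \<epsilon> where "\<epsilon> = e / (2 * (ns_norm Y y + 1))"
      have pos: "ns_norm Y y + 1 > 0" using norm_nonneg[OF y] by simp
      then have "\<epsilon> > 0" using e by (simp add: \<epsilon>_def)
      have "\<epsilon> * ns_norm Y y \<le> \<epsilon> * (ns_norm Y y + 1)" using \<open>\<epsilon> > 0\<close> by simp
      also have "\<dots> = e / 2"
      proof -
        have "e / (2 * b) * b = e / 2" if "b > 0" for b :: real using that by simp
        from this[OF pos] show ?thesis by (simp only: \<epsilon>_def)
      qed
      also have "\<dots> < e" using e by simp
      finally have lt: "\<epsilon> * ns_norm Y y < e" .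
      from cauchy[OF \<open>\<epsilon> > 0\<close>] obtain N where
        N: "\<forall>m\<ge>N. \<forall>n\<ge>N. ns_dist (ns_dual Y) (\<sigma> m) (\<sigma> n) < \<epsilon>" ..
      have "norm (\<sigma> m y - \<sigma> n y) < e" if "m \<ge> N" "n \<ge> N" for m n
        using close[OF N[rule_format, OF that] y] lt by simp
      then show "\<exists>M. \<forall>m\<ge>M. \<forall>n\<ge>M. norm (\<sigma> m y - \<sigma> n y) < e" by blast
    qed
    then have lim: "(\<lambda>n. \<sigma> n y) \<longlonglongrightarrow> lim (\<lambda>n. \<sigma> n y)" if "y \<in> ns_carrier Y" for y
      using that by (simp add: convergent_LIMSEQ_iff)
    define g where "g = restrict (\<lambda>y. lim (\<lambda>n. \<sigma> n y)) (ns_carrier Y)"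
    have limg: "(\<lambda>n. \<sigma> n y) \<longlonglongrightarrow> g y" if "y \<in> ns_carrier Y" for y
      using lim[OF that] that by (simp add: g_def)
    have closeg: "norm (\<sigma> m y - g y) \<le> \<epsilon> * ns_norm Y y"
      if N: "\<forall>m\<ge>N. \<forall>n\<ge>N. ns_dist (ns_dual Y) (\<sigma> m) (\<sigma> n) < \<epsilon>" and "m \<ge> N" "y \<in> ns_carrier Y"
      for N m \<epsilon> y
    proof (rule LIMSEQ_le_const2)
      show "(\<lambda>n. norm (\<sigma> m y - \<sigma> n y)) \<longlonglongrightarrow> norm (\<sigma> m y - g y)"
        by (intro tendsto_intros limg that)
      show "\<exists>N. \<forall>n\<ge>N. norm (\<sigma> m y - \<sigma> n y) \<le> \<epsilon> * ns_norm Y y"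
        using close[OF N[rule_format, OF \<open>m \<ge> N\<close>] \<open>y \<in> ns_carrier Y\<close>] by blast
    qed
    have gop: "ns_operator Y (*) g"
      unfolding functional_iff_bounded
    proof (intro conjI ballI allI)
      fix x y assume x: "x \<in> ns_carrier Y" and y: "y \<in> ns_carrier Y"
      have "(\<lambda>n. \<sigma> n (ns_add Y x y)) \<longlonglongrightarrow> g x + g y"
        using tendsto_add[OF limg[OF x] limg[OF y]] op x y by (simp add: ns_operator_def)
      then show "g (ns_add Y x y) = g x + g y"
        using limg[OF add_closed[OF x y]] LIMSEQ_unique by blast
    next
      fix c x assume x: "x \<in> ns_carrier Y"
      have "(\<lambda>n. \<sigma> n (ns_scale Y c x)) \<longlonglongrightarrow> c * g x"
        using tendsto_mult_left[OF limg[OF x], of c] op x by (simp add: ns_operator_def)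
      then show "g (ns_scale Y c x) = c * g x"
        using limg[OF scale_closed[OF x]] LIMSEQ_unique by blast
    next
      from cauchy[of 1] obtain N where
        N: "\<forall>m\<ge>N. \<forall>n\<ge>N. ns_dist (ns_dual Y) (\<sigma> m) (\<sigma> n) < 1" by auto
      obtain C where C: "\<And>y. y \<in> ns_carrier Y \<Longrightarrow> norm (\<sigma> N y) \<le> C * ns_norm Y y"
        by (rule functional_bound[OF op[of N]]) blast
      have "norm (g y) \<le> (C + 1) * ns_norm Y y" if "y \<in> ns_carrier Y" for y
        using C[OF that] closeg[OF N order_refl that] norm_triangle_ineq2[of "g y" "\<sigma> N y"]
        by (simp add: norm_minus_commute distrib_right)
      then show "\<exists>C. \<forall>y\<in>ns_carrier Y. norm (g y) \<le> C * ns_norm Y y" by blast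
    qed
    then have gD: "g \<in> ns_carrier (ns_dual Y)" by (simp add: dual_carrier g_def)
    show "\<exists>g\<in>ns_carrier (ns_dual Y). \<forall>\<epsilon>>0. \<exists>N. \<forall>n\<ge>N. ns_dist (ns_dual Y) (\<sigma> n) g \<le> \<epsilon>"
    proof (intro bexI[OF _ gD] allI impI)
      fix \<epsilon> :: real assume "\<epsilon> > 0"
      from cauchy[OF this] obtain N where
        N: "\<forall>m\<ge>N. \<forall>n\<ge>N. ns_dist (ns_dual Y) (\<sigma> m) (\<sigma> n) < \<epsilon>" ..
      have "ns_dist (ns_dual Y) (\<sigma> n) g \<le> \<epsilon>" if "n \<ge> N" for n
      proof (rule dual_dist_le[OF cl gD])
        fix y assume y: "y \<in> ns_carrier Y" "ns_norm Y y \<le> 1"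
        have "norm (\<sigma> n y - g y) \<le> \<epsilon> * ns_norm Y y" by (rule closeg[OF N that y(1)])
        also have "\<dots> \<le> \<epsilon>" using y \<open>\<epsilon> > 0\<close> by (simp add: mult_left_le)
        finally show "norm (\<sigma> n y - g y) \<le> \<epsilon>" .
      qed
      then show "\<exists>N. \<forall>n\<ge>N. ns_dist (ns_dual Y) (\<sigma> n) g \<le> \<epsilon>" by blast
    qed
  qed
qed

end

section \<open>Sequence spaces\<close>

lemma seq_space_simps [simp]:
  "ns_carrier (seq_space C N) = C" "ns_zero (seq_space C N) = (\<lambda>_. 0)"
  "ns_add (seq_space C N) x y = (\<lambda>n. x n + y n)" "ns_scale (seq_space C N) c x = (\<lambda>n. c * x n)"
  "ns_norm (seq_space C N) = N"
  by (simp_all add: seq_space_def)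

lemma normed_space_seq_space:
  assumes "(\<lambda>_. 0) \<in> C" "\<And>x y. x \<in> C \<Longrightarrow> y \<in> C \<Longrightarrow> (\<lambda>n. x n + y n) \<in> C"
    "\<And>c x. x \<in> C \<Longrightarrow> (\<lambda>n. c * x n) \<in> C"
    "\<And>x. x \<in> C \<Longrightarrow> 0 \<le> N x" "\<And>x n. x \<in> C \<Longrightarrow> N x = 0 \<Longrightarrow> x n = 0"
    "\<And>x y. x \<in> C \<Longrightarrow> y \<in> C \<Longrightarrow> N (\<lambda>n. x n + y n) \<le> N x + N y"
    "\<And>c x. x \<in> C \<Longrightarrow> N (\<lambda>n. c * x n) = norm c * N x"
  shows "normed_space (seq_space C N)"
proof
  have "N (\<lambda>_. 0) = 0" using assms(7)[OF assms(1), of 0] by simp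
  then show "ns_norm (seq_space C N) x = 0 \<longleftrightarrow> x = ns_zero (seq_space C N)"
    if "x \<in> ns_carrier (seq_space C N)" for x
    using assms(5)[of x] that by auto
  show "\<exists>y\<in>ns_carrier (seq_space C N). ns_add (seq_space C N) x y = ns_zero (seq_space C N)"
    if "x \<in> ns_carrier (seq_space C N)" for x
    using assms(3)[of x "-1"] that by (intro bexI[of _ "\<lambda>n. -1 * x n"]) auto
qed (use assms in \<open>auto simp: algebra_simps\<close>)

lemma normed_space_seq_space_subset:
  assumes "normed_space (seq_space C N)" "C' \<subseteq> C" "(\<lambda>_. 0) \<in> C'"
    "\<And>x y. x \<in> C' \<Longrightarrow> y \<in> C' \<Longrightarrow> (\<lambda>n. x n + y n) \<in> C'"
    "\<And>c x. x \<in> C' \<Longrightarrow> (\<lambda>n. c * x n) \<in> C'"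
  shows "normed_space (seq_space C' N)"
proof -
  interpret normed_space "seq_space C N" by fact
  note facts = norm_nonneg norm_eq_zero norm_triangle norm_scale
  show ?thesis
    by (rule normed_space_seq_space) (use assms(2-5) facts in \<open>auto simp: subset_iff\<close>)
qed

lemma span_unit_seq_eq: "span_unit_seq = {x :: nat \<Rightarrow> 'k::real_or_complex. finite {n. x n \<noteq> 0}}"
proof safe
  fix x :: "nat \<Rightarrow> 'k" assume "x \<in> span_unit_seq"
  then obtain F a where F: "finite F" "x = (\<lambda>m. \<Sum>n\<in>F. a n * unit_seq n m)"
    by (auto simp: span_unit_seq_def)
  have "{n. x n \<noteq> 0} \<subseteq> F"
  proof
    fix m assume m: "m \<in> {n. x n \<noteq> 0}"
    have "x m = 0" if "m \<notin> F"
      unfolding F(2) by (rule sum.neutral) (use that in \<open>auto simp: unit_seq_def\<close>)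
    with m show "m \<in> F" by auto
  qed
  then show "finite {n. x n \<noteq> 0}" using F(1) by (rule finite_subset)
next
  fix x :: "nat \<Rightarrow> 'k" assume F: "finite {n. x n \<noteq> 0}"
  have "x m = (\<Sum>n\<in>{n. x n \<noteq> 0}. x n * unit_seq n m)" for m
  proof -
    have "(\<Sum>n\<in>{n. x n \<noteq> 0}. x n * unit_seq n m) = (\<Sum>n\<in>{n. x n \<noteq> 0}. if n = m then x n else 0)"
      by (rule sum.cong) (auto simp: unit_seq_def)
    also have "\<dots> = x m" using F by (simp add: sum.delta)
    finally show ?thesis ..
  qed
  with F show "x \<in> span_unit_seq"
    unfolding span_unit_seq_def by blast
qed

lemma span_unit_seq_closed:
  "(\<lambda>_. 0) \<in> span_unit_seq"
  "x \<in> span_unit_seq \<Longrightarrow> y \<in> span_unit_seq \<Longrightarrow> (\<lambda>n. x n + y n) \<in> span_unit_seq"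
  "x \<in> span_unit_seq \<Longrightarrow> (\<lambda>n. c * x n) \<in> span_unit_seq"
  unfolding span_unit_seq_eq mem_Collect_eq
proof -
  assume "finite {n. x n \<noteq> 0}" "finite {n. y n \<noteq> 0}"
  then have "finite ({n. x n \<noteq> 0} \<union> {n. y n \<noteq> 0})" by simp
  then show "finite {n. x n + y n \<noteq> 0}" by (rule rev_finite_subset) auto
next
  assume "finite {n. x n \<noteq> 0}"
  then show "finite {n. c * x n \<noteq> 0}" by (rule rev_finite_subset) auto
qed simp

lemma unit_seq_in_span: "unit_seq n \<in> span_unit_seq"
  by (simp add: span_unit_seq_eq unit_seq_def)

subsection \<open>The spaces of p-summable sequences\<close>

lemma lp_norm_nonneg: "0 \<le> lp_norm r x"
  by (simp add: lp_norm_def)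

lemma lp_norm_powr:
  assumes "1 \<le> r" "x \<in> lp_set r"
  shows "lp_norm r x powr r = (\<Sum>n. norm (x n) powr r)"
proof -
  have "0 \<le> (\<Sum>n. norm (x n) powr r)"
    using assms(2) by (intro suminf_nonneg) (auto simp: lp_set_def)
  then show ?thesis using assms(1) by (simp add: lp_norm_def powr_powr)
qed

lemma lp_norm_sum_le:
  assumes "1 \<le> r" "x \<in> lp_set r" "finite F"
  shows "(\<Sum>n\<in>F. norm (x n) powr r) \<le> lp_norm r x powr r"
  unfolding lp_norm_powr[OF assms(1,2)]
  using assms(2,3) by (intro sum_le_suminf) (auto simp: lp_set_def)

text \<open>
  Bounds on finite partial sums give membership in \<open>\<ell>\<^sub>r\<close> and the norm estimate together. With the
  converse \<open>lp_norm_sum_le\<close>, most estimates below need finite sums only.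
\<close>

lemma lp_normI:
  assumes "1 \<le> r" "0 \<le> c" and le: "\<And>m. (\<Sum>n<m. norm (x n) powr r) \<le> c powr r"
  shows "x \<in> lp_set r" "lp_norm r x \<le> c"
proof -
  have sm: "summable (\<lambda>n. norm (x n) powr r)"
    by (rule summableI_nonneg_bounded[OF _ le]) simp
  then show x: "x \<in> lp_set r" by (simp add: lp_set_def)
  have "(\<Sum>n. norm (x n) powr r) \<le> c powr r"
    by (rule suminf_le_const[OF sm le])
  then have "lp_norm r x powr r \<le> c powr r" using lp_norm_powr[OF assms(1) x] by simp
  then show "lp_norm r x \<le> c"
    using assms(1,2) powr_less_mono2[of r c "lp_norm r x"] by (meson not_le less_le_trans zero_less_one)
qed

lemma lp_norm_component:
  assumes "1 \<le> r" "x \<in> lp_set r"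
  shows "norm (x n) \<le> lp_norm r x"
proof -
  have "norm (x n) powr r \<le> lp_norm r x powr r"
    using lp_norm_sum_le[OF assms, of "{n}"] by simp
  then show ?thesis
    using assms(1) lp_norm_nonneg powr_less_mono2[of r "lp_norm r x" "norm (x n)"]
    by (meson not_le less_le_trans zero_less_one)
qed

text \<open>
  Sequences may have zero entries, hence the endpoint 0. There the claim is \<open>t powr r \<le> t\<close> for
  \<open>t\<close> in the unit interval.
\<close>

lemma powr_convex_nonneg:
  fixes a b t r :: real
  assumes "1 \<le> r" "0 \<le> a" "0 \<le> b" "0 \<le> t" "t \<le> 1"
  shows "((1 - t) * a + t * b) powr r \<le> (1 - t) * a powr r + t * b powr r"
proof -
  have pow_le: "s powr r \<le> s" if "0 \<le> s" "s \<le> 1" for s :: real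
  proof (cases "s = 0")
    case False
    then have "s powr r \<le> s powr 1" using that assms(1) by (intro powr_mono') auto
    then show ?thesis using that by simp
  qed simp
  consider "a = 0" | "b = 0" | "a > 0" "b > 0" using assms by linarith
  then show ?thesis
  proof cases
    case 1
    then show ?thesis using assms mult_right_mono[OF pow_le[of t], of "b powr r"]
      by (simp add: powr_mult)
  next
    case 2
    then show ?thesis using assms mult_right_mono[OF pow_le[of "1 - t"], of "a powr r"]
      by (simp add: powr_mult)
  next
    case 3
    then show ?thesis
      using convex_onD[OF powr_convex[OF assms(1)], of t a b] assms by simp
  qed
qed

text \<open>
  For \<open>\<alpha> > \<parallel>x\<parallel>\<close> and \<open>\<beta> > \<parallel>y\<parallel>\<close>, the vector \<open>(x + y) / (\<alpha> + \<beta>)\<close> is a convex combination of \<open>x / \<alpha>\<close> and \<open>y / \<beta>\<close>,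
  so convexity of the power function bounds its partial sums by 1. Strict upper bounds of the norms
  avoid a case distinction for zero vectors.
\<close>

lemma lp_Minkowski:
  assumes r: "1 \<le> r" and x: "x \<in> lp_set r" and y: "y \<in> lp_set r"
  shows "(\<lambda>n. x n + y n) \<in> lp_set r" "lp_norm r (\<lambda>n. x n + y n) \<le> lp_norm r x + lp_norm r y"
proof -
  have bound: "(\<Sum>n<m. norm (x n + y n) powr r) \<le> (\<alpha> + \<beta>) powr r"
    if \<alpha>: "\<alpha> > lp_norm r x" and \<beta>: "\<beta> > lp_norm r y" for \<alpha> \<beta> m
  proof -
    have pos: "\<alpha> > 0" "\<beta> > 0" using \<alpha> \<beta> lp_norm_nonneg[of r] by (meson le_less_trans)+
    define t where "t = \<beta> / (\<alpha> + \<beta>)"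
    have t: "0 \<le> t" "t \<le> 1" "1 - t = \<alpha> / (\<alpha> + \<beta>)" using pos by (auto simp: t_def field_simps)
    have part: "(\<Sum>n<m. (norm (z n) / \<gamma>) powr r) \<le> 1"
      if "z \<in> lp_set r" "\<gamma> > lp_norm r z" for z :: "nat \<Rightarrow> 'a" and \<gamma>
    proof -
      have "\<gamma> > 0" using that(2) lp_norm_nonneg[of r z] by simp
      have "(\<Sum>n<m. (norm (z n) / \<gamma>) powr r) = (\<Sum>n<m. norm (z n) powr r) / \<gamma> powr r"
        using \<open>\<gamma> > 0\<close> by (simp add: powr_divide sum_divide_distrib)
      also have "(\<Sum>n<m. norm (z n) powr r) \<le> \<gamma> powr r"
        using lp_norm_sum_le[OF r that(1), of "{..<m}"] powr_mono2[of r "lp_norm r z" \<gamma>]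
          that(2) lp_norm_nonneg[of r z] r by simp
      finally show ?thesis using \<open>\<gamma> > 0\<close> by (simp add: divide_le_eq_1 divide_right_mono)
    qed
    have "norm (x n + y n) powr r
        \<le> (\<alpha> + \<beta>) powr r * ((1 - t) * (norm (x n) / \<alpha>) powr r + t * (norm (y n) / \<beta>) powr r)" for n
    proof -
      have "norm (x n + y n) \<le> norm (x n) + norm (y n)" by (rule norm_triangle_ineq)
      also have "\<dots> = (\<alpha> + \<beta>) * ((1 - t) * (norm (x n) / \<alpha>) + t * (norm (y n) / \<beta>))"
      proof -
        have "(\<alpha> + \<beta>) * (1 - t) = \<alpha>" "(\<alpha> + \<beta>) * t = \<beta>"
          unfolding t(3) using pos by (simp_all add: t_def)
        then show ?thesis
          using pos by (simp only: distrib_left mult.assoc[symmetric]) simp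
      qed
      finally have "norm (x n + y n) powr r \<le> \<dots> powr r" using r by (intro powr_mono2) auto
      also have "\<dots> = (\<alpha> + \<beta>) powr r * ((1 - t) * (norm (x n) / \<alpha>) + t * (norm (y n) / \<beta>)) powr r"
        using pos t by (intro powr_mult)
      also have "\<dots> \<le> (\<alpha> + \<beta>) powr r * ((1 - t) * (norm (x n) / \<alpha>) powr r + t * (norm (y n) / \<beta>) powr r)"
        using pos t r by (intro mult_left_mono powr_convex_nonneg) auto
      finally show ?thesis .
    qed
    then have "(\<Sum>n<m. norm (x n + y n) powr r)
        \<le> (\<Sum>n<m. (\<alpha> + \<beta>) powr r * ((1 - t) * (norm (x n) / \<alpha>) powr r + t * (norm (y n) / \<beta>) powr r))"
      by (intro sum_mono)
    also have "\<dots> = (\<alpha> + \<beta>) powr r * ((1 - t) * (\<Sum>n<m. (norm (x n) / \<alpha>) powr r)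
        + t * (\<Sum>n<m. (norm (y n) / \<beta>) powr r))"
      by (simp only: sum_distrib_left[symmetric] sum.distrib)
    also have "\<dots> \<le> (\<alpha> + \<beta>) powr r * ((1 - t) * 1 + t * 1)"
      using t by (intro mult_left_mono add_mono part x y \<alpha> \<beta>) auto
    finally show ?thesis by simp
  qed
  show "(\<lambda>n. x n + y n) \<in> lp_set r"
    by (rule lp_normI(1)[OF r _ bound[of "lp_norm r x + 1" "lp_norm r y + 1"]])
      (auto intro: add_nonneg_nonneg simp: lp_norm_nonneg)
  show "lp_norm r (\<lambda>n. x n + y n) \<le> lp_norm r x + lp_norm r y"
  proof (rule field_le_epsilon)
    fix e :: real assume e: "e > 0"
    have "lp_norm r (\<lambda>n. x n + y n) \<le> (lp_norm r x + e / 2) + (lp_norm r y + e / 2)"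
      by (rule lp_normI(2)[OF r _ bound]) (use e in \<open>auto intro: add_nonneg_nonneg simp: lp_norm_nonneg\<close>)
    then show "lp_norm r (\<lambda>n. x n + y n) \<le> lp_norm r x + lp_norm r y + e" by simp
  qed
qed

lemma lp_scale:
  assumes "1 \<le> r" "x \<in> lp_set r"
  shows "(\<lambda>n. c * x n) \<in> lp_set r" "lp_norm r (\<lambda>n. c * x n) = norm c * lp_norm r x"
proof -
  have sm: "summable (\<lambda>n. norm (x n) powr r)" using assms(2) by (simp add: lp_set_def)
  have eq: "norm (c * x n) powr r = norm c powr r * norm (x n) powr r" for n
    by (simp add: norm_mult powr_mult)
  show "(\<lambda>n. c * x n) \<in> lp_set r"
    unfolding lp_set_def mem_Collect_eq eq by (intro summable_mult sm)
  have "0 \<le> (\<Sum>n. norm (x n) powr r)" by (intro suminf_nonneg sm) simp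
  then show "lp_norm r (\<lambda>n. c * x n) = norm c * lp_norm r x"
    using assms(1) unfolding lp_norm_def eq suminf_mult[OF sm]
    by (simp add: powr_mult powr_powr)
qed

lemma lp_diff:
  assumes "1 \<le> r" "x \<in> lp_set r" "y \<in> lp_set r"
  shows "(\<lambda>n. x n - y n) \<in> lp_set r"
  using lp_Minkowski(1)[OF assms(1,2) lp_scale(1)[OF assms(1,3), of "-1"]] by simp

lemma lp_normed_space: "1 \<le> r \<Longrightarrow> normed_space (seq_space (lp_set r) (lp_norm r))"
proof (rule normed_space_seq_space)
  fix x :: "nat \<Rightarrow> 'a" and n assume "1 \<le> r" "x \<in> lp_set r" "lp_norm r x = 0"
  then show "x n = 0" using lp_norm_component[of r x n] by simp
qed (auto simp: lp_norm_nonneg lp_Minkowski lp_scale, simp add: lp_set_def)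

lemma span_unit_seq_subset_lp: "span_unit_seq \<subseteq> lp_set r"
  unfolding span_unit_seq_eq lp_set_def by (auto intro!: summable_finite)

lemma lp_subseq:
  fixes k :: "nat \<Rightarrow> nat"
  assumes "1 \<le> r" "x \<in> lp_set r" "strict_mono k"
  shows "(\<lambda>n. x (k n)) \<in> lp_set r"
proof (rule lp_normI(1)[OF assms(1) lp_norm_nonneg[of r x]])
  fix m
  have inj: "inj_on k {..<m}" using assms(3) by (auto simp: strict_mono_eq intro: inj_onI)
  have "(\<Sum>n<m. norm (x (k n)) powr r) = (\<Sum>n\<in>k ` {..<m}. norm (x n) powr r)"
    by (simp add: sum.reindex[OF inj])
  also have "\<dots> \<le> lp_norm r x powr r" by (rule lp_norm_sum_le[OF assms(1,2)]) simp
  finally show "(\<Sum>n<m. norm (x (k n)) powr r) \<le> lp_norm r x powr r" .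
qed

lemma lp_tendsto_zero:
  assumes "1 \<le> r" "x \<in> lp_set r"
  shows "x \<longlonglongrightarrow> 0"
proof -
  have "(\<lambda>n. norm (x n) powr r) \<longlonglongrightarrow> 0"
    using assms(2) by (intro summable_LIMSEQ_zero) (simp add: lp_set_def)
  then have "(\<lambda>n. (norm (x n) powr r) powr (1 / r)) \<longlonglongrightarrow> 0 powr (1 / r)"
    using assms(1) by (intro tendsto_powr2) auto
  then show ?thesis using assms(1) by (simp add: powr_powr tendsto_norm_zero_iff)
qed

lemma lp_complete:
  assumes r: "1 \<le> r"
  shows "Metric_space.mcomplete (ns_carrier (lp_space r)) (ns_dist (lp_space r :: ('k::real_or_complex, _) nspace))"
proof -
  interpret L: normed_space "lp_space r :: ('k, _) nspace"
    unfolding lp_space_def by (rule lp_normed_space[OF r])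
  have carrier: "ns_carrier (lp_space r) = (lp_set r :: (nat \<Rightarrow> 'k) set)" by (simp add: lp_space_def)
  have dst: "ns_dist (lp_space r) x y = lp_norm r (\<lambda>n. x n - y n)"
    if "x \<in> lp_set r" "y \<in> lp_set r" for x y :: "nat \<Rightarrow> 'k"
    using that by (simp add: ns_dist_def lp_space_def)
  show ?thesis
  proof (rule L.completeI)
    fix \<sigma> :: "nat \<Rightarrow> nat \<Rightarrow> 'k"
    assume "\<And>n. \<sigma> n \<in> ns_carrier (lp_space r)"
      and c: "\<And>\<epsilon>. \<epsilon> > 0 \<Longrightarrow> \<exists>N. \<forall>m\<ge>N. \<forall>n\<ge>N. ns_dist (lp_space r) (\<sigma> m) (\<sigma> n) < \<epsilon>"
    then have cl: "\<sigma> n \<in> lp_set r" for n by (simp add: carrier)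
    note dl = lp_diff[OF r cl cl]
    have cauchy: "\<exists>N. \<forall>m\<ge>N. \<forall>n\<ge>N. lp_norm r (\<lambda>i. \<sigma> m i - \<sigma> n i) < \<epsilon>" if "\<epsilon> > 0" for \<epsilon>
      using c[OF that] by (simp add: dst cl)
    have "convergent (\<lambda>n. \<sigma> n i)" for i
    proof (rule Cauchy_convergent, rule CauchyI)
      fix e :: real assume "e > 0"
      from cauchy[OF this] obtain N where N: "\<forall>m\<ge>N. \<forall>n\<ge>N. lp_norm r (\<lambda>i. \<sigma> m i - \<sigma> n i) < e" ..
      have "norm (\<sigma> m i - \<sigma> n i) < e" if "m \<ge> N" "n \<ge> N" for m n
        using lp_norm_component[OF r dl[of m n], of i] N[rule_format, OF that] by simp
      then show "\<exists>M. \<forall>m\<ge>M. \<forall>n\<ge>M. norm (\<sigma> m i - \<sigma> n i) < e" by blast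
    qed
    then have lim: "(\<lambda>n. \<sigma> n i) \<longlonglongrightarrow> lim (\<lambda>n. \<sigma> n i)" for i
      by (simp add: convergent_LIMSEQ_iff)
    define s where "s i = lim (\<lambda>n. \<sigma> n i)" for i
    have close: "(\<lambda>i. \<sigma> m i - s i) \<in> lp_set r" "lp_norm r (\<lambda>i. \<sigma> m i - s i) \<le> \<epsilon>"
      if "\<epsilon> > 0" and N: "\<forall>m\<ge>N. \<forall>n\<ge>N. lp_norm r (\<lambda>i. \<sigma> m i - \<sigma> n i) < \<epsilon>" and "m \<ge> N" for m N \<epsilon>
    proof -
      have le: "(\<Sum>i<k. norm (\<sigma> m i - s i) powr r) \<le> \<epsilon> powr r" for k
      proof (rule LIMSEQ_le_const2)
        show "(\<lambda>n. \<Sum>i<k. norm (\<sigma> m i - \<sigma> n i) powr r) \<longlonglongrightarrow> (\<Sum>i<k. norm (\<sigma> m i - s i) powr r)"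
          unfolding s_def using r by (intro tendsto_sum tendsto_powr2 tendsto_intros lim) auto
        have "(\<Sum>i<k. norm (\<sigma> m i - \<sigma> n i) powr r) \<le> \<epsilon> powr r" if "n \<ge> N" for n
          using lp_norm_sum_le[OF r dl[of m n], of "{..<k}"]
            powr_mono2[of r "lp_norm r (\<lambda>i. \<sigma> m i - \<sigma> n i)" \<epsilon>] r lp_norm_nonneg
            N[rule_format, OF \<open>m \<ge> N\<close> that] by force
        then show "\<exists>N. \<forall>n\<ge>N. (\<Sum>i<k. norm (\<sigma> m i - \<sigma> n i) powr r) \<le> \<epsilon> powr r" by blast
      qed
      show "(\<lambda>i. \<sigma> m i - s i) \<in> lp_set r" "lp_norm r (\<lambda>i. \<sigma> m i - s i) \<le> \<epsilon>"
        by (rule lp_normI[OF r less_imp_le[OF \<open>\<epsilon> > 0\<close>] le])+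
    qed
    obtain N where "\<forall>m\<ge>N. \<forall>n\<ge>N. lp_norm r (\<lambda>i. \<sigma> m i - \<sigma> n i) < 1" using cauchy[of 1] by auto
    then have "(\<lambda>i. \<sigma> N i - s i) \<in> lp_set r" by (intro close(1)[of 1 N N]) auto
    from lp_diff[OF r cl[of N] this] have s: "s \<in> lp_set r" by simp
    show "\<exists>x\<in>ns_carrier (lp_space r). \<forall>\<epsilon>>0. \<exists>N. \<forall>n\<ge>N. ns_dist (lp_space r) (\<sigma> n) x \<le> \<epsilon>"
    proof (intro bexI[of _ s] allI impI)
      fix \<epsilon> :: real assume e: "\<epsilon> > 0"
      from cauchy[OF this] obtain N where "\<forall>m\<ge>N. \<forall>n\<ge>N. lp_norm r (\<lambda>i. \<sigma> m i - \<sigma> n i) < \<epsilon>" ..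
      from close(2)[OF e this] show "\<exists>N. \<forall>n\<ge>N. ns_dist (lp_space r) (\<sigma> n) s \<le> \<epsilon>"
        by (auto simp: dst cl s)
    qed (simp add: carrier s)
  qed
qed

text \<open>
  A diagonal subsequence converges in every coordinate. The first \<open>M\<close> coordinates of a difference are
  then small, and the remaining ones are controlled by the uniform tails.
\<close>

lemma lp_relatively_compactI:
  fixes A :: "(nat \<Rightarrow> 'k::real_or_complex) set"
  assumes r: "1 \<le> r" and A: "A \<subseteq> lp_set r"
    and bnd: "\<And>i. \<exists>M. \<forall>s\<in>A. norm (s i) \<le> M"
    and tails: "\<And>\<epsilon>. \<epsilon> > 0 \<Longrightarrow> \<exists>m. \<forall>s\<in>A. \<forall>n. (\<Sum>i\<in>{m..<n}. norm (s i) powr r) \<le> \<epsilon>"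
  shows "ns_relatively_compact (lp_space r) A"
proof -
  interpret L: normed_space "lp_space r :: ('k, _) nspace"
    unfolding lp_space_def by (rule lp_normed_space[OF r])
  have carrier: "ns_carrier (lp_space r) = (lp_set r :: (nat \<Rightarrow> 'k) set)" by (simp add: lp_space_def)
  have dst: "ns_dist (lp_space r) x y = lp_norm r (\<lambda>n. x n - y n)"
    if "x \<in> lp_set r" "y \<in> lp_set r" for x y :: "nat \<Rightarrow> 'k"
    using that by (simp add: ns_dist_def lp_space_def)
  show ?thesis
  proof (rule L.relatively_compact_sequentially[OF lp_complete[OF r]])
    show "A \<subseteq> ns_carrier (lp_space r)" using A by (simp add: carrier)
    fix \<sigma> :: "nat \<Rightarrow> nat \<Rightarrow> 'k" assume "range \<sigma> \<subseteq> A"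
    then have \<sigma>: "\<sigma> n \<in> A" for n by auto
    then have cl: "\<sigma> n \<in> lp_set r" for n using A by auto
    have "\<exists>M. \<forall>n. norm (\<sigma> n i) \<le> M" for i using bnd[of i] \<sigma> by blast
    then obtain k :: "nat \<Rightarrow> nat" where k: "strict_mono k" "\<And>i. convergent (\<lambda>n. \<sigma> (k n) i)"
      using pointwise_convergent_subsequence[of UNIV \<sigma>] by auto
    have "\<exists>N. \<forall>m\<ge>N. \<forall>n\<ge>N. ns_dist (lp_space r) (\<sigma> (k m)) (\<sigma> (k n)) < \<epsilon>" if "\<epsilon> > 0" for \<epsilon>
    proof -
      \<comment> \<open>The head contributes \<open>\<delta>\<close>, and each of the two tails \<open>2 powr r * \<delta>\<close>.\<close>
      define \<delta> where "\<delta> = (\<epsilon> / 2) powr r / (1 + 2 * 2 powr r)"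
      have den: "1 + 2 * 2 powr r > 0" by (simp add: add_pos_pos)
      have \<delta>: "\<delta> > 0" "(1 + 2 * 2 powr r) * \<delta> = (\<epsilon> / 2) powr r"
        using that den by (simp_all add: \<delta>_def)
      obtain M where M: "\<And>s n. s \<in> A \<Longrightarrow> (\<Sum>i\<in>{M..<n}. norm (s i) powr r) \<le> \<delta>"
        using tails[OF \<delta>(1)] by blast
      define \<eta> where "\<eta> = (\<delta> / (real M + 1)) powr (1 / r)"
      have \<eta>: "\<eta> > 0" "\<eta> powr r = \<delta> / (real M + 1)"
        using \<delta>(1) r by (auto simp: \<eta>_def powr_powr)
      have "\<exists>N. \<forall>m\<ge>N. \<forall>n\<ge>N. norm (\<sigma> (k m) i - \<sigma> (k n) i) < \<eta>" for i
        using CauchyD[OF convergent_Cauchy[OF k(2)[of i]] \<eta>(1)] .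
      then obtain N where N: "\<And>i m n. m \<ge> N i \<Longrightarrow> n \<ge> N i \<Longrightarrow> norm (\<sigma> (k m) i - \<sigma> (k n) i) < \<eta>"
        by metis
      define N' where "N' = (\<Sum>i<M. N i)"
      have N': "N i \<le> N'" if "i < M" for i
        unfolding N'_def by (rule member_le_sum) (use that in auto)
      have "ns_dist (lp_space r) (\<sigma> (k m)) (\<sigma> (k n)) < \<epsilon>" if mn: "m \<ge> N'" "n \<ge> N'" for m n
      proof -
        let ?u = "\<sigma> (k m)" and ?v = "\<sigma> (k n)"
        have head: "(\<Sum>i<M. norm (?u i - ?v i) powr r) \<le> \<delta>"
        proof -
          have "(\<Sum>i<M. norm (?u i - ?v i) powr r) \<le> (\<Sum>i<M. \<delta> / (real M + 1))"
          proof (rule sum_mono)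
            fix i assume "i \<in> {..<M}"
            then have "norm (?u i - ?v i) < \<eta>" using N[of i m n] N'[of i] mn by simp
            then have "norm (?u i - ?v i) powr r \<le> \<eta> powr r" using r by (intro powr_mono2) auto
            then show "norm (?u i - ?v i) powr r \<le> \<delta> / (real M + 1)" by (simp add: \<eta>(2))
          qed
          also have "\<dots> \<le> \<delta>" using \<delta>(1) by (simp add: field_simps)
          finally show ?thesis .
        qed
        have elt: "norm (a - b) powr r \<le> 2 powr r * norm a powr r + 2 powr r * norm b powr r" for a b :: 'k
        proof -
          have "norm (a - b) \<le> 2 * max (norm a) (norm b)"
            using norm_triangle_ineq4[of a b] by linarith
          then have "norm (a - b) powr r \<le> (2 * max (norm a) (norm b)) powr r"
            using r by (intro powr_mono2) auto
          also have "\<dots> = 2 powr r * max (norm a) (norm b) powr r" by (simp add: powr_mult)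
          also have "\<dots> \<le> 2 powr r * (norm a powr r + norm b powr r)"
            by (intro mult_left_mono) (auto simp: max_def)
          finally show ?thesis by (simp add: distrib_left)
        qed
        have le: "(\<Sum>i<l. norm (?u i - ?v i) powr r) \<le> (\<epsilon> / 2) powr r" for l
        proof -
          have "(\<Sum>i<l. norm (?u i - ?v i) powr r)
              \<le> (\<Sum>i\<in>{..<M} \<union> {M..<l}. norm (?u i - ?v i) powr r)"
            by (rule sum_mono2) auto
          also have "\<dots> = (\<Sum>i<M. norm (?u i - ?v i) powr r) + (\<Sum>i\<in>{M..<l}. norm (?u i - ?v i) powr r)"
            by (rule sum.union_disjoint) auto
          also have "(\<Sum>i\<in>{M..<l}. norm (?u i - ?v i) powr r)
              \<le> 2 powr r * (\<Sum>i\<in>{M..<l}. norm (?u i) powr r) + 2 powr r * (\<Sum>i\<in>{M..<l}. norm (?v i) powr r)"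
            unfolding sum_distrib_left sum.distrib[symmetric] by (rule sum_mono) (rule elt)
          also have "\<dots> \<le> 2 powr r * \<delta> + 2 powr r * \<delta>"
            by (intro add_mono mult_left_mono M \<sigma>) auto
          finally show ?thesis using head \<delta>(2) by (simp add: algebra_simps)
        qed
        have "lp_norm r (\<lambda>i. ?u i - ?v i) \<le> \<epsilon> / 2"
          by (rule lp_normI(2)[OF r _ le]) (use \<open>\<epsilon> > 0\<close> in simp)
        then show ?thesis using \<open>\<epsilon> > 0\<close> by (simp add: dst cl)
      qed
      then show ?thesis by blast
    qed
    with k(1) show "\<exists>k :: nat \<Rightarrow> nat. strict_mono k \<and>
        (\<forall>\<epsilon>>0. \<exists>N. \<forall>m\<ge>N. \<forall>n\<ge>N. ns_dist (lp_space r) (\<sigma> (k m)) (\<sigma> (k n)) < \<epsilon>)" by blast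
  qed
qed

subsection \<open>The preduals\<close>

lemma sup_norm_upper:
  assumes "bounded (range x)"
  shows "norm (x n) \<le> sup_norm x"
  unfolding sup_norm_def
proof (rule cSUP_upper)
  show "bdd_above (range (\<lambda>n. norm (x n)))"
    using assms by (auto simp: bounded_iff intro: bdd_aboveI2)
qed simp

lemma sup_norm_le: "(\<And>n. norm (x n) \<le> c) \<Longrightarrow> sup_norm x \<le> c"
  unfolding sup_norm_def by (rule cSUP_least) auto

lemma null_sequence_bounded: "x \<longlonglongrightarrow> 0 \<Longrightarrow> bounded (range x)"
  for x :: "nat \<Rightarrow> 'k::real_normed_vector"
  by (rule convergent_imp_bounded)

lemma c0_normed_space: "normed_space (seq_space {x :: nat \<Rightarrow> 'k::real_or_complex. x \<longlonglongrightarrow> 0} sup_norm)"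
proof (rule normed_space_seq_space, goal_cases)
  case (2 x y)
  then show ?case using tendsto_add[of x 0 sequentially y 0] by simp
next
  case (3 c x)
  then show ?case using tendsto_mult_left[of x 0 sequentially c] by simp
next
  case (4 x)
  then have "norm (x 0) \<le> sup_norm x" by (intro sup_norm_upper null_sequence_bounded) simp
  then show ?case by (rule order_trans[OF norm_ge_zero])
next
  case (5 x n)
  then show ?case using sup_norm_upper[OF null_sequence_bounded, of x n] by simp
next
  case (6 x y)
  then show ?case
    by (intro sup_norm_le norm_triangle_mono sup_norm_upper null_sequence_bounded) auto
next
  case (7 c x)
  have le: "sup_norm (\<lambda>n. c * z n) \<le> norm c * sup_norm z" if "z \<longlonglongrightarrow> 0" for c and z :: "nat \<Rightarrow> 'k"
    by (rule sup_norm_le) (auto simp: norm_mult intro!: mult_left_mono sup_norm_upper null_sequence_bounded that)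
  show ?case
  proof (cases "c = 0")
    case True
    then show ?thesis by (simp add: sup_norm_def)
  next
    case False
    have "(\<lambda>n. c * x n) \<longlonglongrightarrow> 0" using 7 tendsto_mult_left[of x 0 sequentially c] by simp
    from le[OF this, of "inverse c"] have "sup_norm x \<le> norm (inverse c) * sup_norm (\<lambda>n. c * x n)"
      using False by (simp add: mult.assoc[symmetric])
    then have "norm c * sup_norm x \<le> norm c * (norm (inverse c) * sup_norm (\<lambda>n. c * x n))"
      by (intro mult_left_mono) auto
    also have "\<dots> = sup_norm (\<lambda>n. c * x n)" using False by (simp add: norm_inverse)
    finally have "norm c * sup_norm x \<le> sup_norm (\<lambda>n. c * x n)" .
    then show ?thesis using le[of x c] 7 by simp
  qed
qed simp

text \<open>
  The two cases \<open>p = 1\<close> and \<open>p > 1\<close> are distinguished only in the proofs of the norm axioms, of Hoelder's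
  inequality with its equality case on finite sets, and of the smallness of tails.
\<close>

definition predual_set :: "real \<Rightarrow> (nat \<Rightarrow> 'k::real_or_complex) set" where
  "predual_set p = (if p = 1 then {x. x \<longlonglongrightarrow> 0} else lp_set (conjugate_exponent p))"

definition predual_norm :: "real \<Rightarrow> (nat \<Rightarrow> 'k::real_or_complex) \<Rightarrow> real" where
  "predual_norm p = (if p = 1 then sup_norm else lp_norm (conjugate_exponent p))"

lemma predual_eq: "predual p = seq_space (predual_set p) (predual_norm p)"
  by (simp add: predual_def predual_set_def predual_norm_def c0_space_def lp_space_def)

lemma predual0_eq: "predual0 p = seq_space span_unit_seq (predual_norm p)"
  by (simp add: predual0_def predual_norm_def c0_space0_def lp_space0_def)

lemma conjugate_exponent_gt_1: "1 < p \<Longrightarrow> 1 < conjugate_exponent p"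
  by (simp add: conjugate_exponent_def field_simps)

lemma conjugate_exponent_inverse: "1 < p \<Longrightarrow> 1 / p + 1 / conjugate_exponent p = 1"
  by (simp add: conjugate_exponent_def field_simps)

lemma predual_normed_space:
  assumes "1 \<le> p"
  shows "normed_space (seq_space (predual_set p :: (nat \<Rightarrow> 'k::real_or_complex) set) (predual_norm p))"
proof (cases "p = 1")
  case True
  then show ?thesis using c0_normed_space by (simp add: predual_set_def predual_norm_def)
next
  case False
  then have "1 < conjugate_exponent p" using assms conjugate_exponent_gt_1 by simp
  with False show ?thesis
    using lp_normed_space[of "conjugate_exponent p"] by (simp add: predual_set_def predual_norm_def)
qed

lemma span_unit_seq_subset_predual: "span_unit_seq \<subseteq> predual_set p"
proof -
  have "x \<longlonglongrightarrow> 0" if "x \<in> span_unit_seq" for x :: "nat \<Rightarrow> 'a"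
  proof -
    have "finite {n. x n \<noteq> 0}" using that by (simp add: span_unit_seq_eq)
    then have "\<forall>\<^sub>F n in cofinite. x n = 0" by (simp add: eventually_cofinite)
    then have "\<forall>\<^sub>F n in sequentially. x n = 0" by (simp only: cofinite_eq_sequentially)
    then show ?thesis by (rule tendsto_eventually)
  qed
  then show ?thesis using span_unit_seq_subset_lp by (auto simp: predual_set_def)
qed

lemma predual0_normed_space:
  assumes "1 \<le> p"
  shows "normed_space (seq_space (span_unit_seq :: (nat \<Rightarrow> 'k::real_or_complex) set) (predual_norm p))"
  by (rule normed_space_seq_space_subset[OF predual_normed_space[OF assms] span_unit_seq_subset_predual])
    (simp_all add: span_unit_seq_closed)

text \<open>
  For \<open>p > 1\<close>, Young's inequality applied to the normalized sequences.
\<close>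

lemma Hoelder_predual:
  fixes a s :: "nat \<Rightarrow> 'k::real_or_complex"
  assumes p: "1 \<le> p" and a: "a \<in> predual_set p" and F: "finite F"
  shows "norm (\<Sum>i\<in>F. a i * s i) \<le> predual_norm p a * (\<Sum>i\<in>F. norm (s i) powr p) powr (1 / p)"
proof -
  have "norm (\<Sum>i\<in>F. a i * s i) \<le> (\<Sum>i\<in>F. norm (a i) * norm (s i))"
    by (rule order_trans[OF norm_sum]) (simp add: norm_mult)
  also have "\<dots> \<le> predual_norm p a * (\<Sum>i\<in>F. norm (s i) powr p) powr (1 / p)"
  proof (cases "p = 1")
    case True
    then have "norm (a i) \<le> sup_norm a" for i
      using a by (intro sup_norm_upper null_sequence_bounded) (simp add: predual_set_def)
    then have "(\<Sum>i\<in>F. norm (a i) * norm (s i)) \<le> (\<Sum>i\<in>F. sup_norm a * norm (s i))"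
      by (intro sum_mono mult_right_mono) auto
    then show ?thesis using True by (simp add: predual_norm_def sum_distrib_left sum_nonneg)
  next
    case False
    define q where "q = conjugate_exponent p"
    have p1: "1 < p" and q: "1 < q" "1 / p + 1 / q = 1"
      using False p conjugate_exponent_gt_1 conjugate_exponent_inverse by (auto simp: q_def)
    have aq: "a \<in> lp_set q" and na: "predual_norm p a = lp_norm q a"
      using a False by (auto simp: predual_set_def predual_norm_def q_def)
    define A where "A = lp_norm q a"
    define S where "S = (\<Sum>i\<in>F. norm (s i) powr p) powr (1 / p)"
    have Sp: "S powr p = (\<Sum>i\<in>F. norm (s i) powr p)"
      using p1 by (simp add: S_def powr_powr sum_nonneg)
    have A0: "A \<ge> 0" and S0: "S \<ge> 0" by (simp_all add: A_def S_def lp_norm_nonneg)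
    have aA: "norm (a i) \<le> A" for i unfolding A_def by (rule lp_norm_component) (use q aq in auto)
    have sS: "norm (s i) = 0" if "S = 0" "i \<in> F" for i
    proof -
      have "(\<Sum>i\<in>F. norm (s i) powr p) = 0" using Sp that(1) by simp
      then show ?thesis using that(2) by (simp add: sum_nonneg_eq_0_iff F)
    qed
    have "(\<Sum>i\<in>F. norm (a i) * norm (s i)) \<le> A * S"
    proof (cases "A = 0 \<or> S = 0")
      case True
      then have "norm (a i) * norm (s i) = 0" if "i \<in> F" for i
        using aA[of i] sS[OF _ that] by auto
      then have "(\<Sum>i\<in>F. norm (a i) * norm (s i)) = 0" by (intro sum.neutral) auto
      then show ?thesis using A0 S0 by simp
    next
      case False
      then have pos: "A > 0" "S > 0" using A0 S0 by auto
      have "(\<Sum>i\<in>F. (norm (a i) / A) * (norm (s i) / S))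
          \<le> (\<Sum>i\<in>F. (norm (s i) / S) powr p / p + (norm (a i) / A) powr q / q)"
      proof (rule sum_mono)
        fix i
        show "(norm (a i) / A) * (norm (s i) / S) \<le> (norm (s i) / S) powr p / p + (norm (a i) / A) powr q / q"
          using Youngs_inequality[of p q "norm (s i) / S" "norm (a i) / A"] p1 q pos
          by (simp add: mult.commute)
      qed
      also have "\<dots> = (\<Sum>i\<in>F. norm (s i) powr p) / S powr p / p + (\<Sum>i\<in>F. norm (a i) powr q) / A powr q / q"
        using pos by (simp add: sum.distrib powr_divide sum_divide_distrib)
      also have "\<dots> \<le> 1 / p + 1 / q"
      proof -
        have "(\<Sum>i\<in>F. norm (a i) powr q) / A powr q \<le> 1"
          using lp_norm_sum_le[of q a F] q aq pos F by (simp add: A_def)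
        then have "(\<Sum>i\<in>F. norm (a i) powr q) / A powr q / q \<le> 1 / q"
          using q by (intro divide_right_mono) auto
        moreover have "(\<Sum>i\<in>F. norm (s i) powr p) / S powr p = 1" unfolding Sp[symmetric] using pos by simp
        then have "(\<Sum>i\<in>F. norm (s i) powr p) / S powr p / p = 1 / p" by (simp only:)
        ultimately show ?thesis by linarith
      qed
      also have "(\<Sum>i\<in>F. (norm (a i) / A) * (norm (s i) / S)) = (\<Sum>i\<in>F. norm (a i) * norm (s i)) / (A * S)"
        by (simp add: sum_divide_distrib)
      finally show ?thesis using pos q(2) by (simp add: pos_divide_le_eq)
    qed
    then show ?thesis by (simp add: na A_def S_def)
  qed
  finally show ?thesis .
qed

text \<open>
  The extremal vector has phases that cancel those of \<open>s\<close> and, for \<open>p > 1\<close>, the moduli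
  \<open>|s\<^sub>i|\<^bsup>p-1\<^esup> / S\<^bsup>1/q\<^esup>\<close> with \<open>S = \<Sum> |s\<^sub>i|\<^sup>p\<close>; the exponent is chosen since \<open>(p - 1) q = p\<close>.
\<close>

lemma Hoelder_predual_attained:
  fixes s :: "nat \<Rightarrow> 'k::real_or_complex"
  assumes p: "1 \<le> p" and F: "finite F"
  obtains b where "b \<in> span_unit_seq" "\<And>i. i \<notin> F \<Longrightarrow> b i = 0" "predual_norm p b \<le> 1"
    "(\<Sum>i\<in>F. b i * s i) = of_real ((\<Sum>i\<in>F. norm (s i) powr p) powr (1 / p))"
proof -
  have "\<exists>u. norm u = 1 \<and> u * s i = of_real (norm (s i))" for i
    by (rule unit_rotation[of "s i"]) blast
  then obtain u where u: "\<And>i. norm (u i) = 1" "\<And>i. u i * s i = of_real (norm (s i))" by metis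
  have span: "(\<lambda>i. if i \<in> F then c i else 0) \<in> span_unit_seq" for c :: "nat \<Rightarrow> 'k"
    unfolding span_unit_seq_eq by (auto intro: finite_subset[OF _ F])
  show ?thesis
  proof (cases "p = 1")
    case True
    let ?b = "\<lambda>i. if i \<in> F then u i else 0"
    show ?thesis
    proof (rule that[of ?b])
      show "predual_norm p ?b \<le> 1"
        using True by (auto simp: predual_norm_def u intro: sup_norm_le)
      have "(\<Sum>i\<in>F. ?b i * s i) = (\<Sum>i\<in>F. of_real (norm (s i)))"
        by (rule sum.cong) (auto simp: u)
      then show "(\<Sum>i\<in>F. ?b i * s i) = of_real ((\<Sum>i\<in>F. norm (s i) powr p) powr (1 / p))"
        using True by (simp add: sum_nonneg)
    qed (use span[of u] in auto)
  next
    case False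
    define q where "q = conjugate_exponent p"
    have p1: "1 < p" and q: "1 < q" "1 / p + 1 / q = 1"
      using False p conjugate_exponent_gt_1 conjugate_exponent_inverse by (auto simp: q_def)
    have pq: "(p - 1) * q = p" using p1 by (simp add: q_def conjugate_exponent_def)
    define S where "S = (\<Sum>i\<in>F. norm (s i) powr p)"
    have S0: "S \<ge> 0" by (simp add: S_def sum_nonneg)
    let ?c = "\<lambda>i. u i * of_real (norm (s i) powr (p - 1) / S powr (1 / q))"
    let ?b = "\<lambda>i. if i \<in> F then ?c i else 0"
    show ?thesis
    proof (cases "S = 0")
      case True
      show ?thesis
      proof (rule that[of "\<lambda>_. 0"])
        show "predual_norm p (\<lambda>_. 0 :: 'k) \<le> 1" using False by (simp add: predual_norm_def lp_norm_def)
        show "(\<Sum>i\<in>F. 0 * s i) = of_real ((\<Sum>i\<in>F. norm (s i) powr p) powr (1 / p))"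
          using True by (simp add: S_def)
      qed (simp_all add: span_unit_seq_closed)
    next
      case False
      then have pos: "S > 0" using S0 by simp
      have nb: "norm (?c i) powr q = norm (s i) powr p / S" for i
      proof -
        have "norm (?c i) = norm (s i) powr (p - 1) / S powr (1 / q)"
          by (simp only: norm_mult u norm_of_real) simp
        then have "norm (?c i) powr q = (norm (s i) powr (p - 1)) powr q / (S powr (1 / q)) powr q"
          using pos by (simp add: powr_divide)
        then show ?thesis using pos q(1) pq by (simp only: powr_powr) simp
      qed
      have le: "(\<Sum>i<m. norm (?b i) powr q) \<le> 1 powr q" for m
      proof -
        have "(\<Sum>i<m. norm (?b i) powr q) = (\<Sum>i\<in>{..<m} \<inter> F. norm (?b i) powr q)"
          by (rule sum.mono_neutral_right) auto
        also have "\<dots> \<le> (\<Sum>i\<in>F. norm (?b i) powr q)"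
          by (rule sum_mono2[OF F]) auto
        also have "\<dots> = (\<Sum>i\<in>F. norm (s i) powr p / S)"
          by (rule sum.cong) (simp_all only: nb if_True)
        also have "\<dots> = 1" using pos by (simp add: S_def flip: sum_divide_distrib)
        finally show ?thesis by simp
      qed
      show ?thesis
      proof (rule that[of ?b])
        show "predual_norm p ?b \<le> 1"
          using lp_normI(2)[OF _ _ le] q \<open>p \<noteq> 1\<close> by (simp add: predual_norm_def q_def)
        have "(\<Sum>i\<in>F. ?b i * s i) = (\<Sum>i\<in>F. of_real (norm (s i) powr p / S powr (1 / q)))"
        proof (rule sum.cong)
          fix i assume i: "i \<in> F"
          have "?c i * s i = (u i * s i) * of_real (norm (s i) powr (p - 1) / S powr (1 / q))" by simp
          also have "\<dots> = of_real (norm (s i) * norm (s i) powr (p - 1) / S powr (1 / q))"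
            by (simp add: u)
          also have "norm (s i) * norm (s i) powr (p - 1) = norm (s i) powr p"
            using p1 by (cases "s i = 0") (simp_all add: powr_mult_base)
          finally show "?b i * s i = of_real (norm (s i) powr p / S powr (1 / q))" using i by simp
        qed simp
        also have "\<dots> = of_real (S / S powr (1 / q))"
          by (simp add: S_def flip: of_real_sum sum_divide_distrib)
        also have "S / S powr (1 / q) = S powr (1 - 1 / q)" using pos by (simp add: powr_diff)
        also have "1 - 1 / q = 1 / p" using q(2) by simp
        finally show "(\<Sum>i\<in>F. ?b i * s i) = of_real ((\<Sum>i\<in>F. norm (s i) powr p) powr (1 / p))"
          by (simp add: S_def)
      qed (use span[of ?c] in auto)
    qed
  qed
qed

lemma predual_tails:
  fixes a :: "nat \<Rightarrow> 'k::real_or_complex"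
  assumes p: "1 \<le> p" and a: "a \<in> predual_set p" and \<epsilon>: "\<epsilon> > 0"
  obtains N where "\<And>m n. m \<ge> N \<Longrightarrow> predual_norm p (\<lambda>i. if i \<in> {m..<n} then a i else 0) \<le> \<epsilon>"
proof (cases "p = 1")
  case True
  then have "a \<longlonglongrightarrow> 0" using a by (simp add: predual_set_def)
  then obtain N where N: "\<And>i. i \<ge> N \<Longrightarrow> norm (a i) < \<epsilon>" using LIMSEQ_D[of a 0 \<epsilon>] \<epsilon> by auto
  have "predual_norm p (\<lambda>i. if i \<in> {m..<n} then a i else 0) \<le> \<epsilon>" if "m \<ge> N" for m n
    using True N that \<epsilon> by (auto simp: predual_norm_def less_imp_le intro!: sup_norm_le)
  then show ?thesis by (rule that)
next
  case False
  define q where "q = conjugate_exponent p"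
  have q: "1 < q" using False p conjugate_exponent_gt_1 by (auto simp: q_def)
  have sm: "summable (\<lambda>i. norm (a i) powr q)"
    using a False by (simp add: predual_set_def q_def lp_set_def)
  obtain N where N: "\<And>m n. m \<ge> N \<Longrightarrow> norm (\<Sum>i\<in>{m..<n}. norm (a i) powr q) < \<epsilon> powr q"
    using sm[unfolded summable_Cauchy, rule_format, of "\<epsilon> powr q"] \<epsilon> by auto
  have "predual_norm p (\<lambda>i. if i \<in> {m..<n} then a i else 0) \<le> \<epsilon>" if "m \<ge> N" for m n
  proof -
    have "(\<Sum>i<k. norm (if i \<in> {m..<n} then a i else 0) powr q) \<le> \<epsilon> powr q" for k
    proof -
      have "(\<Sum>i<k. norm (if i \<in> {m..<n} then a i else 0) powr q)
          = (\<Sum>i\<in>{..<k} \<inter> {m..<n}. norm (a i) powr q)"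
        by (rule sum.mono_neutral_cong_right) (auto split: if_splits)
      also have "\<dots> \<le> (\<Sum>i\<in>{m..<n}. norm (a i) powr q)" by (rule sum_mono2) auto
      also have "\<dots> \<le> \<epsilon> powr q" using N[OF that, of n] by (simp add: sum_nonneg)
      finally show ?thesis .
    qed
    from lp_normI(2)[OF _ _ this] show ?thesis
      using q \<epsilon> False by (simp add: predual_norm_def q_def)
  qed
  then show ?thesis by (rule that)
qed

section \<open>Sets of functionals\<close>

lemma p_V_set_iff:
  "p_V_set smul p B \<longleftrightarrow> B \<noteq> {} \<and> B \<subseteq> top_dual smul \<and>
     (\<forall>x. weakly_p_summable smul p x \<longrightarrow>
        (\<forall>\<epsilon>>0. \<exists>N. \<forall>n\<ge>N. \<forall>f\<in>B. norm (f (x n)) \<le> \<epsilon>))"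
proof -
  have "(\<lambda>n. SUP f\<in>B. ennreal (norm (f (x n)))) \<longlonglongrightarrow> 0 \<longleftrightarrow>
      (\<forall>\<epsilon>>0. \<exists>N. \<forall>n\<ge>N. \<forall>f\<in>B. norm (f (x n)) \<le> \<epsilon>)" (is "?S \<longlonglongrightarrow> 0 \<longleftrightarrow> ?R") for x
  proof
    assume lim: "?S \<longlonglongrightarrow> 0"
    show ?R
    proof (intro allI impI)
      fix \<epsilon> :: real assume "\<epsilon> > 0"
      then have "\<forall>\<^sub>F n in sequentially. ?S n < ennreal \<epsilon>"
        by (intro order_tendstoD(2)[OF lim]) simp
      then obtain N where N: "\<And>n. n \<ge> N \<Longrightarrow> ?S n < ennreal \<epsilon>"
        by (auto simp: eventually_sequentially)
      have "norm (f (x n)) \<le> \<epsilon>" if "n \<ge> N" "f \<in> B" for n f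
      proof -
        have "ennreal (norm (f (x n))) \<le> ?S n" using that(2) by (rule SUP_upper)
        also have "\<dots> < ennreal \<epsilon>" by (rule N[OF that(1)])
        finally show ?thesis using \<open>\<epsilon> > 0\<close> by (simp add: ennreal_less_iff)
      qed
      then show "\<exists>N. \<forall>n\<ge>N. \<forall>f\<in>B. norm (f (x n)) \<le> \<epsilon>" by blast
    qed
  next
    assume R: ?R
    show "?S \<longlonglongrightarrow> 0"
    proof (rule order_tendstoI)
      fix a :: ennreal assume "0 < a"
      obtain \<epsilon> where \<epsilon>: "\<epsilon> > 0" "ennreal \<epsilon> < a"
      proof (cases a)
        case (real r)
        then show ?thesis using \<open>0 < a\<close> by (intro that[of "r / 2"]) (auto simp: ennreal_less_iff)
      next
        case top
        then show ?thesis by (intro that[of 1]) auto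
      qed
      obtain N where N: "\<And>n f. n \<ge> N \<Longrightarrow> f \<in> B \<Longrightarrow> norm (f (x n)) \<le> \<epsilon>"
        using R \<epsilon>(1) by blast
      have "?S n < a" if "n \<ge> N" for n
        by (rule le_less_trans[OF SUP_least \<epsilon>(2)]) (intro ennreal_leI N that)
      then show "\<forall>\<^sub>F n in sequentially. ?S n < a" by (rule eventually_sequentiallyI)
    qed simp
  qed
  then show ?thesis by (simp add: p_V_set_def)
qed

text \<open>
  The functionals with \<open>|f(x)| < 1\<close> form a weak* neighborhood of zero, which has to absorb \<open>B\<close>.
\<close>

lemma weak_star_bounded_pointwise:
  assumes lc: "locally_convex_space smul" and B: "weak_star_bounded smul B"
  shows "B \<subseteq> top_dual smul" "\<exists>M. \<forall>f\<in>B. norm (f x) \<le> M"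
proof -
  interpret locally_convex_space smul by fact
  show "B \<subseteq> top_dual smul" using B by (simp add: weak_star_bounded_def)
  define U where "U = {f \<in> top_dual smul. norm (f x) < 1}"
  have "openin (product_topology (\<lambda>_. euclidean) UNIV)
      {f \<in> topspace (product_topology (\<lambda>_::'b. euclidean :: 'a topology) UNIV). f x \<in> ball 0 1}"
    by (rule openin_continuous_map_preimage[OF continuous_map_product_projection]) auto
  then have "openin (product_topology (\<lambda>_. euclidean) UNIV) {f :: 'b \<Rightarrow> 'a. f x \<in> ball 0 1}"
    by simp
  then have "openin (weak_star_topology smul) (top_dual smul \<inter> {f. f x \<in> ball 0 1})"
    unfolding weak_star_topology_def by (rule openin_subtopology_Int2)
  also have "top_dual smul \<inter> {f. f x \<in> ball 0 1} = U" by (auto simp: U_def)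
  finally have "openin (weak_star_topology smul) U" .
  moreover have "(\<lambda>_. 0) \<in> U"
    using linear_functionalI[OF vector_space_axioms, of "\<lambda>_. 0"] by (simp add: U_def top_dual_def)
  ultimately obtain r where r: "r > 0" "B \<subseteq> (\<lambda>f x. of_real r * f x) ` U"
    using B by (auto simp: weak_star_bounded_def)
  have "norm (f x) \<le> r" if f: "f \<in> B" for f
  proof -
    obtain g where "g \<in> U" "f = (\<lambda>x. of_real r * g x)" using r(2) f by auto
    then show ?thesis using r(1) by (simp add: U_def norm_mult mult_left_le)
  qed
  then show "\<exists>M. \<forall>f\<in>B. norm (f x) \<le> M" by blast
qed

text \<open>
  A finite set of null sequences is uniformly null, and a finite net in the supremum distance passes
  this on. It serves both \<open>\<ell>\<^sub>p\<close> and the dual of a space that contains the unit vectors.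
\<close>

lemma uniformly_null_from_finite_nets:
  fixes A :: "(nat \<Rightarrow> 'k::real_normed_vector) set"
  assumes null: "\<And>a. a \<in> A \<Longrightarrow> a \<longlonglongrightarrow> 0"
    and net: "\<And>\<epsilon>. \<epsilon> > 0 \<Longrightarrow> \<exists>K. finite K \<and> K \<subseteq> A \<and> (\<forall>a\<in>A. \<exists>b\<in>K. \<forall>n. norm (a n - b n) \<le> \<epsilon>)"
    and \<epsilon>: "\<epsilon> > 0"
  shows "\<exists>N. \<forall>n\<ge>N. \<forall>a\<in>A. norm (a n) \<le> \<epsilon>"
proof -
  have "\<epsilon> / 2 > 0" using \<epsilon> by simp
  from net[OF this] obtain K where K: "finite K" "K \<subseteq> A"
    "\<And>a. a \<in> A \<Longrightarrow> \<exists>b\<in>K. \<forall>n. norm (a n - b n) \<le> \<epsilon> / 2" by blast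
  have "\<exists>N. \<forall>n\<ge>N. norm (b n) < \<epsilon> / 2" if "b \<in> K" for b
    using LIMSEQ_D[OF null, of b "\<epsilon> / 2"] that K(2) \<epsilon> by auto
  then obtain N where N: "\<And>b n. b \<in> K \<Longrightarrow> n \<ge> N b \<Longrightarrow> norm (b n) < \<epsilon> / 2" by metis
  have "norm (a n) \<le> \<epsilon>" if n: "n \<ge> (\<Sum>b\<in>K. N b)" and a: "a \<in> A" for a n
  proof -
    obtain b where b: "b \<in> K" "norm (a n - b n) \<le> \<epsilon> / 2" using K(3)[OF a] by blast
    have "N b \<le> n" using member_le_sum[OF b(1), of N] K(1) n by simp
    then have "norm (b n) < \<epsilon> / 2" by (rule N[OF b(1)])
    then show ?thesis using b(2) norm_triangle_sub[of "a n" "b n"] by linarith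
  qed
  then show ?thesis by blast
qed

section \<open>Operators defined by weakly summable sequences\<close>

text \<open>
  The operator sending \<open>e\<^sub>n\<close> to \<open>x\<^sub>n\<close>. Taking the limit of the partial sums covers finitely supported \<open>a\<close>,
  where they are eventually constant, and general \<open>a\<close> alike.
\<close>

definition series_operator ::
  "('k::real_or_complex \<Rightarrow> 'e::{topological_ab_group_add, t2_space} \<Rightarrow> 'e) \<Rightarrow> (nat \<Rightarrow> 'e) \<Rightarrow> (nat \<Rightarrow> 'k) \<Rightarrow> 'e" where
  "series_operator smul x a = lim (\<lambda>n. \<Sum>i<n. smul (a i) (x i))"

lemma series_finite:
  assumes vs: "vector_space smul" and a: "a \<in> span_unit_seq"
  obtains m where "\<And>i. i \<ge> m \<Longrightarrow> a i = 0" "(\<lambda>n. \<Sum>i<n. smul (a i) (x i)) \<longlonglongrightarrow> (\<Sum>i<m. smul (a i) (x i))"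
    "series_operator smul x a = (\<Sum>i<m. smul (a i) (x i))"
proof -
  interpret vector_space smul by fact
  have "finite {n. a n \<noteq> 0}" using a by (simp add: span_unit_seq_eq)
  then obtain m where "\<forall>n\<in>{n. a n \<noteq> 0}. n < m" using finite_nat_set_iff_bounded by blast
  then have m: "a i = 0" if "i \<ge> m" for i using that by (metis leD mem_Collect_eq)
  have "(\<Sum>i<n. smul (a i) (x i)) = (\<Sum>i<m. smul (a i) (x i))" if "n \<ge> m" for n
    by (rule sum.mono_neutral_right) (use that m in auto)
  then have lim: "(\<lambda>n. \<Sum>i<n. smul (a i) (x i)) \<longlonglongrightarrow> (\<Sum>i<m. smul (a i) (x i))"
    by (intro tendsto_eventually eventually_sequentiallyI)
  then have "series_operator smul x a = (\<Sum>i<m. smul (a i) (x i))"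
    unfolding series_operator_def by (rule limI)
  with m lim that show ?thesis by blast
qed

lemma series_operator_unit_seq:
  assumes vs: "vector_space smul"
  shows "series_operator smul x (unit_seq n) = x n"
proof -
  interpret vector_space smul by fact
  obtain m where m: "\<And>i. i \<ge> m \<Longrightarrow> unit_seq n i = (0 :: 'a)"
    "series_operator smul x (unit_seq n) = (\<Sum>i<m. smul (unit_seq n i) (x i))"
    using series_finite[OF vs unit_seq_in_span] by metis
  have "n < m" using m(1)[of n] by (force simp: unit_seq_def not_less)
  have "(\<Sum>i<m. smul (unit_seq n i) (x i)) = (\<Sum>i\<in>{n}. smul (unit_seq n i) (x i))"
    by (rule sum.mono_neutral_right) (use \<open>n < m\<close> in \<open>auto simp: unit_seq_def\<close>)
  then show ?thesis using m(2) by (simp add: unit_seq_def)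
qed

text \<open>
  The sums with \<open>N a \<le> 1\<close> form a weakly bounded set by hypothesis, hence a bounded one.
\<close>

lemma partial_sums_bounded:
  fixes smul :: "'k::real_or_complex \<Rightarrow> 'e::{topological_ab_group_add, t2_space} \<Rightarrow> 'e"
  assumes vs: "vector_space smul" and ns: "normed_space (seq_space C N)"
    and bound: "\<And>s. s \<in> lp_set p \<Longrightarrow> \<exists>M. \<forall>a\<in>C. \<forall>n. norm (\<Sum>i<n. a i * s i) \<le> M * N a"
    and x: "weakly_p_summable smul p x" and q: "continuous_seminorm smul q"
  shows "\<exists>K. \<forall>a\<in>C. \<forall>n. q (\<Sum>i<n. smul (a i) (x i)) \<le> K * N a"
proof -
  interpret vector_space smul by fact
  interpret S: normed_space "seq_space C N" by fact
  define A where "A = {\<Sum>i<n. smul (a i) (x i) | a n. a \<in> C \<and> N a \<le> 1}"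
  have sq: "seminorm smul q" using q by (simp add: continuous_seminorm_def)
  have "\<exists>K. \<forall>z\<in>A. q z \<le> K"
  proof (rule weakly_bounded_imp_seminorm_bounded[OF vs q])
    fix f assume "f \<in> top_dual smul"
    then have lin: "Vector_Spaces.linear smul (*) f" and s: "(\<lambda>i. f (x i)) \<in> lp_set p"
      using x by (auto simp: top_dual_def weakly_p_summable_def)
    obtain M where M: "\<And>a n. a \<in> C \<Longrightarrow> norm (\<Sum>i<n. a i * f (x i)) \<le> M * N a"
      using bound[OF s] by blast
    have "norm (f z) \<le> \<bar>M\<bar>" if zA: "z \<in> A" for z
    proof -
      obtain a n where z: "z = (\<Sum>i<n. smul (a i) (x i))" "a \<in> C" "N a \<le> 1"
        using zA by (auto simp: A_def)
      have "norm (f z) \<le> M * N a"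
        using M[OF z(2), of n] by (simp add: z(1) linear_functionalD[OF lin])
      also have "\<dots> \<le> \<bar>M\<bar> * N a" using S.norm_nonneg[of a] z(2) by (intro mult_right_mono) auto
      also have "\<dots> \<le> \<bar>M\<bar>" using z(3) by (simp add: mult_left_le)
      finally show ?thesis .
    qed
    then show "\<exists>M. \<forall>z\<in>A. norm (f z) \<le> M" by blast
  qed
  then obtain K where K: "\<And>z. z \<in> A \<Longrightarrow> q z \<le> K" by blast
  have "q (\<Sum>i<n. smul (a i) (x i)) \<le> K * N a" if a: "a \<in> C" for a n
  proof (cases "N a = 0")
    case True
    then have "a = (\<lambda>_. 0)" using S.norm_eq_zero[of a] a by simp
    then show ?thesis using True seminormD(3)[OF vs sq] by simp
  next
    case False
    then have pos: "N a > 0" using S.norm_nonneg[of a] a by simp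
    let ?c = "of_real (1 / N a) :: 'k"
    have nc: "norm ?c = 1 / N a" using pos by (simp only: norm_of_real) simp
    have "(\<lambda>i. ?c * a i) \<in> C" using S.scale_closed[of a ?c] a by simp
    moreover have "N (\<lambda>i. ?c * a i) = 1" using S.norm_scale[of a ?c] a pos nc by simp
    ultimately have "(\<Sum>i<n. smul (?c * a i) (x i)) \<in> A" unfolding A_def by force
    then have "q (smul ?c (\<Sum>i<n. smul (a i) (x i))) \<le> K"
      using K by (simp only: scale_sum_right scale_scale)
    then have "1 / N a * q (\<Sum>i<n. smul (a i) (x i)) \<le> K"
      by (simp only: seminormD(2)[OF vs sq] nc)
    then show ?thesis using pos by (simp add: field_simps)
  qed
  then show ?thesis by blast
qed

lemma series_operator_is_operator:
  fixes smul :: "'k::real_or_complex \<Rightarrow> 'e::{topological_ab_group_add, t2_space} \<Rightarrow> 'e"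
  assumes lc: "locally_convex_space smul" and ns: "normed_space (seq_space C N)"
    and bound: "\<And>s. s \<in> lp_set p \<Longrightarrow> \<exists>M. \<forall>a\<in>C. \<forall>n. norm (\<Sum>i<n. a i * s i) \<le> M * N a"
    and x: "weakly_p_summable smul p x"
    and conv: "\<And>a. a \<in> C \<Longrightarrow> convergent (\<lambda>n. \<Sum>i<n. smul (a i) (x i))"
  shows "ns_operator (seq_space C N) smul (series_operator smul x)"
    "\<And>q. continuous_seminorm smul q \<Longrightarrow> \<exists>K. \<forall>a\<in>C. q (series_operator smul x a) \<le> K * N a"
proof -
  interpret locally_convex_space smul by fact
  have vs: "vector_space smul" by (rule vector_space_axioms)
  interpret S: normed_space "seq_space C N" by fact
  have lim: "(\<lambda>n. \<Sum>i<n. smul (a i) (x i)) \<longlonglongrightarrow> series_operator smul x a" if "a \<in> C" for a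
    using conv[OF that] by (simp add: convergent_LIMSEQ_iff series_operator_def)
  show bnd: "\<exists>K. \<forall>a\<in>C. q (series_operator smul x a) \<le> K * N a" if q: "continuous_seminorm smul q" for q
  proof -
    obtain K where K: "\<And>a n. a \<in> C \<Longrightarrow> q (\<Sum>i<n. smul (a i) (x i)) \<le> K * N a"
      using partial_sums_bounded[OF vs ns bound x q] by blast
    have "q (series_operator smul x a) \<le> K * N a" if a: "a \<in> C" for a
    proof (rule LIMSEQ_le_const2)
      have "isCont q (series_operator smul x a)"
        using q by (simp add: continuous_seminorm_def continuous_on_eq_continuous_at)
      then show "(\<lambda>n. q (\<Sum>i<n. smul (a i) (x i))) \<longlonglongrightarrow> q (series_operator smul x a)"
        by (rule isCont_tendsto_compose[OF _ lim[OF a]])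
    qed (use K[OF a] in blast)
    then show ?thesis by blast
  qed
  show "ns_operator (seq_space C N) smul (series_operator smul x)"
  proof (rule S.operator_into_locally_convexI[OF lc])
    fix a b assume "a \<in> ns_carrier (seq_space C N)" "b \<in> ns_carrier (seq_space C N)"
    then have ab: "a \<in> C" "b \<in> C" "(\<lambda>n. a n + b n) \<in> C" using S.add_closed[of a b] by auto
    have "(\<lambda>n. \<Sum>i<n. smul (a i + b i) (x i)) \<longlonglongrightarrow> series_operator smul x a + series_operator smul x b"
      using tendsto_add[OF lim[OF ab(1)] lim[OF ab(2)]]
      by (simp only: scale_left_distrib sum.distrib)
    from LIMSEQ_unique[OF lim[OF ab(3)] this]
    show "series_operator smul x (ns_add (seq_space C N) a b) = series_operator smul x a + series_operator smul x b"
      by simp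
  next
    fix c a assume "a \<in> ns_carrier (seq_space C N)"
    then have a: "a \<in> C" "(\<lambda>n. c * a n) \<in> C" using S.scale_closed[of a c] by auto
    have "continuous_on UNIV (smul c)"
      using continuous_on_compose2[OF continuous_scale, of UNIV "\<lambda>x. (c, x)"]
      by (simp add: continuous_on_Pair)
    then have "isCont (smul c) (series_operator smul x a)"
      by (simp add: continuous_on_eq_continuous_at)
    from isCont_tendsto_compose[OF this lim[OF a(1)]]
    have "(\<lambda>n. \<Sum>i<n. smul (c * a i) (x i)) \<longlonglongrightarrow> smul c (series_operator smul x a)"
      by (simp only: scale_sum_right scale_scale)
    from LIMSEQ_unique[OF lim[OF a(2)] this]
    show "series_operator smul x (ns_scale (seq_space C N) c a) = smul c (series_operator smul x a)"
      by simp
  next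
    fix q assume "continuous_seminorm smul q"
    from bnd[OF this] show "\<exists>K. \<forall>y\<in>ns_carrier (seq_space C N).
        q (series_operator smul x y) \<le> K * ns_norm (seq_space C N) y" by simp
  qed
qed

lemma predual_pairing_bound:
  assumes "1 \<le> p" "s \<in> lp_set p"
  shows "\<exists>M. \<forall>a\<in>predual_set p. \<forall>n. norm (\<Sum>i<n. a i * s i) \<le> M * predual_norm p a"
proof -
  have "norm (\<Sum>i<n. a i * s i) \<le> lp_norm p s * predual_norm p a" if a: "a \<in> predual_set p" for a n
  proof -
    have "(\<Sum>i<n. norm (s i) powr p) powr (1 / p) \<le> (lp_norm p s powr p) powr (1 / p)"
      using lp_norm_sum_le[OF assms, of "{..<n}"] assms(1) by (intro powr_mono2) (auto simp: sum_nonneg)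
    also have "\<dots> = lp_norm p s" using assms(1) lp_norm_nonneg[of p s] by (simp add: powr_powr)
    finally have "predual_norm p a * (\<Sum>i<n. norm (s i) powr p) powr (1 / p) \<le> predual_norm p a * lp_norm p s"
      using normed_space.norm_nonneg[OF predual_normed_space[OF assms(1)], of a] a
      by (intro mult_left_mono) auto
    with Hoelder_predual[OF assms(1) a, of "{..<n}" s] show ?thesis by (simp add: mult.commute)
  qed
  then show ?thesis by blast
qed

lemma series_operator_predual0:
  assumes p: "1 \<le> p" and lc: "locally_convex_space smul" and x: "weakly_p_summable smul p x"
  shows "ns_operator (predual0 p) smul (series_operator smul x)"
  unfolding predual0_eq
proof (rule series_operator_is_operator(1)[OF lc predual0_normed_space[OF p] _ x])
  have vs: "vector_space smul" using lc by (simp add: locally_convex_space_def)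
  show "\<exists>M. \<forall>a\<in>span_unit_seq. \<forall>n. norm (\<Sum>i<n. a i * s i) \<le> M * predual_norm p a"
    if "s \<in> lp_set p" for s :: "nat \<Rightarrow> 'a"
    using predual_pairing_bound[OF p that] span_unit_seq_subset_predual by blast
  show "convergent (\<lambda>n. \<Sum>i<n. smul (a i) (x i))" if "a \<in> span_unit_seq" for a
    by (rule series_finite[OF vs that]) (auto simp: convergent_def)
qed

text \<open>
  The partial sums are Cauchy because a piece of the series of \<open>a\<close> is the image of the corresponding
  truncation of \<open>a\<close>, whose norm is small.
\<close>

lemma series_operator_predual:
  fixes smul :: "'k::real_or_complex \<Rightarrow> 'e::{topological_ab_group_add, t2_space} \<Rightarrow> 'e"
  assumes p: "1 \<le> p" and lc: "locally_convex_space smul" and x: "weakly_p_summable smul p x"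
    and sc: "tvs_sequentially_complete TYPE('e)"
  shows "ns_operator (predual p) smul (series_operator smul x)"
  unfolding predual_eq
proof (rule series_operator_is_operator(1)[OF lc predual_normed_space[OF p] predual_pairing_bound[OF p] x])
  interpret locally_convex_space smul by fact
  have vs: "vector_space smul" by (rule vector_space_axioms)
  fix a :: "nat \<Rightarrow> 'k" assume a: "a \<in> predual_set p"
  let ?S = "\<lambda>n. \<Sum>i<n. smul (a i) (x i)"
  have "\<exists>N. \<forall>m\<ge>N. \<forall>n\<ge>N. ?S m - ?S n \<in> U" if U: "open U" "0 \<in> U" for U
  proof -
    obtain q where q: "continuous_seminorm smul q" "{x. q x < 1} \<subseteq> U"
      by (rule continuous_seminorm_basis[OF lc U])
    have sq: "seminorm smul q" using q(1) by (simp add: continuous_seminorm_def)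
    obtain K where K: "\<And>a n. a \<in> predual_set p \<Longrightarrow> q (\<Sum>i<n. smul (a i) (x i)) \<le> K * predual_norm p a"
      using partial_sums_bounded[OF vs predual_normed_space[OF p] predual_pairing_bound[OF p] x q(1)] by blast
    define \<epsilon> where "\<epsilon> = 1 / (2 * (\<bar>K\<bar> + 1))"
    have \<epsilon>: "\<epsilon> > 0" "\<bar>K\<bar> * \<epsilon> < 1" by (auto simp: \<epsilon>_def field_simps)
    obtain N where N: "\<And>m n. m \<ge> N \<Longrightarrow> predual_norm p (\<lambda>i. if i \<in> {m..<n} then a i else 0) \<le> \<epsilon>"
      using predual_tails[OF p a \<epsilon>(1)] by blast
    have small: "q (?S n - ?S m) < 1" if "N \<le> m" "m \<le> n" for m n
    proof -
      let ?a = "\<lambda>i. if i \<in> {m..<n} then a i else 0"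
      have "?a \<in> span_unit_seq" unfolding span_unit_seq_eq
        by (auto intro: finite_subset[of _ "{m..<n}"])
      then have a': "?a \<in> predual_set p" using span_unit_seq_subset_predual by blast
      have "?S n - ?S m = (\<Sum>i\<in>{m..<n}. smul (a i) (x i))"
        using sum.atLeastLessThan_concat[of 0 m n "\<lambda>i. smul (a i) (x i)"] that(2)
        by (simp add: atLeast0LessThan algebra_simps)
      also have "\<dots> = (\<Sum>i<n. smul (?a i) (x i))"
        by (rule sum.mono_neutral_cong_left) auto
      finally have "q (?S n - ?S m) \<le> K * predual_norm p ?a" using K[OF a', of n] by simp
      also have "\<dots> \<le> \<bar>K\<bar> * \<epsilon>"
        using N[OF that(1), of n] normed_space.norm_nonneg[OF predual_normed_space[OF p], of ?a] a'
        by (intro mult_mono) auto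
      finally show ?thesis using \<epsilon>(2) by simp
    qed
    have "?S m - ?S n \<in> U" if "m \<ge> N" "n \<ge> N" for m n
    proof -
      have "q (?S m - ?S n) < 1"
      proof (cases "n \<le> m")
        case False
        then show ?thesis
          using small[of m n] that seminormD(4)[OF vs sq, of "?S n - ?S m"] by simp
      qed (use small that in simp)
      then show ?thesis using q(2) by blast
    qed
    then show ?thesis by blast
  qed
  then have "\<forall>U. open U \<and> 0 \<in> U \<longrightarrow> (\<exists>N. \<forall>m\<ge>N. \<forall>n\<ge>N. ?S m - ?S n \<in> U)" by simp
  then show "convergent ?S"
    by (rule sc[unfolded tvs_sequentially_complete_def, THEN spec, THEN mp])
qed

section \<open>Operators on the preduals\<close>

lemma operator_restrict:
  assumes ns: "normed_space (seq_space C N)" and ns': "normed_space (seq_space C' N)" and sub: "C' \<subseteq> C"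
    and T: "ns_operator (seq_space C N) smul T"
  shows "ns_operator (seq_space C' N) smul T"
proof -
  interpret S: normed_space "seq_space C N" by fact
  interpret S': normed_space "seq_space C' N" by fact
  have "continuous_map (ns_topology (seq_space C' N)) euclidean T"
  proof (rule S'.continuous_mapI)
    show "\<exists>\<delta>>0. \<forall>y\<in>ns_carrier (seq_space C' N). ns_norm (seq_space C' N) y < \<delta> \<longrightarrow> T y \<in> U"
      if "open U" "0 \<in> U" for U
      using S.operator_small[OF T that] sub by auto
  qed (use T sub in \<open>simp add: ns_operator_def subset_iff\<close>)
  then show ?thesis using T sub by (simp add: ns_operator_def subset_iff)
qed

lemma functional_comp:
  assumes "ns_operator Y smul T" "f \<in> top_dual smul"
  shows "ns_operator Y (*) (f \<circ> T)"
proof -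
  have "continuous_map (ns_topology Y) euclidean (f \<circ> T)"
    by (rule continuous_map_compose[of _ euclidean]) (use assms in \<open>auto simp: ns_operator_def top_dual_def\<close>)
  with assms show ?thesis
    by (auto simp: ns_operator_def top_dual_def linear_functionalD)
qed

text \<open>
  A functional is determined on finitely supported sequences by its values at the unit vectors; the
  sum may run over any finite set that contains the support.
\<close>

lemma functional_finite_support:
  assumes ns: "normed_space (seq_space span_unit_seq N)"
    and g: "ns_operator (seq_space span_unit_seq N) (*) g"
    and F: "finite F" "\<And>i. i \<notin> F \<Longrightarrow> b i = 0"
  shows "g b = (\<Sum>i\<in>F. b i * g (unit_seq i))"
proof -
  have add: "g (\<lambda>n. u n + v n) = g u + g v" if "u \<in> span_unit_seq" "v \<in> span_unit_seq" for u v
    using g that by (simp add: ns_operator_def)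
  have scale: "g (\<lambda>n. c * u n) = c * g u" if "u \<in> span_unit_seq" for c u
    using g that by (simp add: ns_operator_def)
  show ?thesis
    using F
  proof (induction F arbitrary: b rule: finite_induct)
    case empty
    then have "b = (\<lambda>_. 0)" by auto
    then show ?case using normed_space.functional_zero[OF ns g] by simp
  next
    case (insert j F)
    let ?b = "\<lambda>i. if i \<in> F then b i else 0"
    have "?b \<in> span_unit_seq" unfolding span_unit_seq_eq
      using insert(1) by (auto intro: finite_subset[of _ F])
    moreover have "(\<lambda>i. b j * unit_seq j i) \<in> span_unit_seq"
      by (rule span_unit_seq_closed(3)[OF unit_seq_in_span])
    ultimately have "g (\<lambda>i. ?b i + b j * unit_seq j i) = g ?b + g (\<lambda>i. b j * unit_seq j i)"
      by (rule add)
    moreover have "b = (\<lambda>i. ?b i + b j * unit_seq j i)"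
      using insert(2,4) by (auto simp: unit_seq_def fun_eq_iff)
    ultimately have "g b = g ?b + g (\<lambda>i. b j * unit_seq j i)" by (simp only:)
    also have "g (\<lambda>i. b j * unit_seq j i) = b j * g (unit_seq j)"
      by (rule scale) (rule unit_seq_in_span)
    finally have "g b = g ?b + b j * g (unit_seq j)" .
    moreover have "g ?b = (\<Sum>i\<in>F. ?b i * g (unit_seq i))" by (rule insert.IH) simp
    moreover have "\<dots> = (\<Sum>i\<in>F. b i * g (unit_seq i))" by (rule sum.cong) auto
    ultimately show ?case using insert(1,2) by simp
  qed
qed

text \<open>
  Testing \<open>f \<circ> T\<close> on the extremal vectors of Hoelder's inequality bounds the partial sums of
  \<open>|f(T e\<^sub>i)|\<^sup>p\<close> by the norm of \<open>f \<circ> T\<close>.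
\<close>

lemma operator_predual0_weakly_summable:
  assumes p: "1 \<le> p" and T: "ns_operator (predual0 p) smul T"
  shows "weakly_p_summable smul p (\<lambda>n. T (unit_seq n))"
  unfolding weakly_p_summable_def
proof
  fix f assume f: "f \<in> top_dual smul"
  note ns = predual0_normed_space[OF p]
  have g: "ns_operator (seq_space span_unit_seq (predual_norm p)) (*) (f \<circ> T)"
    using functional_comp[OF T f] by (simp add: predual0_eq)
  obtain C where C0: "C \<ge> 0"
    and C': "\<And>a. a \<in> ns_carrier (seq_space span_unit_seq (predual_norm p)) \<Longrightarrow>
      norm ((f \<circ> T) a) \<le> C * ns_norm (seq_space span_unit_seq (predual_norm p)) a"
    by (rule normed_space.functional_bound[OF ns g]) blast
  have C: "norm (f (T a)) \<le> C * predual_norm p a" if "a \<in> span_unit_seq" for a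
    using C'[of a] that by simp
  show "(\<lambda>n. f (T (unit_seq n))) \<in> lp_set p"
  proof (rule lp_normI(1)[OF p C0])
    fix m
    let ?\<Sigma> = "\<Sum>i<m. norm (f (T (unit_seq i))) powr p"
    obtain b where b: "b \<in> span_unit_seq" "\<And>i. i \<notin> {..<m} \<Longrightarrow> b i = 0" "predual_norm p b \<le> 1"
      "(\<Sum>i<m. b i * f (T (unit_seq i))) = of_real (?\<Sigma> powr (1 / p))"
      using Hoelder_predual_attained[OF p, of "{..<m}" "\<lambda>i. f (T (unit_seq i))"] by blast
    have "f (T b) = of_real (?\<Sigma> powr (1 / p))"
      using functional_finite_support[OF ns g, of "{..<m}" b] b(2,4) by simp
    then have "?\<Sigma> powr (1 / p) = norm (f (T b))" by (simp only: norm_of_real) simp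
    also have "\<dots> \<le> C" using C[OF b(1)] mult_left_mono[OF b(3) C0] by simp
    finally have "(?\<Sigma> powr (1 / p)) powr p \<le> C powr p" using p by (intro powr_mono2) auto
    then show "?\<Sigma> \<le> C powr p" using p by (simp add: powr_powr sum_nonneg)
  qed
qed

lemma sum_consecutive_blocks:
  fixes g :: "nat \<Rightarrow> 'a::comm_monoid_add"
  assumes "m 0 = 0" "\<And>k. m k \<le> m (Suc k)"
  shows "(\<Sum>k<K. \<Sum>i\<in>{m k..<m (Suc k)}. g i) = (\<Sum>i<m K. g i)"
proof (induction K)
  case (Suc K)
  have "(\<Sum>i<m (Suc K). g i) = (\<Sum>i<m K. g i) + (\<Sum>i\<in>{m K..<m (Suc K)}. g i)"
    using sum.atLeastLessThan_concat[of 0 "m K" "m (Suc K)" g] assms(2)[of K]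
    by (simp add: atLeast0LessThan)
  then show ?case using Suc by simp
qed (use assms(1) in simp)

lemma adjoint_predual0_image:
  "seq_of_functional ` ns_adjoint (predual0 p) T ` B = (\<lambda>f n. f (T (unit_seq n))) ` B"
  by (auto simp: image_image seq_of_functional_def ns_adjoint_def predual0_eq unit_seq_in_span)

lemma adjoint_predual_image:
  fixes T :: "(nat \<Rightarrow> 'k::real_or_complex) \<Rightarrow> 'e"
  shows
  "seq_of_functional ` ns_adjoint (predual p) T ` B = (\<lambda>f n. f (T (unit_seq n))) ` B"
proof -
  have "(unit_seq n :: nat \<Rightarrow> 'k) \<in> predual_set p" for n
    using unit_seq_in_span span_unit_seq_subset_predual by blast
  then show ?thesis by (simp add: image_image seq_of_functional_def ns_adjoint_def predual_eq)
qed

text \<open>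
  The block argument. Blocks \<open>I\<^sub>k\<close> on which functionals \<open>g\<^sub>k \<in> B\<close> keep \<open>p\<close>-th power sums above \<open>\<epsilon>\<close> give
  vectors \<open>b\<^sub>k\<close> supported in \<open>I\<^sub>k\<close> such that \<open>(T b\<^sub>k)\<^sub>k\<close> is weakly \<open>p\<close>-summable but not uniformly null on \<open>B\<close>.
\<close>

lemma p_V_set_imp_relatively_compact:
  fixes smul :: "'k::real_or_complex \<Rightarrow> 'e::{topological_ab_group_add, t2_space} \<Rightarrow> 'e"
  assumes p: "1 \<le> p" and B: "p_V_set smul p B" and bnd: "\<And>x. \<exists>M. \<forall>f\<in>B. norm (f x) \<le> M"
    and T: "ns_operator (predual0 p) smul T"
  shows "ns_relatively_compact (lp_space p) ((\<lambda>f n. f (T (unit_seq n))) ` B)"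
proof (rule lp_relatively_compactI[OF p])
  note ns = predual0_normed_space[OF p]
  define x where "x n = T (unit_seq n)" for n
  have wps: "f \<in> top_dual smul \<Longrightarrow> (\<lambda>n. f (x n)) \<in> lp_set p" for f
    using operator_predual0_weakly_summable[OF p T] by (simp add: weakly_p_summable_def x_def)
  have Bd: "B \<subseteq> top_dual smul" using B by (simp add: p_V_set_iff)
  show "(\<lambda>f n. f (T (unit_seq n))) ` B \<subseteq> lp_set p" using wps Bd by (auto simp: x_def)
  show "\<exists>M. \<forall>s\<in>(\<lambda>f n. f (T (unit_seq n))) ` B. norm (s i) \<le> M" for i
    using bnd[of "T (unit_seq i)"] by auto
  fix \<epsilon> :: real assume \<epsilon>: "\<epsilon> > 0"
  show "\<exists>m. \<forall>s\<in>(\<lambda>f n. f (T (unit_seq n))) ` B. \<forall>n. (\<Sum>i\<in>{m..<n}. norm (s i) powr p) \<le> \<epsilon>"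
  proof (rule ccontr)
    assume "\<not> ?thesis"
    then have "\<forall>m. \<exists>f n. f \<in> B \<and> \<epsilon> < (\<Sum>i\<in>{m..<n}. norm (f (x i)) powr p)"
      by (simp add: x_def not_le) blast
    then obtain f n where fB: "\<And>m. f m \<in> B"
      and big: "\<And>m. \<epsilon> < (\<Sum>i\<in>{m..<n m}. norm (f m (x i)) powr p)" by metis
    have less: "m < n m" for m using big[of m] \<epsilon> by (cases "m < n m") auto
    \<comment> \<open>Each block ends where the next one begins, so that the blocks partition the indices.\<close>
    define m where "m k = (n ^^ k) 0" for k
    have m0: "m 0 = 0" and mS: "m (Suc k) = n (m k)" for k by (simp_all add: m_def)
    define I where "I k = {m k..<m (Suc k)}" for k
    define g where "g k = f (m k)" for k
    have gB: "g k \<in> B" for k by (simp add: g_def fB)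
    have gbig: "\<epsilon> < (\<Sum>i\<in>I k. norm (g k (x i)) powr p)" for k
      using big[of "m k"] by (simp add: I_def g_def mS)
    let ?P = "\<lambda>k b. b \<in> span_unit_seq \<and> (\<forall>i. i \<notin> I k \<longrightarrow> b i = 0) \<and> predual_norm p b \<le> 1 \<and>
        (\<Sum>i\<in>I k. b i * g k (x i)) = of_real ((\<Sum>i\<in>I k. norm (g k (x i)) powr p) powr (1 / p))"
    have "\<exists>b. ?P k b" for k
      by (rule Hoelder_predual_attained[OF p, of "I k" "\<lambda>i. g k (x i)"]) (auto simp: I_def)
    then have "\<forall>k. \<exists>b. ?P k b" ..
    from choice[OF this] obtain b where b': "\<forall>k. ?P k (b k)" ..
    have b: "b k \<in> span_unit_seq" "i \<notin> I k \<Longrightarrow> b k i = 0" "predual_norm p (b k) \<le> 1"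
      "(\<Sum>i\<in>I k. b k i * g k (x i)) = of_real ((\<Sum>i\<in>I k. norm (g k (x i)) powr p) powr (1 / p))"
      for k i using b'[rule_format, of k] by simp_all
    have eval: "h (T (b k)) = (\<Sum>i\<in>I k. b k i * h (x i))" if "h \<in> top_dual smul" for h k
      using functional_finite_support[OF ns, of "h \<circ> T" "I k" "b k"] functional_comp[OF T that] b(2)
      by (simp add: predual0_eq x_def I_def)
    have "weakly_p_summable smul p (\<lambda>k. T (b k))"
      unfolding weakly_p_summable_def
    proof
      fix h assume h: "h \<in> top_dual smul"
      have le: "norm (h (T (b k))) powr p \<le> (\<Sum>i\<in>I k. norm (h (x i)) powr p)" for k
      proof -
        let ?\<Sigma> = "\<Sum>i\<in>I k. norm (h (x i)) powr p"
        have "norm (h (T (b k))) \<le> predual_norm p (b k) * ?\<Sigma> powr (1 / p)"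
          unfolding eval[OF h] using b(1) span_unit_seq_subset_predual
          by (intro Hoelder_predual[OF p]) (auto simp: I_def)
        also have "\<dots> \<le> ?\<Sigma> powr (1 / p)" using mult_right_mono[OF b(3)[of k], of "?\<Sigma> powr (1 / p)"] by simp
        finally have "norm (h (T (b k))) powr p \<le> (?\<Sigma> powr (1 / p)) powr p" using p by (intro powr_mono2) auto
        then show ?thesis using p by (simp add: powr_powr sum_nonneg)
      qed
      show "(\<lambda>k. h (T (b k))) \<in> lp_set p"
      proof (rule lp_normI(1)[OF p lp_norm_nonneg])
        fix K
        have "(\<Sum>k<K. norm (h (T (b k))) powr p) \<le> (\<Sum>k<K. \<Sum>i\<in>I k. norm (h (x i)) powr p)"
          by (rule sum_mono) (rule le)
        also have "\<dots> = (\<Sum>i<m K. norm (h (x i)) powr p)"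
          unfolding I_def by (rule sum_consecutive_blocks) (use m0 mS less in \<open>auto simp: less_imp_le\<close>)
        also have "\<dots> \<le> lp_norm p (\<lambda>i. h (x i)) powr p"
          by (rule lp_norm_sum_le[OF p wps[OF h]]) simp
        finally show "(\<Sum>k<K. norm (h (T (b k))) powr p) \<le> lp_norm p (\<lambda>i. h (x i)) powr p" .
      qed
    qed
    moreover have "\<epsilon> powr (1 / p) / 2 > 0" using \<epsilon> by simp
    ultimately obtain N where "\<forall>k\<ge>N. \<forall>f\<in>B. norm (f (T (b k))) \<le> \<epsilon> powr (1 / p) / 2"
      using B unfolding p_V_set_iff by blast
    then have small: "norm (g N (T (b N))) \<le> \<epsilon> powr (1 / p) / 2" using gB by blast
    have "\<epsilon> powr (1 / p) \<le> (\<Sum>i\<in>I N. norm (g N (x i)) powr p) powr (1 / p)"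
      using gbig[of N] \<epsilon> p by (intro powr_mono2) auto
    also have "\<dots> = norm (g N (T (b N)))"
      using eval[of "g N" N] gB Bd b(4)[of N] by (auto simp: subset_iff)
    finally show False using small \<open>\<epsilon> powr (1 / p) / 2 > 0\<close> by simp
  qed
qed

lemma relatively_compact_imp_uniformly_null:
  fixes A :: "(nat \<Rightarrow> 'k::real_or_complex) set"
  assumes p: "1 \<le> p" and A: "ns_relatively_compact (lp_space p) A" and \<epsilon>: "\<epsilon> > 0"
  shows "\<exists>N. \<forall>n\<ge>N. \<forall>a\<in>A. norm (a n) \<le> \<epsilon>"
proof (rule uniformly_null_from_finite_nets[OF _ _ \<epsilon>])
  interpret L: normed_space "lp_space p :: ('k, _) nspace"
    unfolding lp_space_def by (rule lp_normed_space[OF p])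
  have sub: "A \<subseteq> lp_set p" using A by (simp add: ns_relatively_compact_def lp_space_def)
  show "a \<longlonglongrightarrow> 0" if "a \<in> A" for a using that sub lp_tendsto_zero[OF p] by blast
  fix \<epsilon> :: real assume "\<epsilon> > 0"
  obtain K where K: "finite K" "K \<subseteq> A" "\<And>a. a \<in> A \<Longrightarrow> \<exists>b\<in>K. ns_dist (lp_space p) a b < \<epsilon>"
    using L.relatively_compact_imp_finite_net[OF A \<open>\<epsilon> > 0\<close>] by metis
  have "\<exists>b\<in>K. \<forall>n. norm (a n - b n) \<le> \<epsilon>" if a: "a \<in> A" for a
  proof -
    obtain b where b: "b \<in> K" "ns_dist (lp_space p) a b < \<epsilon>" using K(3)[OF a] by blast
    have ab: "a \<in> lp_set p" "b \<in> lp_set p" using a b K(2) sub by auto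
    have "lp_norm p (\<lambda>n. a n - b n) < \<epsilon>" using b(2) ab by (simp add: ns_dist_def lp_space_def)
    then have "norm (a n - b n) \<le> \<epsilon>" for n
      using lp_norm_component[OF p lp_diff[OF p ab], of n] by simp
    with b(1) show ?thesis by blast
  qed
  with K(1,2) show "\<exists>K. finite K \<and> K \<subseteq> A \<and> (\<forall>a\<in>A. \<exists>b\<in>K. \<forall>n. norm (a n - b n) \<le> \<epsilon>)" by blast
qed

section \<open>Adjoints of weakly sequentially precompact operators\<close>

text \<open>
  The usual greedy choice when there is no finite net, for a relation that need not come from a metric.
\<close>

lemma separated_sequence:
  assumes "\<And>F. finite F \<Longrightarrow> F \<subseteq> R \<Longrightarrow> \<exists>y\<in>R. \<forall>z\<in>F. far y z"
  obtains y :: "nat \<Rightarrow> 'a" where "\<And>n. y n \<in> R" "\<And>i n. i < n \<Longrightarrow> far (y n) (y i)"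
proof -
  have "\<exists>y. \<forall>n::nat. y n \<in> R \<and> (\<forall>i<n. far (y n) (y i))"
  proof (rule dependent_wellorder_choice[where P = "\<lambda>y (n::nat) r. r \<in> R \<and> (\<forall>i<n. far r (y i))"])
    show "(r \<in> R \<and> (\<forall>i<n. far r (y i))) = (r \<in> R \<and> (\<forall>i<n. far r (y' i)))"
      if "\<And>i. i < n \<Longrightarrow> y i = y' i" for r y y' and n :: nat
      using that by simp
  next
    fix n :: nat and y :: "nat \<Rightarrow> 'a" assume "\<And>m. m < n \<Longrightarrow> y m \<in> R \<and> (\<forall>i<m. far (y m) (y i))"
    then have "y ` {..<n} \<subseteq> R" by auto
    from assms[OF _ this] show "\<exists>r. r \<in> R \<and> (\<forall>i<n. far r (y i))" by auto
  qed
  with that show ?thesis by blast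
qed

text \<open>
  Finite nets of a ball for the seminorms \<open>sup\<^bsub>f \<in> B\<^esub> |f(T y)|\<close>, followed by a diagonal subsequence of
  functionals that converges at all points of the nets.
\<close>

lemma (in normed_space) p_V_set_imp_adjoint_relatively_compact:
  fixes smul :: "'k \<Rightarrow> 'e::{topological_ab_group_add, t2_space} \<Rightarrow> 'e"
  assumes B: "p_V_set smul p B" and bnd: "\<And>x. \<exists>M. \<forall>f\<in>B. norm (f x) \<le> M"
    and T: "weakly_seq_p_precompact_operator Y smul p T"
  shows "ns_relatively_compact (ns_dual Y) (ns_adjoint Y T ` B)"
proof -
  have Bd: "B \<subseteq> top_dual smul" using B by (simp add: p_V_set_iff)
  have op: "ns_operator Y smul T" using T by (simp add: weakly_seq_p_precompact_operator_def)
  obtain U where U: "openin ns.mtopology U" "ns_zero Y \<in> U" "weakly_seq_p_precompact smul p (T ` U)"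
    using T by (auto simp: weakly_seq_p_precompact_operator_def topology_eq)
  obtain \<delta> where \<delta>: "\<delta> > 0" "ns.mball (ns_zero Y) \<delta> \<subseteq> U"
    using U(1,2) unfolding ns.openin_mtopology by blast
  define R where "R = {y \<in> ns_carrier Y. ns_norm Y y < \<delta>}"
  have "y \<in> ns.mball (ns_zero Y) \<delta>" if "y \<in> R" for y
    using that by (simp add: R_def zero_closed ns.commute[of "ns_zero Y"] dist_self_zero)
  then have RU: "R \<subseteq> U" using \<delta>(2) by blast
  have net: "\<exists>F. finite F \<and> F \<subseteq> R \<and> (\<forall>y\<in>R. \<exists>z\<in>F. \<forall>f\<in>B. norm (f (T y) - f (T z)) \<le> \<epsilon>)"
    if \<epsilon>: "\<epsilon> > 0" for \<epsilon>
  proof (rule ccontr)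
    assume no_net: "\<not> ?thesis"
    define far where "far y z \<longleftrightarrow> (\<exists>f\<in>B. \<epsilon> < norm (f (T y) - f (T z)))" for y z
    have "\<exists>y\<in>R. \<forall>z\<in>F. far y z" if "finite F" "F \<subseteq> R" for F
    proof (rule ccontr)
      assume "\<not> ?thesis"
      then have "\<forall>y\<in>R. \<exists>z\<in>F. \<forall>f\<in>B. norm (f (T y) - f (T z)) \<le> \<epsilon>"
        by (simp add: far_def not_less)
      with that no_net show False by blast
    qed
    then obtain y :: "nat \<Rightarrow> 'y" where y: "\<And>n. y n \<in> R" "\<And>i n. i < n \<Longrightarrow> far (y n) (y i)"
      by (rule separated_sequence) (assumption | rule that)+
    have "range (\<lambda>n. T (y n)) \<subseteq> T ` U" using y(1) RU by blast
    then obtain r :: "nat \<Rightarrow> nat" where r: "strict_mono r" "weakly_p_Cauchy smul p ((\<lambda>n. T (y n)) \<circ> r)"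
      using U(3) unfolding weakly_seq_p_precompact_def by metis
    \<comment> \<open>The weak Cauchy condition compared along the indices \<open>n + 1\<close> and \<open>n\<close>.\<close>
    have "strict_mono Suc" "strict_mono (\<lambda>n::nat. n)" by (simp_all add: strict_mono_def)
    then have "weakly_p_summable smul p (\<lambda>n. T (y (r (Suc n))) - T (y (r n)))"
      using r(2) unfolding weakly_p_Cauchy_def comp_def by blast
    then obtain N where N: "\<forall>n\<ge>N. \<forall>f\<in>B. norm (f (T (y (r (Suc n))) - T (y (r n)))) \<le> \<epsilon>"
      using B \<epsilon> unfolding p_V_set_iff by blast
    have "r N < r (Suc N)" using r(1) by (simp add: strict_mono_def)
    from y(2)[OF this] obtain f where f: "f \<in> B" "\<epsilon> < norm (f (T (y (r (Suc N)))) - f (T (y (r N))))"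
      by (auto simp: far_def)
    have "Vector_Spaces.linear smul (*) f" using f(1) Bd by (auto simp: top_dual_def)
    then show False using N f linear_functionalD(3) by (metis not_le order_refl)
  qed
  interpret D: normed_space "ns_dual Y" by (rule dual_normed_space)
  have adj: "ns_adjoint Y T f \<in> ns_carrier (ns_dual Y)" if "f \<in> B" for f
  proof -
    have "ns_operator Y (*) (f \<circ> T)" using functional_comp[OF op] that Bd by blast
    then have "ns_operator Y (*) (ns_adjoint Y T f)"
      by (rule functional_cong) (simp add: ns_adjoint_def)
    then show ?thesis by (simp add: dual_carrier ns_adjoint_def)
  qed
  show ?thesis
  proof (rule D.relatively_compact_sequentially[OF dual_complete])
    show "ns_adjoint Y T ` B \<subseteq> ns_carrier (ns_dual Y)" using adj by blast
    fix \<sigma> :: "nat \<Rightarrow> 'y \<Rightarrow> 'k" assume "range \<sigma> \<subseteq> ns_adjoint Y T ` B"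
    then have "\<forall>n. \<exists>f. f \<in> B \<and> \<sigma> n = ns_adjoint Y T f" by blast
    from choice[OF this] obtain h where h: "\<And>n. h n \<in> B" "\<And>n. \<sigma> n = ns_adjoint Y T (h n)" by blast
    have "\<forall>k. \<exists>F. finite F \<and> F \<subseteq> R \<and>
        (\<forall>y\<in>R. \<exists>z\<in>F. \<forall>f\<in>B. norm (f (T y) - f (T z)) \<le> 1 / real (Suc k))"
      by (intro allI net) simp
    from choice[OF this] obtain F where F: "\<And>k. finite (F k)" "\<And>k. F k \<subseteq> R"
      "\<And>k y. y \<in> R \<Longrightarrow> \<exists>z\<in>F k. \<forall>f\<in>B. norm (f (T y) - f (T z)) \<le> 1 / real (Suc k)" by blast
    have "countable (\<Union>k. F k)" using F(1) by (intro countable_UN) (auto intro: countable_finite)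
    moreover have "\<exists>M. \<forall>n. norm (h n (T z)) \<le> M" for z using bnd[of "T z"] h(1) by blast
    ultimately obtain r :: "nat \<Rightarrow> nat" where r: "strict_mono r"
      "\<And>z. z \<in> (\<Union>k. F k) \<Longrightarrow> convergent (\<lambda>n. h (r n) (T z))"
      by (rule pointwise_convergent_subsequence[of _ "\<lambda>n z. h n (T z)"]) blast
    have "\<exists>N. \<forall>m\<ge>N. \<forall>n\<ge>N. ns_dist (ns_dual Y) (\<sigma> (r m)) (\<sigma> (r n)) < \<epsilon>" if \<epsilon>: "\<epsilon> > 0" for \<epsilon>
    proof -
      \<comment> \<open>A bound \<open>3 * \<eta>\<close> on the ball of radius \<open>\<delta>\<close>, tested at points of norm \<open>\<delta> / 2\<close>, becomes \<open>\<epsilon> / 2\<close>.\<close>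
      define \<eta> where "\<eta> = \<epsilon> * \<delta> / 12"
      have \<eta>: "\<eta> > 0" using \<epsilon> \<delta>(1) by (simp add: \<eta>_def)
      obtain k where k: "1 / real (Suc k) < \<eta>" using nat_approx_posE[OF \<eta>] by blast
      have "\<forall>z\<in>F k. \<exists>N. \<forall>m\<ge>N. \<forall>n\<ge>N. norm (h (r m) (T z) - h (r n) (T z)) < \<eta>"
        using CauchyD[OF convergent_Cauchy[OF r(2)] \<eta>] by blast
      from bchoice[OF this] obtain N where
        N: "\<And>z m n. z \<in> F k \<Longrightarrow> m \<ge> N z \<Longrightarrow> n \<ge> N z \<Longrightarrow> norm (h (r m) (T z) - h (r n) (T z)) < \<eta>"
        by blast
      have "ns_dist (ns_dual Y) (\<sigma> (r m)) (\<sigma> (r n)) < \<epsilon>"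
        if mn: "m \<ge> (\<Sum>z\<in>F k. N z)" "n \<ge> (\<Sum>z\<in>F k. N z)" for m n
      proof -
        let ?f = "h (r m)" and ?g = "h (r n)"
        have onR: "norm (?f (T y) - ?g (T y)) \<le> 3 * \<eta>" if "y \<in> R" for y
        proof -
          obtain z where z: "z \<in> F k" "\<forall>f\<in>B. norm (f (T y) - f (T z)) \<le> 1 / real (Suc k)"
            using F(3)[OF \<open>y \<in> R\<close>] by blast
          have "N z \<le> (\<Sum>z\<in>F k. N z)" using z(1) F(1) by (intro member_le_sum) auto
          then have "norm (?f (T z) - ?g (T z)) < \<eta>" using mn by (intro N z) auto
          moreover have "norm (?f (T y) - ?f (T z)) \<le> \<eta>" "norm (?g (T y) - ?g (T z)) \<le> \<eta>"
            using z(2) h(1) k by (meson less_imp_le order_trans)+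
          moreover have "norm (?f (T y) - ?g (T y))
              = norm ((?f (T y) - ?f (T z)) + (?f (T z) - ?g (T z)) - (?g (T y) - ?g (T z)))" by simp
          ultimately show ?thesis
            using norm_triangle_ineq4[of "(?f (T y) - ?f (T z)) + (?f (T z) - ?g (T z))" "?g (T y) - ?g (T z)"]
              norm_triangle_ineq[of "?f (T y) - ?f (T z)" "?f (T z) - ?g (T z)"] by linarith
        qed
        have "ns_dist (ns_dual Y) (\<sigma> (r m)) (\<sigma> (r n)) \<le> \<epsilon> / 2"
        proof (rule dual_dist_le)
          show "\<sigma> (r m) \<in> ns_carrier (ns_dual Y)" "\<sigma> (r n) \<in> ns_carrier (ns_dual Y)"
            by (simp_all add: h adj)
          fix y assume y: "y \<in> ns_carrier Y" "ns_norm Y y \<le> 1"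
          let ?c = "of_real (\<delta> / 2) :: 'k"
          have nc: "norm ?c = \<delta> / 2" using \<delta>(1) by (simp only: norm_of_real)
          have "\<delta> / 2 * ns_norm Y y \<le> \<delta> / 2 * 1" using y(2) \<delta>(1) by (intro mult_left_mono) auto
          then have "ns_scale Y ?c y \<in> R"
            using y(1) \<delta>(1) nc unfolding R_def by (simp only: mem_Collect_eq norm_scale scale_closed) simp
          moreover have ev: "f (T (ns_scale Y ?c y)) = ?c * f (T y)" if "f \<in> B" for f
            using functional_comp[OF op, of f] that Bd y(1) by (auto simp: ns_operator_def)
          ultimately have "norm (?c * (?f (T y) - ?g (T y))) \<le> 3 * \<eta>"
            using onR[of "ns_scale Y ?c y"] by (simp only: ev[OF h(1)] right_diff_distrib)
          then have "\<delta> / 2 * norm (?f (T y) - ?g (T y)) \<le> 3 * \<eta>" by (simp only: norm_mult nc)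
          then have "norm (?f (T y) - ?g (T y)) \<le> \<epsilon> / 2" using \<delta>(1) by (simp add: \<eta>_def)
          then show "norm (\<sigma> (r m) y - \<sigma> (r n) y) \<le> \<epsilon> / 2" using y(1) by (simp add: h(2) ns_adjoint_def)
        qed
        then show ?thesis using \<epsilon> by simp
      qed
      then show ?thesis by blast
    qed
    with r(1) show "\<exists>r :: nat \<Rightarrow> nat. strict_mono r \<and>
        (\<forall>\<epsilon>>0. \<exists>N. \<forall>m\<ge>N. \<forall>n\<ge>N. ns_dist (ns_dual Y) (\<sigma> (r m)) (\<sigma> (r n)) < \<epsilon>)" by blast
  qed
qed

section \<open>The unit ball of the absolutely summable sequences\<close>

lemma lp_dominated:
  assumes "1 \<le> r" "w \<in> lp_set r" "\<And>n. norm (u n) \<le> norm (w n)"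
  shows "u \<in> lp_set r"
proof (rule lp_normI(1)[OF assms(1) lp_norm_nonneg[of r w]])
  fix m
  have "(\<Sum>n<m. norm (u n) powr r) \<le> (\<Sum>n<m. norm (w n) powr r)"
    using assms(1,3) by (intro sum_mono powr_mono2) auto
  also have "\<dots> \<le> lp_norm r w powr r" by (rule lp_norm_sum_le[OF assms(1,2)]) simp
  finally show "(\<Sum>n<m. norm (u n) powr r) \<le> lp_norm r w powr r" .
qed

lemma geometric_in_lp:
  assumes "1 \<le> r"
  shows "(\<lambda>n. (1/2) ^ n :: real) \<in> lp_set r"
proof -
  have "norm ((1/2) ^ n :: real) powr r = ((1/2) powr r) ^ n" for n
    by (simp add: powr_realpow[symmetric] powr_powr mult.commute)
  moreover have "(1/2 :: real) powr r < 1"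
    using powr_less_mono2[of r "1/2" 1] assms by simp
  ultimately show ?thesis by (simp add: lp_set_def summable_geometric_iff)
qed

text \<open>
  A sequence in the unit ball of \<open>\<ell>\<^sub>1\<close> has a subsequence converging in every coordinate to some \<open>c\<close>, and
  the finite supports allow a faster one with cut points \<open>N\<^sub>n\<close>: before \<open>N\<^sub>n\<close> its \<open>n\<close>-th term is close to
  \<open>c\<close>, after \<open>N\<^bsub>n+1\<^esub>\<close> it vanishes, and \<open>c\<close> is small after \<open>N\<^sub>n\<close>. Up to small errors the differences to \<open>c\<close>
  live on disjoint blocks.
\<close>

lemma l1_ball_sequence:
  fixes a :: "nat \<Rightarrow> nat \<Rightarrow> 'k::real_or_complex"
  assumes span: "\<And>n. a n \<in> span_unit_seq" and ball: "\<And>n. lp_norm 1 (a n) \<le> 1"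
  obtains r :: "nat \<Rightarrow> nat" and c and N :: "nat \<Rightarrow> nat" where
    "strict_mono r" "N 0 = 0" "\<And>n. N n \<le> N (Suc n)"
    "\<And>m. (\<Sum>i<m. norm (c i)) \<le> 1"
    "\<And>n. (\<Sum>i<N n. norm (a (r n) i - c i)) \<le> (1/2) ^ n"
    "\<And>n m. (\<Sum>i\<in>{N n..<m}. norm (c i)) \<le> (1/2) ^ n"
    "\<And>n i. i \<ge> N (Suc n) \<Longrightarrow> a (r n) i = 0"
proof -
  have lp: "a n \<in> lp_set 1" for n using span span_unit_seq_subset_lp by blast
  have sum1: "(\<Sum>i<m. norm (a n i)) \<le> 1" for n m
    using lp_norm_sum_le[OF _ lp[of n], of "{..<m}"] ball[of n] lp_norm_nonneg[of 1 "a n"] by simp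
  have "norm (a n i) \<le> 1" for n i
    using lp_norm_component[OF _ lp[of n], of i] ball[of n] by simp
  then have "\<exists>M. \<forall>n. norm (a n i) \<le> M" for i by blast
  then obtain r0 :: "nat \<Rightarrow> nat" where r0: "strict_mono r0" "\<And>i. convergent (\<lambda>n. a (r0 n) i)"
    using pointwise_convergent_subsequence[of UNIV a] by auto
  define c where "c i = lim (\<lambda>n. a (r0 n) i)" for i
  have lim: "(\<lambda>n. a (r0 n) i) \<longlonglongrightarrow> c i" for i
    using r0(2)[of i] by (simp add: convergent_LIMSEQ_iff c_def)
  have c1: "(\<Sum>i<m. norm (c i)) \<le> 1" for m
  proof (rule LIMSEQ_le_const2)
    show "(\<lambda>n. \<Sum>i<m. norm (a (r0 n) i)) \<longlonglongrightarrow> (\<Sum>i<m. norm (c i))"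
      by (intro tendsto_intros lim)
  qed (use sum1 in blast)
  have smc: "summable (\<lambda>i. norm (c i))" by (rule summableI_nonneg_bounded[OF _ c1]) simp
  define P where "P n x \<longleftrightarrow> (n = 0 \<longrightarrow> snd x = 0) \<and>
      (\<Sum>i<snd x. norm (a (r0 (fst x)) i - c i)) \<le> (1/2) ^ n \<and>
      (\<forall>m. (\<Sum>i\<in>{snd x..<m}. norm (c i)) \<le> (1/2) ^ n)" for n and x :: "nat \<times> nat"
  define Q where "Q x y \<longleftrightarrow> fst x < fst y \<and> snd x \<le> snd y \<and> (\<forall>i\<ge>snd y. a (r0 (fst x)) i = 0)"
    for x y :: "nat \<times> nat"
  have "\<exists>f. \<forall>n. P n (f n) \<and> Q (f n) (f (Suc n))"
  proof (rule dependent_nat_choice)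
    show "\<exists>x. P 0 x"
      by (rule exI[of _ "(0, 0)"]) (simp add: P_def atLeast0LessThan c1)
  next
    fix x n assume "P n x"
    obtain t N where x: "x = (t, N)" by (cases x)
    define \<epsilon> :: real where "\<epsilon> = (1/2) ^ Suc n"
    have \<epsilon>: "\<epsilon> > 0" by (simp add: \<epsilon>_def)
    obtain N1 where N1: "\<And>m k. m \<ge> N1 \<Longrightarrow> norm (\<Sum>i\<in>{m..<k}. norm (c i)) < \<epsilon>"
      using smc[unfolded summable_Cauchy, rule_format, OF \<epsilon>] by blast
    have "finite {i. a (r0 t) i \<noteq> 0}" using span by (simp add: span_unit_seq_eq)
    then obtain N2 where N2: "\<forall>i\<in>{i. a (r0 t) i \<noteq> 0}. i < N2" using finite_nat_set_iff_bounded by blast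
    define N' where "N' = N + N1 + N2"
    have "(\<lambda>m. \<Sum>i<N'. norm (a (r0 m) i - c i)) \<longlonglongrightarrow> (\<Sum>i<N'. norm (c i - c i))"
      by (intro tendsto_intros lim)
    then have "(\<lambda>m. \<Sum>i<N'. norm (a (r0 m) i - c i)) \<longlonglongrightarrow> 0" by simp
    from LIMSEQ_D[OF this \<epsilon>] obtain M where
      M: "\<And>m. m \<ge> M \<Longrightarrow> norm ((\<Sum>i<N'. norm (a (r0 m) i - c i)) - 0) < \<epsilon>" by blast
    define t' where "t' = Suc (t + M)"
    have "(\<Sum>i<N'. norm (a (r0 t') i - c i)) \<le> \<epsilon>" using M[of t'] by (simp add: t'_def sum_nonneg)
    moreover have "(\<Sum>i\<in>{N'..<m}. norm (c i)) \<le> \<epsilon>" for m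
      using N1[of N' m] by (simp add: N'_def sum_nonneg)
    ultimately have "P (Suc n) (t', N')" by (simp add: P_def \<epsilon>_def)
    moreover have "Q x (t', N')"
      using N2 by (auto simp: Q_def x t'_def N'_def not_less[symmetric])
    ultimately show "\<exists>y. P (Suc n) y \<and> Q x y" by blast
  qed
  then obtain f where f: "\<And>n. P n (f n)" "\<And>n. Q (f n) (f (Suc n))" by blast
  show ?thesis
  proof (rule that[of "\<lambda>n. r0 (fst (f n))" "\<lambda>n. snd (f n)" c])
    have "strict_mono (\<lambda>n. fst (f n))" using f(2) by (simp add: strict_mono_Suc_iff Q_def)
    then show "strict_mono (\<lambda>n. r0 (fst (f n)))" using r0(1) by (simp add: strict_mono_def)
    show "snd (f 0) = 0" using f(1)[of 0] by (simp add: P_def)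
    show "snd (f n) \<le> snd (f (Suc n))" for n using f(2)[of n] by (simp add: Q_def)
    show "(\<Sum>i<m. norm (c i)) \<le> 1" for m by (rule c1)
    show "(\<Sum>i<snd (f n). norm (a (r0 (fst (f n))) i - c i)) \<le> (1/2) ^ n" for n
      using f(1)[of n] by (simp add: P_def)
    show "(\<Sum>i\<in>{snd (f n)..<m}. norm (c i)) \<le> (1/2) ^ n" for n m
      using f(1)[of n] by (simp add: P_def)
    show "a (r0 (fst (f n))) i = 0" if "i \<ge> snd (f (Suc n))" for n i
      using f(2)[of n] that by (simp add: Q_def)
  qed
qed

text \<open>
  On the \<open>n\<close>-th block the pairing with \<open>s\<close> is at most twice the \<open>\<ell>\<^sub>p\<close> norm \<open>\<beta>\<^sub>n\<close> of \<open>s\<close> there, and \<open>(\<beta>\<^sub>n)\<^sub>n\<close>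
  is in \<open>\<ell>\<^sub>p\<close> because the blocks are disjoint; outside it is geometrically small. The subsequence does
  not depend on \<open>s\<close>.
\<close>

lemma l1_ball_pairings:
  fixes a :: "nat \<Rightarrow> nat \<Rightarrow> 'k::real_or_complex"
  assumes p: "1 \<le> p" and span: "\<And>n. a n \<in> span_unit_seq" and ball: "\<And>n. lp_norm 1 (a n) \<le> 1"
  obtains r :: "nat \<Rightarrow> nat" where "strict_mono r"
    "\<And>s. s \<in> lp_set p \<Longrightarrow> \<exists>l. (\<lambda>n. (\<Sum>i. a (r n) i * s i) - l) \<in> lp_set p"
proof -
  obtain r :: "nat \<Rightarrow> nat" and c and N :: "nat \<Rightarrow> nat" where
    r: "strict_mono r" and N: "N 0 = 0" "\<And>n. N n \<le> N (Suc n)"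
    and c1: "\<And>m. (\<Sum>i<m. norm (c i)) \<le> 1"
    and head: "\<And>n. (\<Sum>i<N n. norm (a (r n) i - c i)) \<le> (1/2) ^ n"
    and ctail: "\<And>n m. (\<Sum>i\<in>{N n..<m}. norm (c i)) \<le> (1/2) ^ n"
    and zero: "\<And>n i. i \<ge> N (Suc n) \<Longrightarrow> a (r n) i = 0"
    by (rule l1_ball_sequence[of a, OF span ball]) (rule that; assumption)
  have lp: "a n \<in> lp_set 1" for n using span span_unit_seq_subset_lp by blast
  have a1: "(\<Sum>i<m. norm (a n i)) \<le> 1" for n m
    using lp_norm_sum_le[OF _ lp[of n], of "{..<m}"] ball[of n] lp_norm_nonneg[of 1 "a n"] by simp
  have "\<exists>l. (\<lambda>n. (\<Sum>i. a (r n) i * s i) - l) \<in> lp_set p" if s: "s \<in> lp_set p" for s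
  proof -
    define S where "S = lp_norm p s"
    have S0: "S \<ge> 0" and sS: "norm (s i) \<le> S" for i
      using lp_norm_nonneg lp_norm_component[OF p s] by (auto simp: S_def)
    define \<beta> where "\<beta> n = (\<Sum>i\<in>{N n..<N (Suc n)}. norm (s i) powr p) powr (1 / p)" for n
    have \<beta>0: "\<beta> n \<ge> 0" for n by (simp add: \<beta>_def)
    have \<beta>p: "\<beta> n powr p = (\<Sum>i\<in>{N n..<N (Suc n)}. norm (s i) powr p)" for n
      using p by (simp add: \<beta>_def powr_powr sum_nonneg)
    have s\<beta>: "norm (s i) \<le> \<beta> n" if "i \<in> {N n..<N (Suc n)}" for n i
    proof -
      have "norm (s i) powr p \<le> \<beta> n powr p"
        unfolding \<beta>p by (rule member_le_sum[OF that]) auto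
      then show ?thesis using p \<beta>0[of n] powr_less_mono2[of p "\<beta> n" "norm (s i)"]
        by (meson not_le less_le_trans zero_less_one)
    qed
    have \<beta>lp: "\<beta> \<in> lp_set p"
    proof (rule lp_normI(1)[OF p lp_norm_nonneg[of p s]])
      fix K
      have "(\<Sum>n<K. norm (\<beta> n) powr p) = (\<Sum>n<K. \<Sum>i\<in>{N n..<N (Suc n)}. norm (s i) powr p)"
        using \<beta>0 by (simp add: \<beta>p)
      also have "\<dots> = (\<Sum>i<N K. norm (s i) powr p)" by (rule sum_consecutive_blocks[OF N])
      also have "\<dots> \<le> lp_norm p s powr p" by (rule lp_norm_sum_le[OF p s]) simp
      finally show "(\<Sum>n<K. norm (\<beta> n) powr p) \<le> lp_norm p s powr p" .
    qed
    have w: "(\<lambda>n. 2 * S * (1/2) ^ n + 2 * \<beta> n) \<in> lp_set p"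
      using lp_Minkowski(1)[OF p lp_scale(1)[OF p geometric_in_lp[OF p], of "2 * S"] lp_scale(1)[OF p \<beta>lp, of 2]] .
    have main: "(\<Sum>i<m. norm ((a (r n) i - c i) * s i)) \<le> 2 * S * (1/2) ^ n + 2 * \<beta> n" for n m
    proof -
      let ?d = "\<lambda>i. norm (a (r n) i - c i)" and ?g = "\<lambda>i. norm ((a (r n) i - c i) * s i)"
      have g: "?g i = ?d i * norm (s i)" for i by (rule norm_mult)
      have "(\<Sum>i<m. ?g i) \<le> (\<Sum>i\<in>{..<N n} \<union> ({N n..<N (Suc n)} \<union> {N (Suc n)..<m}). ?g i)"
        by (rule sum_mono2) auto
      also have "\<dots> = (\<Sum>i<N n. ?g i) + (\<Sum>i\<in>{N n..<N (Suc n)} \<union> {N (Suc n)..<m}. ?g i)"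
        using N(2)[of n] by (intro sum.union_disjoint) auto
      also have "(\<Sum>i\<in>{N n..<N (Suc n)} \<union> {N (Suc n)..<m}. ?g i)
          = (\<Sum>i\<in>{N n..<N (Suc n)}. ?g i) + (\<Sum>i\<in>{N (Suc n)..<m}. ?g i)"
        by (intro sum.union_disjoint) auto
      finally have split: "(\<Sum>i<m. ?g i) \<le> (\<Sum>i<N n. ?g i)
          + ((\<Sum>i\<in>{N n..<N (Suc n)}. ?g i) + (\<Sum>i\<in>{N (Suc n)..<m}. ?g i))" .
      have "(\<Sum>i<N n. ?g i) \<le> (\<Sum>i<N n. ?d i * S)"
        unfolding g by (intro sum_mono mult_left_mono sS) auto
      also have "\<dots> = (\<Sum>i<N n. ?d i) * S" by (simp add: sum_distrib_right)
      also have "\<dots> \<le> (1/2) ^ n * S" by (intro mult_right_mono head S0)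
      finally have first: "(\<Sum>i<N n. ?g i) \<le> (1/2) ^ n * S" .
      have "(\<Sum>i\<in>{N n..<N (Suc n)}. ?d i) \<le> (\<Sum>i<N (Suc n). norm (a (r n) i) + norm (c i))"
        by (rule order_trans[OF sum_mono sum_mono2]) (auto intro: norm_triangle_ineq4)
      also have "\<dots> \<le> 1 + 1" unfolding sum.distrib by (intro add_mono a1 c1)
      finally have d2: "(\<Sum>i\<in>{N n..<N (Suc n)}. ?d i) \<le> 1 + 1" .
      have "(\<Sum>i\<in>{N n..<N (Suc n)}. ?g i) \<le> (\<Sum>i\<in>{N n..<N (Suc n)}. ?d i * \<beta> n)"
        unfolding g by (intro sum_mono mult_left_mono s\<beta>) auto
      also have "\<dots> = (\<Sum>i\<in>{N n..<N (Suc n)}. ?d i) * \<beta> n" by (simp add: sum_distrib_right)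
      also have "\<dots> \<le> (1 + 1) * \<beta> n" by (intro mult_right_mono d2 \<beta>0)
      finally have second: "(\<Sum>i\<in>{N n..<N (Suc n)}. ?g i) \<le> 2 * \<beta> n" by simp
      have "(\<Sum>i\<in>{N (Suc n)..<m}. ?g i) \<le> (\<Sum>i\<in>{N (Suc n)..<m}. norm (c i) * S)"
      proof (rule sum_mono)
        fix i assume "i \<in> {N (Suc n)..<m}"
        then show "?g i \<le> norm (c i) * S" using zero[of n i] mult_left_mono[OF sS, of "norm (c i)" i]
          by (simp add: norm_mult)
      qed
      also have "\<dots> = (\<Sum>i\<in>{N (Suc n)..<m}. norm (c i)) * S" by (simp add: sum_distrib_right)
      also have "\<dots> \<le> (1/2) ^ Suc n * S" by (intro mult_right_mono ctail S0)
      also have "\<dots> \<le> (1/2) ^ n * S" using S0 by (intro mult_right_mono) auto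
      finally have third: "(\<Sum>i\<in>{N (Suc n)..<m}. ?g i) \<le> (1/2) ^ n * S" .
      have "2 * S * (1/2) ^ n = (1/2) ^ n * S + (1/2) ^ n * S" by simp
      with split first second third show ?thesis by linarith
    qed
    have smd: "summable (\<lambda>i. norm ((a (r n) i - c i) * s i))" for n
      by (rule summableI_nonneg_bounded[OF _ main]) simp
    have sma: "summable (\<lambda>i. a (r n) i * s i)" for n
      by (rule summable_finite[of "{..<N (Suc n)}"]) (use zero in \<open>auto simp: not_less\<close>)
    define l where "l = (\<Sum>i. c i * s i)"
    have "norm ((\<Sum>i. a (r n) i * s i) - l) \<le> 2 * S * (1/2) ^ n + 2 * \<beta> n" for n
    proof -
      have "summable (\<lambda>i. a (r n) i * s i - (a (r n) i - c i) * s i)"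
        by (intro summable_diff sma summable_norm_cancel[OF smd])
      then have smc: "summable (\<lambda>i. c i * s i)" by (simp add: algebra_simps)
      have "(\<Sum>i. a (r n) i * s i) - l = (\<Sum>i. (a (r n) i - c i) * s i)"
        unfolding l_def suminf_diff[OF sma smc] by (simp add: algebra_simps)
      also have "norm \<dots> \<le> (\<Sum>i. norm ((a (r n) i - c i) * s i))" by (rule summable_norm[OF smd])
      also have "\<dots> \<le> 2 * S * (1/2) ^ n + 2 * \<beta> n" by (rule suminf_le_const[OF smd main])
      finally show ?thesis .
    qed
    then have "(\<lambda>n. (\<Sum>i. a (r n) i * s i) - l) \<in> lp_set p"
      by (intro lp_dominated[OF p w]) (simp add: order_trans[OF _ abs_ge_self])
    then show ?thesis by blast
  qed
  with r that show ?thesis by blast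
qed

text \<open>
  Subtracting the limit of the pairings shows that any two subsequences differ by a sequence in \<open>\<ell>\<^sub>p\<close>.
\<close>

lemma series_operator_l1_ball_precompact:
  fixes smul :: "'k::real_or_complex \<Rightarrow> 'e::{topological_ab_group_add, t2_space} \<Rightarrow> 'e"
  assumes p: "1 \<le> p" and vs: "vector_space smul" and x: "weakly_p_summable smul p x"
  shows "weakly_seq_p_precompact smul p (series_operator smul x ` {a \<in> span_unit_seq. lp_norm 1 a \<le> 1})"
  unfolding weakly_seq_p_precompact_def
proof (intro allI impI)
  let ?T = "series_operator smul x"
  fix y :: "nat \<Rightarrow> 'e" assume "range y \<subseteq> ?T ` {a \<in> span_unit_seq. lp_norm 1 a \<le> 1}"
  then have "\<forall>n. \<exists>a. a \<in> span_unit_seq \<and> lp_norm 1 a \<le> 1 \<and> y n = ?T a" by blast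
  from choice[OF this] obtain a where a: "\<And>n. a n \<in> span_unit_seq" "\<And>n. lp_norm 1 (a n) \<le> 1"
    "\<And>n. y n = ?T (a n)" by blast
  obtain r :: "nat \<Rightarrow> nat" where r: "strict_mono r"
    "\<And>s. s \<in> lp_set p \<Longrightarrow> \<exists>l. (\<lambda>n. (\<Sum>i. a (r n) i * s i) - l) \<in> lp_set p"
    by (rule l1_ball_pairings[of p a, OF p a(1,2)]) (rule that; assumption)
  have "weakly_p_Cauchy smul p (y \<circ> r)"
    unfolding weakly_p_Cauchy_def weakly_p_summable_def
  proof (intro allI impI ballI, elim conjE)
    fix k j :: "nat \<Rightarrow> nat" and f assume k: "strict_mono k" and j: "strict_mono j" and f: "f \<in> top_dual smul"
    have lin: "Vector_Spaces.linear smul (*) f" using f by (simp add: top_dual_def)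
    have s: "(\<lambda>i. f (x i)) \<in> lp_set p" using x f by (simp add: weakly_p_summable_def)
    have eval: "f (y n) = (\<Sum>i. a n i * f (x i))" for n
    proof -
      obtain m where m: "\<And>i. i \<ge> m \<Longrightarrow> a n i = 0" "?T (a n) = (\<Sum>i<m. smul (a n i) (x i))"
        using series_finite[OF vs a(1)] by metis
      have "f (y n) = (\<Sum>i<m. a n i * f (x i))" by (simp add: a(3) m(2) linear_functionalD[OF lin])
      also have "\<dots> = (\<Sum>i. a n i * f (x i))"
        by (rule suminf_finite[symmetric]) (use m(1) in \<open>auto simp: not_less\<close>)
      finally show ?thesis .
    qed
    obtain l where l: "(\<lambda>n. f (y (r n)) - l) \<in> lp_set p" using r(2)[OF s] by (auto simp: eval)
    have "(\<lambda>n. (f (y (r (k n))) - l) - (f (y (r (j n))) - l)) \<in> lp_set p"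
      by (rule lp_diff[OF p lp_subseq[OF p l k] lp_subseq[OF p l j]])
    then show "(\<lambda>n. f ((y \<circ> r) (k n) - (y \<circ> r) (j n))) \<in> lp_set p"
      by (simp add: linear_functionalD(3)[OF lin])
  qed
  with r(1) show "\<exists>r :: nat \<Rightarrow> nat. strict_mono r \<and> weakly_p_Cauchy smul p (y \<circ> r)" by blast
qed

text \<open>
  A copy of the space \<open>Z\<close> inside a sum type, so that a space of sequences becomes available at the type
  over which the normed spaces \<open>Y\<close> range.
\<close>

definition inr_space :: "('k, 'b) nspace \<Rightarrow> ('k, 'y + 'b) nspace" where
  "inr_space Z =
     \<lparr> ns_carrier = Inr ` ns_carrier Z,
       ns_zero = Inr (ns_zero Z),
       ns_add = (\<lambda>x y. Inr (ns_add Z (projr x) (projr y))),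
       ns_scale = (\<lambda>c x. Inr (ns_scale Z c (projr x))),
       ns_norm = (\<lambda>x. ns_norm Z (projr x)) \<rparr>"

lemma inr_space_simps [simp]:
  "ns_carrier (inr_space Z) = Inr ` ns_carrier Z" "ns_zero (inr_space Z) = Inr (ns_zero Z)"
  "ns_add (inr_space Z) (Inr x) (Inr y) = Inr (ns_add Z x y)"
  "ns_scale (inr_space Z) c (Inr x) = Inr (ns_scale Z c x)" "ns_norm (inr_space Z) (Inr x) = ns_norm Z x"
  by (simp_all add: inr_space_def)

lemma normed_space_inr_space:
  assumes "normed_space Z"
  shows "normed_space (inr_space Z)"
proof -
  interpret Z: normed_space Z by fact
  show ?thesis
  proof
    show "\<exists>y\<in>ns_carrier (inr_space Z). ns_add (inr_space Z) x y = ns_zero (inr_space Z)"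
      if "x \<in> ns_carrier (inr_space Z)" for x
      using that Z.add_inverse by auto
  qed (auto simp: Z.zero_closed Z.add_closed Z.scale_closed Z.add_assoc Z.add_zero Z.scale_one
      Z.scale_scale Z.scale_add_left Z.scale_add_right Z.norm_eq_zero Z.norm_nonneg Z.norm_triangle
      Z.norm_scale intro: Z.add_commute)
qed

text \<open>
  The test space is the span of the unit vectors in \<open>\<ell>\<^sub>1\<close>. Evaluation at the unit vectors, which lie in
  the unit ball, turns a finite net in the dual into a finite net in the supremum distance.
\<close>

lemma adjoint_relatively_compact_imp_p_V_set:
  fixes smul :: "'k::real_or_complex \<Rightarrow> 'e::{topological_ab_group_add, t2_space} \<Rightarrow> 'e"
  assumes p: "1 \<le> p" and lc: "locally_convex_space smul" and ne: "B \<noteq> {}" and Bd: "B \<subseteq> top_dual smul"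
    and comp: "\<And>(Y :: ('k, 'y + (nat \<Rightarrow> 'k)) nspace) T.
      normed_space Y \<Longrightarrow> weakly_seq_p_precompact_operator Y smul p T \<Longrightarrow>
      ns_relatively_compact (ns_dual Y) (ns_adjoint Y T ` B)"
  shows "p_V_set smul p B"
proof -
  interpret locally_convex_space smul by fact
  have vs: "vector_space smul" by (rule vector_space_axioms)
  let ?Z = "seq_space span_unit_seq (lp_norm 1) :: ('k, nat \<Rightarrow> 'k) nspace"
  define Y where "Y = (inr_space ?Z :: ('k, 'y + (nat \<Rightarrow> 'k)) nspace)"
  have nsZ: "normed_space ?Z"
    by (rule normed_space_seq_space_subset[OF lp_normed_space[of 1] span_unit_seq_subset_lp])
      (simp_all add: span_unit_seq_closed)
  have nsY: "normed_space Y" unfolding Y_def by (rule normed_space_inr_space[OF nsZ])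
  interpret Z: normed_space ?Z by (rule nsZ)
  interpret Y: normed_space Y by (rule nsY)
  have unit: "lp_norm 1 (unit_seq n :: nat \<Rightarrow> 'k) \<le> 1" for n
  proof (rule lp_normI(2))
    fix m
    have "(\<Sum>i<m. norm (unit_seq n i :: 'k) powr 1) = (\<Sum>i<m. if i = n then 1 else 0)"
      by (rule sum.cong) (auto simp: unit_seq_def)
    then show "(\<Sum>i<m. norm (unit_seq n i :: 'k) powr 1) \<le> 1 powr 1" by simp
  qed auto
  have uniform: "\<exists>N. \<forall>n\<ge>N. \<forall>f\<in>B. norm (f (x n)) \<le> \<epsilon>"
    if x: "weakly_p_summable smul p x" and \<epsilon>: "\<epsilon> > 0" for x \<epsilon>
  proof -
    define T where "T = series_operator smul x"
    have bound: "\<exists>M. \<forall>a\<in>span_unit_seq. \<forall>n. norm (\<Sum>i<n. a i * s i) \<le> M * lp_norm 1 a"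
      if s: "s \<in> lp_set p" for s :: "nat \<Rightarrow> 'k"
    proof -
      have "norm (\<Sum>i<n. a i * s i) \<le> lp_norm p s * lp_norm 1 a" if "a \<in> span_unit_seq" for a n
      proof -
        have a: "a \<in> lp_set 1" using that span_unit_seq_subset_lp by blast
        have "norm (\<Sum>i<n. a i * s i) \<le> (\<Sum>i<n. norm (a i) * lp_norm p s)"
          by (rule order_trans[OF norm_sum sum_mono])
            (simp add: norm_mult mult_left_mono lp_norm_component[OF p s])
        also have "\<dots> = (\<Sum>i<n. norm (a i)) * lp_norm p s" by (simp add: sum_distrib_right)
        also have "\<dots> \<le> lp_norm 1 a * lp_norm p s"
          using lp_norm_sum_le[OF _ a, of "{..<n}"] lp_norm_nonneg[of 1 a]
          by (intro mult_right_mono lp_norm_nonneg) simp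
        finally show ?thesis by (simp add: mult.commute)
      qed
      then show ?thesis by blast
    qed
    have conv: "convergent (\<lambda>n. \<Sum>i<n. smul (a i) (x i))" if "a \<in> span_unit_seq" for a
      by (rule series_finite[OF vs that]) (auto simp: convergent_def)
    have TZ: "ns_operator ?Z smul T"
      unfolding T_def by (rule series_operator_is_operator(1)[OF lc nsZ bound x conv])
    have Tq: "\<exists>K. \<forall>a\<in>span_unit_seq. q (T a) \<le> K * lp_norm 1 a" if "continuous_seminorm smul q" for q
      unfolding T_def by (rule series_operator_is_operator(2)[OF lc nsZ bound x conv]) (use that in auto)
    have op: "ns_operator Y smul (T \<circ> projr)"
    proof (rule Y.operator_into_locally_convexI[OF lc])
      show "(T \<circ> projr) (ns_add Y a b) = (T \<circ> projr) a + (T \<circ> projr) b"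
        if "a \<in> ns_carrier Y" "b \<in> ns_carrier Y" for a b
        using that TZ by (auto simp: Y_def ns_operator_def)
      show "(T \<circ> projr) (ns_scale Y c a) = smul c ((T \<circ> projr) a)" if "a \<in> ns_carrier Y" for c a
        using that TZ by (auto simp: Y_def ns_operator_def)
      show "\<exists>C. \<forall>y\<in>ns_carrier Y. q ((T \<circ> projr) y) \<le> C * ns_norm Y y" if "continuous_seminorm smul q" for q
        using Tq[OF that] by (simp add: Y_def)
    qed
    have zball: "Y.ns.mball (ns_zero Y) 1 \<subseteq> Inr ` {a \<in> span_unit_seq. lp_norm 1 a \<le> 1}"
    proof
      fix y assume "y \<in> Y.ns.mball (ns_zero Y) 1"
      then have "y \<in> ns_carrier Y" "ns_norm Y y < 1"
        using Y.dist_self_zero[of y] Y.ns.commute[of y] by auto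
      then show "y \<in> Inr ` {a \<in> span_unit_seq. lp_norm 1 a \<le> 1}" by (auto simp: Y_def)
    qed
    have "(T \<circ> projr) ` Y.ns.mball (ns_zero Y) 1 \<subseteq> T ` {a \<in> span_unit_seq. lp_norm 1 a \<le> 1}"
    proof
      fix z assume "z \<in> (T \<circ> projr) ` Y.ns.mball (ns_zero Y) 1"
      then obtain y where "y \<in> Y.ns.mball (ns_zero Y) 1" "z = (T \<circ> projr) y" by (rule imageE)
      with zball show "z \<in> T ` {a \<in> span_unit_seq. lp_norm 1 a \<le> 1}" by auto
    qed
    then have "weakly_seq_p_precompact smul p ((T \<circ> projr) ` Y.ns.mball (ns_zero Y) 1)"
      using series_operator_l1_ball_precompact[OF p vs x, folded T_def]
      unfolding weakly_seq_p_precompact_def by (meson order_trans)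
    moreover have "openin (ns_topology Y) (Y.ns.mball (ns_zero Y) 1)" "ns_zero Y \<in> Y.ns.mball (ns_zero Y) 1"
      by (simp_all add: Y.topology_eq Y.ns.openin_mball Y.zero_closed)
    ultimately have "weakly_seq_p_precompact_operator Y smul p (T \<circ> projr)"
      using op unfolding weakly_seq_p_precompact_operator_def by blast
    from comp[OF nsY this] have rc: "ns_relatively_compact (ns_dual Y) (ns_adjoint Y (T \<circ> projr) ` B)" .
    interpret D: normed_space "ns_dual Y" by (rule Y.dual_normed_space)
    define e where "e n = (Inr (unit_seq n) :: 'y + (nat \<Rightarrow> 'k))" for n
    have e: "e n \<in> ns_carrier Y" "ns_norm Y (e n) \<le> 1" for n
      by (auto simp: e_def Y_def unit_seq_in_span unit)
    define \<Phi> where "\<Phi> g n = g (e n)" for g :: "'y + (nat \<Rightarrow> 'k) \<Rightarrow> 'k" and n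
    have \<Phi>: "\<Phi> (ns_adjoint Y (T \<circ> projr) f) = (\<lambda>n. f (x n))" for f
      using e(1) by (auto simp: \<Phi>_def ns_adjoint_def e_def T_def series_operator_unit_seq[OF vs])
    have "\<exists>N. \<forall>n\<ge>N. \<forall>s\<in>\<Phi> ` ns_adjoint Y (T \<circ> projr) ` B. norm (s n) \<le> \<epsilon>"
    proof (rule uniformly_null_from_finite_nets[OF _ _ \<epsilon>])
      show "s \<longlonglongrightarrow> 0" if "s \<in> \<Phi> ` ns_adjoint Y (T \<circ> projr) ` B" for s
        using that x Bd by (auto simp: \<Phi> weakly_p_summable_def subset_iff intro!: lp_tendsto_zero[OF p])
      fix \<eta> :: real assume \<eta>: "\<eta> > 0"
      let ?A = "ns_adjoint Y (T \<circ> projr) ` B"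
      obtain K where K: "finite K" "K \<subseteq> ?A" "\<And>g. g \<in> ?A \<Longrightarrow> \<exists>h\<in>K. ns_dist (ns_dual Y) g h < \<eta>"
        using D.relatively_compact_imp_finite_net[OF rc \<eta>] by metis
      have "\<exists>h\<in>\<Phi> ` K. \<forall>n. norm (s n - h n) \<le> \<eta>" if s: "s \<in> \<Phi> ` ?A" for s
      proof -
        obtain g where g: "g \<in> ?A" "s = \<Phi> g" using s by blast
        obtain h where h: "h \<in> K" "ns_dist (ns_dual Y) g h < \<eta>" using K(3)[OF g(1)] by blast
        have gh: "g \<in> ns_carrier (ns_dual Y)" "h \<in> ns_carrier (ns_dual Y)"
          using rc g(1) h(1) K(2) by (auto simp: ns_relatively_compact_def)
        have "norm (s n - \<Phi> h n) \<le> \<eta>" for n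
        proof -
          have "norm (g (e n) - h (e n)) \<le> ns_dist (ns_dual Y) g h * ns_norm Y (e n)"
            by (rule Y.dual_dist_bound[OF gh e(1)])
          also have "\<dots> \<le> ns_dist (ns_dual Y) g h"
            using e(2)[of n] by (simp add: mult_left_le)
          finally show ?thesis using h(2) by (simp add: g(2) \<Phi>_def)
        qed
        with h(1) show ?thesis by blast
      qed
      then have "\<forall>s\<in>\<Phi> ` ?A. \<exists>h\<in>\<Phi> ` K. \<forall>n. norm (s n - h n) \<le> \<eta>" by (rule ballI)
      moreover have "finite (\<Phi> ` K)" using K(1) by (rule finite_imageI)
      moreover have "\<Phi> ` K \<subseteq> \<Phi> ` ?A" using K(2) by (rule image_mono)
      ultimately show "\<exists>K. finite K \<and> K \<subseteq> \<Phi> ` ?A \<and> (\<forall>s\<in>\<Phi> ` ?A. \<exists>h\<in>K. \<forall>n. norm (s n - h n) \<le> \<eta>)"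
        by (intro exI[of _ "\<Phi> ` K"] conjI)
    qed
    then show ?thesis by (simp add: \<Phi>)
  qed
  with ne Bd show ?thesis by (simp add: p_V_set_iff)
qed

section \<open>The characterization of p-(V) sets\<close>

lemma relatively_compact_imp_p_V_set:
  assumes p: "1 \<le> p" and lc: "locally_convex_space smul" and ne: "B \<noteq> {}" and Bd: "B \<subseteq> top_dual smul"
    and comp: "\<And>x. weakly_p_summable smul p x \<Longrightarrow>
      ns_relatively_compact (lp_space p) ((\<lambda>f n. f (series_operator smul x (unit_seq n))) ` B)"
  shows "p_V_set smul p B"
proof -
  have vs: "vector_space smul" using lc by (simp add: locally_convex_space_def)
  have "\<exists>N. \<forall>n\<ge>N. \<forall>f\<in>B. norm (f (x n)) \<le> \<epsilon>" if "weakly_p_summable smul p x" "\<epsilon> > 0" for x \<epsilon>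
    using relatively_compact_imp_uniformly_null[OF p comp[OF that(1)] that(2)]
    by (simp add: series_operator_unit_seq[OF vs])
  with ne Bd show ?thesis by (simp add: p_V_set_iff)
qed

theorem theorem14p23:
  fixes smul :: "'k::real_or_complex \<Rightarrow> 'e::{topological_ab_group_add, t2_space} \<Rightarrow> 'e"
    and p :: real
    and B :: "('e \<Rightarrow> 'k) set"
  assumes "1 \<le> p"
    and "locally_convex_space smul"
    and "linf_Vp_barrelled smul p"
    and "B \<noteq> {}"
    and "weak_star_bounded smul B"
  shows
    "(p_V_set smul p B \<longleftrightarrow>
        (\<forall>(Y :: ('k, 'y + (nat \<Rightarrow> 'k)) nspace) T.
           normed_space Y \<and> weakly_seq_p_precompact_operator Y smul p T \<longrightarrow>
           ns_relatively_compact (ns_dual Y) (ns_adjoint Y T ` B))) \<and>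
     (p_V_set smul p B \<longleftrightarrow>
        (\<forall>T. ns_operator (predual0 p) smul T \<longrightarrow>
           ns_relatively_compact (lp_space p)
             (seq_of_functional ` ns_adjoint (predual0 p) T ` B))) \<and>
     (tvs_sequentially_complete TYPE('e) \<longrightarrow>
        (p_V_set smul p B \<longleftrightarrow>
          (\<forall>T. ns_operator (predual p) smul T \<longrightarrow>
             ns_relatively_compact (lp_space p)
               (seq_of_functional ` ns_adjoint (predual p) T ` B))))"
proof (intro conjI impI iffI allI; (elim conjE)?)
  note p = assms(1) and lc = assms(2) and ne = assms(4)
  have Bd: "B \<subseteq> top_dual smul" and bnd: "\<And>x. \<exists>M. \<forall>f\<in>B. norm (f x) \<le> M"
    using weak_star_bounded_pointwise[OF lc assms(5)] by blast+
  {
    fix Y :: "('k, 'y + (nat \<Rightarrow> 'k)) nspace" and T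
    assume "p_V_set smul p B" "normed_space Y" "weakly_seq_p_precompact_operator Y smul p T"
    then show "ns_relatively_compact (ns_dual Y) (ns_adjoint Y T ` B)"
      by (intro normed_space.p_V_set_imp_adjoint_relatively_compact bnd)
  next
    assume "\<forall>(Y :: ('k, 'y + (nat \<Rightarrow> 'k)) nspace) T.
        normed_space Y \<and> weakly_seq_p_precompact_operator Y smul p T \<longrightarrow>
        ns_relatively_compact (ns_dual Y) (ns_adjoint Y T ` B)"
    then show "p_V_set smul p B"
      by (intro adjoint_relatively_compact_imp_p_V_set[OF p lc ne Bd]) blast
  next
    fix T assume "p_V_set smul p B" "ns_operator (predual0 p) smul T"
    then show "ns_relatively_compact (lp_space p) (seq_of_functional ` ns_adjoint (predual0 p) T ` B)"
      unfolding adjoint_predual0_image by (intro p_V_set_imp_relatively_compact[OF p _ bnd])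
  next
    assume "\<forall>T. ns_operator (predual0 p) smul T \<longrightarrow>
        ns_relatively_compact (lp_space p) (seq_of_functional ` ns_adjoint (predual0 p) T ` B)"
    then show "p_V_set smul p B"
      unfolding adjoint_predual0_image
      by (intro relatively_compact_imp_p_V_set[OF p lc ne Bd]) (simp add: series_operator_predual0[OF p lc])
  next
    fix T assume pV: "p_V_set smul p B" and "ns_operator (predual p) smul T"
    then have "ns_operator (predual0 p) smul T"
      unfolding predual_eq predual0_eq
      by (intro operator_restrict[OF predual_normed_space[OF p] predual0_normed_space[OF p]
            span_unit_seq_subset_predual])
    with pV show "ns_relatively_compact (lp_space p) (seq_of_functional ` ns_adjoint (predual p) T ` B)"
      unfolding adjoint_predual_image by (intro p_V_set_imp_relatively_compact[OF p _ bnd])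
  next
    assume "tvs_sequentially_complete TYPE('e)"
      and "\<forall>T. ns_operator (predual p) smul T \<longrightarrow>
        ns_relatively_compact (lp_space p) (seq_of_functional ` ns_adjoint (predual p) T ` B)"
    then show "p_V_set smul p B"
      unfolding adjoint_predual_image
      by (intro relatively_compact_imp_p_V_set[OF p lc ne Bd]) (simp add: series_operator_predual[OF p lc])
  }
qed

end
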